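(* Let $d\ge1$, $\alpha,\beta\in[-1/2,\infty)^d$ and $1<p<\infty$, and let $\mathbf{R}=(R_1,\ldots,R_d)$ be the vector of Riesz transforms for Jacobi polynomial expansions with parameters $\alpha,\beta$ (defined in the context). Then for every $f\in L^p(X,\mu)$ satisfying $\int_Xf(y)\,d\mu(y)=0$ we have $$\|\mathbf{R}f\|_p\le24\,(p^*-1)\,\|f\|_p,\qquad p^*=\max\left(p,\frac{p}{p-1}\right).$$
   Context: All functions are real-valued, $\mathbb{N}=\{0,1,2,\ldots\}$. Let $X=(-1,1)^d$ and let $\mu=\mu_1\otimes\cdots\otimes\mu_d$ be the probability measure with $d\mu_i(x_i)=\frac{1}{C(\alpha_i,\beta_i)}(1-x_i)^{\alpha_i}(1+x_i)^{\beta_i}\,dx_i$ on $(-1,1)$, where $C(\alpha_i,\beta_i)$ is such that $\mu_i((-1,1))=1$. Write $L^p=L^p(X,\mu)$, and for vector-valued functions $\|\mathbf{g}\|_p=\big(\int_X|\mathbf{g}|^p\,d\mu\big)^{1/p}$ with $|\cdot|$ the Euclidean norm. Let $\tilde P_k^{\alpha,\beta}=\tilde P_{k_1}^{\alpha_1,\beta_1}\otimes\cdots\otimes\tilde P_{k_d}^{\alpha_d,\beta_d}$, $k\in\mathbb{N}^d$, where $\tilde P^{\alpha_i,\beta_i}_{k_i}$ is the Jacobi polynomial of degree $k_i$ normalized in $L^2((-1,1),\mu_i)$; these form an orthonormal basis of $L^2$. They are eigenfunctions of the Jacobi operator $L=\sum_{i=1}^d\big[-(1-x_i^2)\partial_{x_i}^2-(\beta_i-\alpha_i-(\alpha_i+\beta_i+2)x_i)\partial_{x_i}\big]=\sum_i\delta_i^*\delta_i$,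 where $\delta_i=\sqrt{1-x_i^2}\,\partial_{x_i}$, with eigenvalues $\lambda_k=\sum_{i=1}^dk_i(k_i+\alpha_i+\beta_i+1)$. The Riesz transforms are $R_if=\sum_{k\in\mathbb{N}^d,\,k\ne0}\lambda_k^{-1/2}\langle f,\tilde P_k^{\alpha,\beta}\rangle_{L^2}\,\delta_i\tilde P_k^{\alpha,\beta}$ for $f\in L^2$, and $\mathbf{R}f=(R_1f,\ldots,R_df)$. For $f\in L^p$, $\mathbf{R}f$ is understood as the continuous extension of $\mathbf{R}$ from the dense subspace of polynomials (existence of the extension is part of the claim). *)

theory Defs
  imports "HOL-Analysis.Analysis"
begin

definition Lp_space :: "'a measure \<Rightarrow> real \<Rightarrow> ('a \<Rightarrow> 'b::real_normed_vector) set" where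
  "Lp_space M p = {f \<in> borel_measurable M. integrable M (\<lambda>x. norm (f x) powr p)}"

definition Lp_norm :: "'a measure \<Rightarrow> real \<Rightarrow> ('a \<Rightarrow> 'b::real_normed_vector) \<Rightarrow> real" where
  "Lp_norm M p f = (\<integral>x. norm (f x) powr p \<partial>M) powr (1 / p)"

text \<open>
  Unconditional convergence of a series in \<open>L\<^sup>2\<close>. As elements of \<open>L\<^sup>p\<close> are represented by
  functions, the sum \<open>s\<close> is determined only up to null sets.
\<close>

definition has_L2_sum :: "'a measure \<Rightarrow> ('k \<Rightarrow> 'a \<Rightarrow> real) \<Rightarrow> ('a \<Rightarrow> real) \<Rightarrow> 'k set \<Rightarrow> bool" where
  "has_L2_sum M h s K \<longleftrightarrow>
     (\<forall>k\<in>K. h k \<in> Lp_space M 2) \<and> s \<in> Lp_space M 2 \<and>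
     ((\<lambda>F. Lp_norm M 2 (\<lambda>x. (\<Sum>k\<in>F. h k x) - s x)) \<longlongrightarrow> 0) (finite_subsets_at_top K)"

definition jacobi_weight :: "real \<Rightarrow> real \<Rightarrow> real \<Rightarrow> real" where
  "jacobi_weight a b x = (1 - x) powr a * (1 + x) powr b"

definition jacobi_const :: "real \<Rightarrow> real \<Rightarrow> real" where
  "jacobi_const a b = (LINT x:{-1<..<1}|lborel. jacobi_weight a b x)"

definition jacobi_measure1 :: "real \<Rightarrow> real \<Rightarrow> real measure" where
  "jacobi_measure1 a b =
     density (restrict_space lborel {-1<..<1}) (\<lambda>x. ennreal (jacobi_weight a b x / jacobi_const a b))"

definition open_cube :: "(real ^ 'n) set" where
  "open_cube = {x. \<forall>i. -1 < x $ i \<and> x $ i < 1}"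

text \<open>
  The product measure lives on functions \<open>'n \<Rightarrow> real\<close>; it is transported to \<open>real ^ 'n\<close> along the
  canonical identification.
\<close>

definition jacobi_measure :: "real ^ 'n \<Rightarrow> real ^ 'n \<Rightarrow> (real ^ 'n) measure" where
  "jacobi_measure \<alpha> \<beta> =
     distr (PiM UNIV (\<lambda>i. jacobi_measure1 (\<alpha> $ i) (\<beta> $ i))) (restrict_space borel open_cube)
       (\<lambda>x. \<chi> i. x i)"

text \<open>
  The classical Jacobi polynomial \<open>P\<^sub>n\<close> for the weight \<open>(1 - x)\<^sup>a (1 + x)\<^sup>b\<close>, in the form
  \<open>\<Sum>s\<le>n. binomial (n + a, n - s) binomial (n + b, s) ((x - 1)/2)\<^sup>s ((x + 1)/2)\<^sup>n\<^sup>-\<^sup>s\<close>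
  (Szegoe, Orthogonal Polynomials, (4.3.2)).
\<close>

definition jacobi_poly :: "real \<Rightarrow> real \<Rightarrow> nat \<Rightarrow> real \<Rightarrow> real" where
  "jacobi_poly a b n x =
     (\<Sum>s\<le>n. ((real n + a) gchoose (n - s)) * ((real n + b) gchoose s)
              * ((x - 1) / 2) ^ s * ((x + 1) / 2) ^ (n - s))"

definition jacobi_poly_normalized :: "real \<Rightarrow> real \<Rightarrow> nat \<Rightarrow> real \<Rightarrow> real" where
  "jacobi_poly_normalized a b n x =
     jacobi_poly a b n x / Lp_norm (jacobi_measure1 a b) 2 (jacobi_poly a b n)"

definition jacobi_basis :: "real ^ 'n \<Rightarrow> real ^ 'n \<Rightarrow> nat ^ 'n \<Rightarrow> real ^ 'n \<Rightarrow> real" where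
  "jacobi_basis \<alpha> \<beta> k x = (\<Prod>i\<in>UNIV. jacobi_poly_normalized (\<alpha> $ i) (\<beta> $ i) (k $ i) (x $ i))"

definition jacobi_eigenvalue :: "real ^ 'n \<Rightarrow> real ^ 'n \<Rightarrow> nat ^ 'n \<Rightarrow> real" where
  "jacobi_eigenvalue \<alpha> \<beta> k = (\<Sum>i\<in>UNIV. real (k $ i) * (real (k $ i) + \<alpha> $ i + \<beta> $ i + 1))"

definition jacobi_delta :: "'n \<Rightarrow> (real ^ 'n \<Rightarrow> real) \<Rightarrow> real ^ 'n \<Rightarrow> real" where
  "jacobi_delta i f x = sqrt (1 - (x $ i)\<^sup>2) * deriv (\<lambda>t. f (x + t *\<^sub>R axis i 1)) 0"

definition riesz_term ::
    "real ^ 'n \<Rightarrow> real ^ 'n \<Rightarrow> 'n \<Rightarrow> (real ^ 'n \<Rightarrow> real) \<Rightarrow> nat ^ 'n \<Rightarrow> real ^ 'n \<Rightarrow> real" where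
  "riesz_term \<alpha> \<beta> i f k x =
     jacobi_eigenvalue \<alpha> \<beta> k powr (- 1 / 2)
     * (\<integral>y. f y * jacobi_basis \<alpha> \<beta> k y \<partial>jacobi_measure \<alpha> \<beta>)
     * jacobi_delta i (jacobi_basis \<alpha> \<beta> k) x"

text \<open>
  \<open>has_riesz_transform \<alpha> \<beta> f g\<close>: the function \<open>g\<close> represents \<open>(R\<^sub>1 f, \<dots>, R\<^sub>d f)\<close>, for \<open>f\<close> in \<open>L\<^sup>2\<close>.
\<close>

definition has_riesz_transform ::
    "real ^ 'n \<Rightarrow> real ^ 'n \<Rightarrow> (real ^ 'n \<Rightarrow> real) \<Rightarrow> (real ^ 'n \<Rightarrow> real ^ 'n) \<Rightarrow> bool" where
  "has_riesz_transform \<alpha> \<beta> f g \<longleftrightarrow>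
     f \<in> Lp_space (jacobi_measure \<alpha> \<beta>) 2 \<and>
     (\<forall>i. has_L2_sum (jacobi_measure \<alpha> \<beta>) (riesz_term \<alpha> \<beta> i f) (\<lambda>x. g x $ i) {k. k \<noteq> 0})"

text \<open>
  \<open>T\<close> extends the vector of Riesz transforms continuously from the polynomials, which are dense, to
  \<open>L\<^sup>p\<close>; hence \<open>T f\<close> is determined up to null sets for every \<open>f\<close> in \<open>L\<^sup>p\<close>.
\<close>

definition riesz_extension ::
    "real ^ 'n \<Rightarrow> real ^ 'n \<Rightarrow> real \<Rightarrow> ((real ^ 'n \<Rightarrow> real) \<Rightarrow> real ^ 'n \<Rightarrow> real ^ 'n) \<Rightarrow> bool" where
  "riesz_extension \<alpha> \<beta> p T \<longleftrightarrow>
     (\<forall>f \<in> Lp_space (jacobi_measure \<alpha> \<beta>) p. T f \<in> Lp_space (jacobi_measure \<alpha> \<beta>) p) \<and>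
     (\<forall>f \<in> Lp_space (jacobi_measure \<alpha> \<beta>) p. \<forall>\<epsilon>>0. \<exists>\<delta>>0. \<forall>g \<in> Lp_space (jacobi_measure \<alpha> \<beta>) p.
        Lp_norm (jacobi_measure \<alpha> \<beta>) p (\<lambda>x. g x - f x) < \<delta> \<longrightarrow>
        Lp_norm (jacobi_measure \<alpha> \<beta>) p (\<lambda>x. T g x - T f x) < \<epsilon>) \<and>
     (\<forall>f. real_polynomial_function f \<longrightarrow> has_riesz_transform \<alpha> \<beta> f (T f))"

end

theory Submission
  imports Defs "HOL-Probability.Probability"
begin

text \<open>
  Polynomials \<open>f\<close> of mean zero are tested against \<open>g\<close> with \<open>g\<^sub>i = \<delta>\<^sub>i H\<^sub>i\<close>, \<open>H\<^sub>i\<close> a polynomial, so that the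
  Poisson extensions \<open>u = exp (- t \<surd>L) f\<close> and \<open>v\<^sub>i = \<delta>\<^sub>i exp (- t \<surd>L) H\<^sub>i\<close> are finite sums and
  \<open>\<langle>R f, g\<rangle> = - 4 \<integral> t \<langle>\<delta> u, \<partial>\<^sub>t v\<rangle> dt\<close>. For a smooth function \<open>B\<close> of the Nazarov--Volberg type,
  \<open>(\<partial>\<^sub>t\<^sup>2 - L) B(u, v) \<ge> 4 m |\<delta> u| |\<partial>\<^sub>t v|\<close> with \<open>1 / m = p\<^sup>* - 1\<close>; the commutators
  \<open>[\<delta>\<^sub>i, \<delta>\<^sub>i\<^sup>*] \<ge> 0\<close> have the right sign because \<open>\<alpha>, \<beta> \<ge> - 1 / 2\<close>. Integrating in \<open>x\<close> removes \<open>L\<close>, and since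
  \<open>b(t) = \<integral> B(u, v) d\<mu>\<close> is convex and bounded, \<open>4 m \<integral> t |\<langle>\<delta> u, \<partial>\<^sub>t v\<rangle>| dt \<le> b(0)\<close>. The upper bound
  \<open>3 |u|\<^sup>p + 18 |v|\<^sup>q\<close> (or with \<open>3\<close> and \<open>18\<close> exchanged) for \<open>B\<close> and optimal scaling give the constant
  \<open>21 (p\<^sup>* - 1)\<close> on polynomials, hence on \<open>L\<^sup>p\<close> by density. Everything is expressed through \<open>|u|\<^sup>2\<close> and \<open>|v|\<^sup>2\<close>,
  which are polynomials in \<open>x\<close>, so that no boundary terms occur.
\<close>

section \<open>The Bellman function\<close>

text \<open>The first argument of \<open>B\<close> carries the exponent P = 1 + 1/m \<ge> 2, the
  second the conjugate exponent Q = 1 + m. With 1/m = p* - 1 these are p and q if p \<ge> 2; for p <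
  2 the roles of u and v are exchanged, which the pairing does not notice. A Bellman function glued
  from two formulas along the curve r = s^m is in general only C^1 there and has to be mollified.
  Here a rational factor 1 / (1 + x^2 / 10) does the gluing, and \<open>B\<close> is smooth wherever
  r, s > 0; adding e > 0 to |u|^2 and |v|^2 keeps the powers away from their singularity at 0. The
  Hessian is not bounded below by a product at once: in each direction it dominates m (\<tau> A / 2
  + 8 B / \<tau>) with the same \<tau> for all directions. Such bounds can be added over time and
  the d coordinates, and only their sum is turned into 4 m sqrt(A B) by the arithmetic-geometric
  mean. This is why the constant is free of d. Mean zero removes the frequency 0, so that the
  extensions decay in t.\<close>

lemma quadratic_form_nonneg:
  fixes a b c p q :: real
  assumes "a > 0" "b\<^sup>2 \<le> a * c"
  shows "a * p\<^sup>2 + 2 * b * p * q + c * q\<^sup>2 \<ge> 0"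
proof -
  have "a * (a * p\<^sup>2 + 2 * b * p * q + c * q\<^sup>2) = (a * p + b * q)\<^sup>2 + (a * c - b\<^sup>2) * q\<^sup>2"
    by (simp add: power2_eq_square algebra_simps)
  also have "\<dots> \<ge> 0" using assms by simp
  finally show ?thesis using assms by (simp add: zero_le_mult_iff)
qed

text \<open>
  The Bellman function is \<open>s\<^sup>Q \<Psi>(r s\<^sup>-\<^sup>m)\<close> with \<open>Y = r\<^sup>2\<close>, \<open>Z = s\<^sup>2\<close>, \<open>P = 1 + 1/m\<close>, \<open>Q = 1 + m\<close> and
  \<open>\<Psi>(x) = 2 x\<^sup>P + 17 + m x\<^sup>2 / (1 + x\<^sup>2 / 10)\<close>. Below, \<open>c = 1 / (1 + x\<^sup>2 / 10)\<close>, and the scaling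
  \<open>\<tau> = Z powr ((1 - m) / 2)\<close> removes the dependence on \<open>s\<close>.
\<close>

lemma bellman_form_normalized:
  fixes m c \<xi> x A B p q :: real
  defines "P \<equiv> 1 + 1 / m"
  assumes m: "0 < m" "m \<le> 1" and c: "0 < c" "c < 1" and x: "x \<ge> 0" "x\<^sup>2 = 10 * (1 - c) / c"
    and \<xi>: "\<xi> \<ge> 0" "x\<^sup>2 \<ge> 1 \<Longrightarrow> \<xi> \<ge> 1" and A: "p\<^sup>2 \<le> A" and B: "q\<^sup>2 \<le> B"
  shows "4 * (P * (P - 2) / 2 * \<xi> - 2 * m * c\<^sup>2 * (1 - c)) * p\<^sup>2
    + 8 * x * m * ((1 + 3 * m) / 2 * c\<^sup>2 - 2 * m * c^3) * p * q
    + 4 * (17 * (1 + m) * (m - 1) / 4 + 10 * m * (1 - c) *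
        (- (1 + m) / 2 * ((1 + m) / 2 - m * c) + ((1 + m) / 2 - 2 * m * c) * m * (1 - c))) * q\<^sup>2
    + 2 * (P * \<xi> + m * c\<^sup>2) * A
    + 2 * (17 * (1 + m) / 2 + 10 * m * (1 - c) * ((1 + m) / 2 - m * c)) * B
    \<ge> m * (A / 2 + 8 * B)" (is "?L \<ge> _")
proof -
  have P2: "P \<ge> 2" using m by (simp add: P_def field_simps)
  have Pm: "P * (P - 1) = P / m" using m by (simp add: P_def field_simps)
  \<comment> \<open>\<open>a1\<close> and \<open>b1\<close> are the coefficients of \<open>A\<close>
    and \<open>B\<close> in the difference of the two sides. Once they are nonnegative,
    \<open>A\<close> and \<open>B\<close> may be lowered to \<open>p\<^sup>2\<close> and
    \<open>q\<^sup>2\<close>, and what is left is \<open>m\<close> times the quadratic form with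
    coefficients \<open>al\<close>, \<open>be\<close>, \<open>ga\<close>.\<close>
  define a1 where "a1 = 2 * (P * \<xi> + m * c\<^sup>2) - m / 2"
  define b1 where "b1 = 2 * (17 * (1 + m) / 2 + 10 * m * (1 - c) * ((1 + m) / 2 - m * c)) - 8 * m"
  define al where "al = 2 * P * \<xi> / m\<^sup>2 + 2 * c\<^sup>2 - 8 * c\<^sup>2 * (1 - c) - 1 / 2"
  define be where "be = 2 * x * c * ((1 - m) * c + m * (4 * (1 - c) * c))"
  define ga where "ga = 17 * (1 + m) - 8 + 10 * m * (1 - c) * ((1 + m) - 2 * c - 8 * m * c * (1 - c))"
  \<comment> \<open>The split at x = 1 decides which term of \<Psi> supplies the convexity in r: for
    x \<ge> 1 the power, whose weight is then \<xi> \<ge> 1; for x < 1 the rational term, with c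
    close to 1.\<close>
  have big: "c \<le> 10 / 11 \<longleftrightarrow> x\<^sup>2 \<ge> 1" using c by (simp add: x field_simps)
  have Pm2: "2 * P * \<xi> / m\<^sup>2 \<ge> 4 * \<xi>"
  proof -
    have "P / m\<^sup>2 \<ge> 2"
    proof -
      have "m\<^sup>2 \<le> 1" using m by (simp add: power_le_one)
      then have "2 * m\<^sup>2 \<le> P" using P2 by linarith
      then show ?thesis using m by (simp add: field_simps)
    qed
    from mult_right_mono[OF this \<xi>(1)] show ?thesis by simp
  qed
  have t1: "4 * (1 - c) * c \<le> 1" using sum_squares_ge_zero[of "2*c - 1" 0]
    by (simp add: algebra_simps power2_eq_square)
  have t0: "0 \<le> 4 * (1 - c) * c" using c by simp
  have k1: "(1 - m) * c + m * (4 * (1 - c) * c) \<le> 1"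
  proof -
    have "(1 - m) * c \<le> (1 - m) * 1" by (intro mult_left_mono) (use m c in auto)
    moreover have "m * (4 * (1 - c) * c) \<le> m * 1" by (intro mult_left_mono) (use m t1 in auto)
    ultimately have "(1 - m) * c + m * (4 * (1 - c) * c) \<le> (1 - m) * 1 + m * 1" by (rule add_mono)
    then show ?thesis by simp
  qed
  have k0: "0 \<le> (1 - m) * c + m * (4 * (1 - c) * c)" using m c t0 by simp
  have k2: "((1 - m) * c + m * (4 * (1 - c) * c))\<^sup>2 \<le> 1" using k0 k1 by (simp add: power_le_one)
  have a1: "a1 \<ge> 0"
  proof (cases "c \<le> 10 / 11")
    case True
    then have "\<xi> \<ge> 1" using big \<xi> by simp
    then have "P * \<xi> \<ge> 2 * 1" using P2 by (intro mult_mono) auto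
    then show ?thesis using m c by (simp add: a1_def) (smt (verit) zero_le_mult_iff zero_le_power2)
  next
    case False
    then have "c\<^sup>2 \<ge> (10/11)\<^sup>2" by (intro power_mono) auto
    then have "c\<^sup>2 \<ge> 1 / 4" by (simp add: power2_eq_square)
    then have "m * c\<^sup>2 \<ge> m * (1 / 4)" using m by (intro mult_left_mono) auto
    moreover have "P * \<xi> \<ge> 0" using P2 \<xi> by simp
    ultimately show ?thesis by (simp add: a1_def)
  qed
  have b1: "b1 \<ge> 0"
  proof -
    define w where "w = m * c"
    have "w \<le> m" unfolding w_def using m c by (simp add: mult_left_le)
    then have "(1 + m) / 2 - m * c \<ge> 0" unfolding w_def[symmetric] using m by simp
    then have "10 * m * (1 - c) * ((1 + m) / 2 - m * c) \<ge> 0" (is "?u \<ge> 0") using m c by simp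
    moreover have "b1 = 2 * ?u + (17 * (1 + m) - 8 * m)" by (simp add: b1_def)
    ultimately show ?thesis using m by (simp only:) (rule add_nonneg_nonneg, simp, simp)
  qed
  \<comment> \<open>The coefficient 17 of s^Q is spent here: 17 - 8 = 9 remains, because the
    rational term costs at most 10 m \<le> 17 m. In the case x < 1 below,
    \<open>al \<ge> 1 / 2\<close> and \<open>be\<^sup>2 \<le> 4\<close> call for at least 8.\<close>
  have ga: "ga \<ge> 9"
  proof -
    define t where "t = (1 - c) * c"
    have t: "t \<le> 1 / 4" using t1 by (simp add: t_def algebra_simps)
    define e where "e = (1 - c) * (8 * t - 1)"
    have "(1 - c) * (8 * t - 1) \<le> (1 - c) * 1" using c t by (intro mult_left_mono) auto
    then have e: "e \<le> 1 - c" by (simp add: e_def)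
    have "m * e \<le> 1 - c"
    proof (cases "e \<ge> 0")
      case True
      then have "m * e \<le> e" using m by (simp add: mult_left_le_one_le)
      then show ?thesis using e by linarith
    next
      case False
      then have "m * e \<le> 0" using m by (simp add: mult_nonneg_nonpos)
      then show ?thesis using c by linarith
    qed
    moreover have "(1 - c) * ((1 + m) - 2 * c - 8 * m * c * (1 - c)) = (1 - c) - 2 * t - m * e"
      unfolding e_def t_def by (simp add: algebra_simps)
    ultimately have "(1 - c) * ((1 + m) - 2 * c - 8 * m * c * (1 - c)) \<ge> - 1" using t by linarith
    then have "10 * m * ((1 - c) * ((1 + m) - 2 * c - 8 * m * c * (1 - c))) \<ge> 10 * m * (- 1)"
      using m by (intro mult_left_mono) auto
    then show ?thesis using m by (simp add: ga_def algebra_simps)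
  qed
  have be2: "be\<^sup>2 = 4 * x\<^sup>2 * c\<^sup>2 * ((1 - m) * c + m * (4 * (1 - c) * c))\<^sup>2"
    by (simp add: be_def power_mult_distrib)
  have al_be: "al > 0 \<and> be\<^sup>2 \<le> al * ga"
  proof (cases "c \<le> 10 / 11")
    case True
    have "2 * P * \<xi> / m\<^sup>2 \<ge> 4" using True big \<xi> Pm2 by simp
    moreover have "2 * c\<^sup>2 - 8 * c\<^sup>2 * (1 - c) \<ge> - 1 / 2"
    proof -
      \<comment> \<open>The product expands to \<open>16 * c^3 - 12 * c\<^sup>2 + 1\<close>; the
        worst case is c = 1/2.\<close>
      have "(2 * c - 1)\<^sup>2 * (4 * c + 1) \<ge> 0" using c by simp
      then show ?thesis by (simp add: power2_eq_square algebra_simps)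
    qed
    ultimately have al: "al \<ge> 3" by (simp add: al_def)
    have "x\<^sup>2 * c\<^sup>2 * 4 = 10 * (4 * (1 - c) * c)" using c unfolding x(2)
      by (simp add: field_simps power2_eq_square)
    then have "be\<^sup>2 = 10 * ((4 * (1 - c) * c) * ((1 - m) * c + m * (4 * (1 - c) * c))\<^sup>2)"
      by (simp add: be2)
    also have "\<dots> \<le> 10 * (1 * 1)" using t0 t1 k2 by (intro mult_left_mono mult_mono) auto
    also have "\<dots> \<le> 3 * 9" by simp
    also have "\<dots> \<le> al * ga" using al ga by (intro mult_mono) auto
    finally show ?thesis using al by simp
  next
    case False
    have "2 * P * \<xi> / m\<^sup>2 \<ge> 0" using Pm2 \<xi> by linarith
    moreover have "2 * c\<^sup>2 - 8 * c\<^sup>2 * (1 - c) \<ge> 1"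
    proof -
      have "c\<^sup>2 * (8 * c - 6) \<ge> (10/11)\<^sup>2 * (8 * (10/11) - 6)"
        using False by (intro mult_mono power_mono) auto
      then show ?thesis by (simp add: power2_eq_square algebra_simps)
    qed
    ultimately have al: "al \<ge> 1 / 2" by (simp add: al_def)
    have "x\<^sup>2 \<le> 1" using False big by simp
    have "be\<^sup>2 \<le> 4 * 1 * 1 * 1" unfolding be2
      using k2 c \<open>x\<^sup>2 \<le> 1\<close> by (intro mult_mono) (auto simp: power_le_one)
    also have "\<dots> \<le> 1 / 2 * 9" by simp
    also have "\<dots> \<le> al * ga" using al ga by (intro mult_mono) auto
    finally show ?thesis using al by simp
  qed
  have "?L - m * (A / 2 + 8 * B) = a1 * (A - p\<^sup>2) + b1 * (B - q\<^sup>2)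
      + m * (al * p\<^sup>2 + 2 * be * p * q + ga * q\<^sup>2)"
  proof -
    have e1: "4 * (P * (P - 2) / 2 * \<xi> - 2 * m * c\<^sup>2 * (1 - c)) + a1 = m * al"
    proof -
      have "2 * (P * (P - 2)) + 2 * P = 2 * (P * (P - 1))" by (simp add: algebra_simps)
      then have "2 * (P * (P - 2)) + 2 * P = 2 * (P / m)" unfolding Pm .
      then have "(2 * (P * (P - 2)) + 2 * P) * \<xi> = 2 * (P / m) * \<xi>" by simp
      moreover have "m * (2 * P * \<xi> / m\<^sup>2) = 2 * (P / m) * \<xi>" using m by (simp add: power2_eq_square)
      ultimately show ?thesis unfolding a1_def al_def by (simp add: algebra_simps diff_divide_distrib)
    qed
    have e2: "8 * x * m * ((1 + 3 * m) / 2 * c\<^sup>2 - 2 * m * c^3) = 2 * m * be"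
      unfolding be_def by (simp add: field_simps power2_eq_square power3_eq_cube)
    have e3: "4 * (17 * (1 + m) * (m - 1) / 4 + 10 * m * (1 - c) *
        (- (1 + m) / 2 * ((1 + m) / 2 - m * c) + ((1 + m) / 2 - 2 * m * c) * m * (1 - c))) + b1 = m * ga"
      unfolding b1_def ga_def by (simp add: field_simps power2_eq_square power3_eq_cube)
    have "?L - m * (A / 2 + 8 * B) = a1 * (A - p\<^sup>2) + b1 * (B - q\<^sup>2)
      + (4 * (P * (P - 2) / 2 * \<xi> - 2 * m * c\<^sup>2 * (1 - c)) + a1) * p\<^sup>2
      + (8 * x * m * ((1 + 3 * m) / 2 * c\<^sup>2 - 2 * m * c^3)) * p * q
      + (4 * (17 * (1 + m) * (m - 1) / 4 + 10 * m * (1 - c) *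
        (- (1 + m) / 2 * ((1 + m) / 2 - m * c) + ((1 + m) / 2 - 2 * m * c) * m * (1 - c))) + b1) * q\<^sup>2"
      unfolding a1_def b1_def by (simp add: field_simps)
    then show ?thesis unfolding e1 e2 e3 by (simp add: algebra_simps)
  qed
  also have "\<dots> \<ge> 0"
    using a1 b1 A B m al_be by (intro add_nonneg_nonneg mult_nonneg_nonneg quadratic_form_nonneg) auto
  finally show ?thesis by simp
qed


section \<open>The Bellman function in the variables Y, Z and its derivatives\<close>

definition bell_tau :: "real \<Rightarrow> real \<Rightarrow> real" where
  "bell_tau m Z = Z powr ((1 - m) / 2)"

definition bell_theta :: "real \<Rightarrow> real \<Rightarrow> real" where
  "bell_theta m Y = Y powr ((1 / m - 1) / 2)"

definition bell_c :: "real \<Rightarrow> real \<Rightarrow> real \<Rightarrow> real" where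
  "bell_c m Y Z = 1 / (1 + Y * (bell_tau m Z)\<^sup>2 / (10 * Z))"

definition bell :: "real \<Rightarrow> real \<Rightarrow> real \<Rightarrow> real" where
  "bell m Y Z = 2 * Y * bell_theta m Y + 17 * Z / bell_tau m Z + m * Y * bell_tau m Z * bell_c m Y Z"

definition bell_Y :: "real \<Rightarrow> real \<Rightarrow> real \<Rightarrow> real" where
  "bell_Y m Y Z = (1 + 1 / m) * bell_theta m Y + m * bell_tau m Z * (bell_c m Y Z)\<^sup>2"

text \<open>Differentiating m Y \<tau> c in Z gives m Y \<tau> c / Z times ((1 + m) / 2 - m c). The
  relation 1 - c = c Y \<tau>^2 / (10 Z) turns the prefactor into 10 m (1 - c) / \<tau>, so that
  apart from powers of Z a polynomial in c remains. The factors 10 in \<open>bell_ZZ\<close> have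
  the same origin.\<close>

definition bell_Z :: "real \<Rightarrow> real \<Rightarrow> real \<Rightarrow> real" where
  "bell_Z m Y Z = (17 * (1 + m) / 2 + 10 * m * (1 - bell_c m Y Z) * ((1 + m) / 2 - m * bell_c m Y Z))
     / bell_tau m Z"

definition bell_YY :: "real \<Rightarrow> real \<Rightarrow> real \<Rightarrow> real" where
  "bell_YY m Y Z = ((1 + 1 / m) * (1 / m - 1) / 2 * bell_theta m Y
     - 2 * m * bell_tau m Z * (bell_c m Y Z)\<^sup>2 * (1 - bell_c m Y Z)) / Y"

definition bell_YZ :: "real \<Rightarrow> real \<Rightarrow> real \<Rightarrow> real" where
  "bell_YZ m Y Z = m * bell_tau m Z / Z * ((1 + 3 * m) / 2 * (bell_c m Y Z)\<^sup>2 - 2 * m * bell_c m Y Z ^ 3)"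

definition bell_ZZ :: "real \<Rightarrow> real \<Rightarrow> real \<Rightarrow> real" where
  "bell_ZZ m Y Z = (17 * (1 + m) * (m - 1) / 4 + 10 * m * (1 - bell_c m Y Z) *
      (- (1 + m) / 2 * ((1 + m) / 2 - m * bell_c m Y Z)
       + ((1 + m) / 2 - 2 * m * bell_c m Y Z) * m * (1 - bell_c m Y Z))) / (bell_tau m Z * Z)"

lemma bell_tau_pos: "Z > 0 \<Longrightarrow> bell_tau m Z > 0"
  by (simp add: bell_tau_def)

lemma bell_theta_pos: "Y > 0 \<Longrightarrow> bell_theta m Y > 0"
  by (simp add: bell_theta_def)

lemma bell_c_bounds:
  assumes "Y > 0" "Z > 0"
  shows "0 < bell_c m Y Z" "bell_c m Y Z < 1"
    and "Y * (bell_tau m Z)\<^sup>2 / Z = 10 * (1 - bell_c m Y Z) / bell_c m Y Z"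
proof -
  have w: "Y * (bell_tau m Z)\<^sup>2 / (10 * Z) > 0" using assms bell_tau_pos[of Z m] by simp
  define w where "w = Y * (bell_tau m Z)\<^sup>2 / (10 * Z)"
  have c: "bell_c m Y Z = 1 / (1 + w)" by (simp add: bell_c_def w_def)
  have "w > 0" using w by (simp add: w_def)
  then show "0 < bell_c m Y Z" "bell_c m Y Z < 1" by (simp_all add: c)
  have "Y * (bell_tau m Z)\<^sup>2 / Z = 10 * w" by (simp add: w_def)
  also have "w = (1 - bell_c m Y Z) / bell_c m Y Z" using \<open>w > 0\<close> unfolding c by (simp add: field_simps)
  finally show "Y * (bell_tau m Z)\<^sup>2 / Z = 10 * (1 - bell_c m Y Z) / bell_c m Y Z" by simp
qed

context
  fixes Y Z :: "real \<Rightarrow> real" and t Y' Z' m :: real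
  assumes Y: "(Y has_real_derivative Y') (at t)" "Y t > 0"
    and Z: "(Z has_real_derivative Z') (at t)" "Z t > 0"
    and m: "0 < m"
begin

lemma DERIV_bell_tau:
  "((\<lambda>t. bell_tau m (Z t)) has_real_derivative (1 - m) / 2 * bell_tau m (Z t) / Z t * Z') (at t)"
  unfolding bell_tau_def
  by (rule DERIV_cong[OF DERIV_fun_powr[OF Z]]) (use Z in \<open>simp add: powr_diff\<close>)

lemma DERIV_bell_theta:
  "((\<lambda>t. bell_theta m (Y t)) has_real_derivative (1 / m - 1) / 2 * bell_theta m (Y t) / Y t * Y') (at t)"
  unfolding bell_theta_def
  by (rule DERIV_cong[OF DERIV_fun_powr[OF Y]]) (use Y in \<open>simp add: powr_diff\<close>)

lemma DERIV_bell_c: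
  defines "c \<equiv> bell_c m (Y t) (Z t)"
  shows "((\<lambda>t. bell_c m (Y t) (Z t)) has_real_derivative c * (1 - c) * (m * Z' / Z t - Y' / Y t)) (at t)"
proof -
  define T where "T = bell_tau m (Z t)"
  define w where "w = Y t * T\<^sup>2 / (10 * Z t)"
  have T: "T > 0" using bell_tau_pos Z by (simp add: T_def)
  have w: "w > 0" using T Y Z by (simp add: w_def)
  have c: "c = 1 / (1 + w)" by (simp add: c_def bell_c_def w_def T_def)
  define W where "W = (\<lambda>t. Y t * (bell_tau m (Z t))\<^sup>2 / (10 * Z t))"
  have Wt: "W t = w" by (simp add: W_def w_def T_def)
  have dW: "(W has_real_derivative w * (Y' / Y t - m * Z' / Z t)) (at t)"
    unfolding W_def by (rule derivative_eq_intros DERIV_bell_tau Y Z refl)+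
      (use Y Z T in \<open>simp_all flip: T_def add: w_def field_simps power2_eq_square\<close>)
  have "((\<lambda>t. 1 / (1 + W t)) has_real_derivative - (w * (Y' / Y t - m * Z' / Z t)) / (1 + w)\<^sup>2) (at t)"
    by (rule derivative_eq_intros dW refl)+ (use w in \<open>auto simp: Wt power2_eq_square\<close>)
  moreover have "c * (1 - c) = w / (1 + w)\<^sup>2" using w unfolding c by (simp add: field_simps power2_eq_square)
  ultimately have "((\<lambda>t. 1 / (1 + W t)) has_real_derivative - (c * (1 - c) * (Y' / Y t - m * Z' / Z t))) (at t)"
    by simp
  then show ?thesis unfolding bell_c_def W_def by (rule DERIV_cong) (simp add: algebra_simps)
qed

text \<open>Stated along a curve t -> (Y t, Z t), so that the same three facts serve the time
  derivative and every coordinate derivative, without differentiability in two variables. The same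
  \<open>bell_YZ\<close> occurs in the last two: this is the symmetry of the Hessian, which again
  rests on 1 - c = c Y \<tau>^2 / (10 Z).\<close>

lemma DERIV_bell:
  "((\<lambda>t. bell m (Y t) (Z t)) has_real_derivative bell_Y m (Y t) (Z t) * Y' + bell_Z m (Y t) (Z t) * Z') (at t)"
  and DERIV_bell_Y:
  "((\<lambda>t. bell_Y m (Y t) (Z t)) has_real_derivative bell_YY m (Y t) (Z t) * Y' + bell_YZ m (Y t) (Z t) * Z') (at t)"
  and DERIV_bell_Z:
  "((\<lambda>t. bell_Z m (Y t) (Z t)) has_real_derivative bell_YZ m (Y t) (Z t) * Y' + bell_ZZ m (Y t) (Z t) * Z') (at t)"
proof -
  define T where "T = (\<lambda>t. bell_tau m (Z t))"
  define H where "H = (\<lambda>t. bell_theta m (Y t))"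
  define c where "c = (\<lambda>t. bell_c m (Y t) (Z t))"
  have T: "T t > 0" using bell_tau_pos Z by (simp add: T_def)
  have c: "c t > 0" "Y t * (T t)\<^sup>2 / Z t = 10 * (1 - c t) / c t" using bell_c_bounds[of "Y t" "Z t" m] Y Z
    by (simp_all add: c_def T_def)
  have cc: "1 - c t = c t * (Y t * (T t)\<^sup>2 / Z t) / 10" using c(1) unfolding c(2) by simp
  note dT = DERIV_bell_tau[folded T_def, unfolded T_def[THEN fun_cong, symmetric]]
  note dH = DERIV_bell_theta[folded H_def, unfolded H_def[THEN fun_cong, symmetric]]
  note dc = DERIV_bell_c[folded c_def, unfolded c_def[THEN fun_cong, symmetric]]
  have pos: "Y t \<noteq> 0" "Z t \<noteq> 0" "T t \<noteq> 0" "m \<noteq> 0" using Y Z T m by auto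
  have "((\<lambda>t. 2 * Y t * H t + 17 * Z t / T t + m * Y t * T t * c t) has_real_derivative
     ((1 + 1 / m) * H t + m * T t * (c t)\<^sup>2) * Y'
     + (17 * (1 + m) / 2 / T t + m * Y t * T t * c t / Z t * ((1 + m) / 2 - m * c t)) * Z') (at t)"
    by (rule DERIV_cong, (rule derivative_eq_intros dT dH dc Y Z refl pos)+)
      (use pos in \<open>simp add: field_simps power2_eq_square\<close>)
  moreover have "17 * (1 + m) / 2 / T t + m * Y t * T t * c t / Z t * ((1 + m) / 2 - m * c t)
      = (17 * (1 + m) / 2 + 10 * m * (1 - c t) * ((1 + m) / 2 - m * c t)) / T t"
    unfolding cc using pos by (simp add: field_simps power2_eq_square)
  ultimately show "((\<lambda>t. bell m (Y t) (Z t)) has_real_derivative bell_Y m (Y t) (Z t) * Y' + bell_Z m (Y t) (Z t) * Z') (at t)"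
    by (simp add: bell_def bell_Y_def bell_Z_def T_def H_def c_def)
  have "((\<lambda>t. (1 + 1 / m) * H t + m * T t * (c t)\<^sup>2) has_real_derivative
     (((1 + 1 / m) * (1 / m - 1) / 2 * H t - 2 * m * T t * (c t)\<^sup>2 * (1 - c t)) / Y t) * Y'
     + (m * T t / Z t * ((1 + 3 * m) / 2 * (c t)\<^sup>2 - 2 * m * c t ^ 3)) * Z') (at t)"
    by (rule DERIV_cong, (rule derivative_eq_intros dT dH dc Y Z refl pos)+)
      (use pos in \<open>simp add: field_simps power2_eq_square power3_eq_cube\<close>)
  then show "((\<lambda>t. bell_Y m (Y t) (Z t)) has_real_derivative bell_YY m (Y t) (Z t) * Y' + bell_YZ m (Y t) (Z t) * Z') (at t)"
    by (simp add: bell_YY_def bell_YZ_def bell_Y_def T_def H_def c_def)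
  have "((\<lambda>t. (17 * (1 + m) / 2 + 10 * m * (1 - c t) * ((1 + m) / 2 - m * c t)) / T t) has_real_derivative
     (10 * m * c t * (1 - c t) / (Y t * T t) * ((1 + 3 * m) / 2 - 2 * m * c t)) * Y' +
     ((17 * (1 + m) * (m - 1) / 4 + 10 * m * (1 - c t) *
      (- (1 + m) / 2 * ((1 + m) / 2 - m * c t)
       + ((1 + m) / 2 - 2 * m * c t) * m * (1 - c t))) / (T t * Z t)) * Z') (at t)"
    by (rule DERIV_cong, (rule derivative_eq_intros dT dH dc Y Z refl pos)+)
      (use pos in \<open>simp add: field_simps power2_eq_square power3_eq_cube\<close>)
  moreover have "10 * m * c t * (1 - c t) / (Y t * T t) * ((1 + 3 * m) / 2 - 2 * m * c t)
     = m * T t / Z t * ((1 + 3 * m) / 2 * (c t)\<^sup>2 - 2 * m * c t ^ 3)"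
    unfolding cc using pos by (simp add: field_simps power2_eq_square power3_eq_cube)
  ultimately show "((\<lambda>t. bell_Z m (Y t) (Z t)) has_real_derivative bell_YZ m (Y t) (Z t) * Y' + bell_ZZ m (Y t) (Z t) * Z') (at t)"
    unfolding bell_ZZ_def bell_YZ_def bell_Z_def T_def c_def by (simp only:)
qed

end

text \<open>\<open>P\<close> and \<open>Q\<close> are the derivatives of Y = |u|^2 + e and Z = |v|^2
  + e in one direction, \<open>A\<close> and \<open>B\<close> the squared lengths of the derivatives
  of u and v; the two hypotheses are then Cauchy-Schwarz. The left side is the part of the second
  derivative of B(u, v) that is free of second derivatives of u and v. Homogeneity reduces it to the
  normalized form in x = r s^(-m).\<close>

lemma bell_form_ge:
  assumes Y: "Y > 0" and Z: "Z > 0" and m: "0 < m" "m \<le> 1"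
    and P: "P\<^sup>2 \<le> 4 * Y * A" and Q: "Q\<^sup>2 \<le> 4 * Z * B"
  shows "bell_YY m Y Z * P\<^sup>2 + 2 * bell_YZ m Y Z * P * Q + bell_ZZ m Y Z * Q\<^sup>2
     + 2 * bell_Y m Y Z * A + 2 * bell_Z m Y Z * B
    \<ge> m * (bell_tau m Z * A / 2 + 8 * B / bell_tau m Z)"
proof -
  define T where "T = bell_tau m Z"
  define H where "H = bell_theta m Y"
  define c where "c = bell_c m Y Z"
  have T: "T > 0" using bell_tau_pos Z by (simp add: T_def)
  have H: "H > 0" using bell_theta_pos Y by (simp add: H_def)
  have c: "0 < c" "c < 1" "Y * T\<^sup>2 / Z = 10 * (1 - c) / c" using bell_c_bounds[of Y Z m] Y Z
    by (simp_all add: c_def T_def)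
  define x where "x = T * sqrt (Y / Z)"
  define p where "p = P * sqrt (T / Y) / 2"
  define q where "q = Q / (2 * sqrt (Z * T))"
  have x: "x \<ge> 0" "x\<^sup>2 = Y * T\<^sup>2 / Z" using T Y Z by (simp_all add: x_def power_mult_distrib)
  have p: "p\<^sup>2 = P\<^sup>2 * T / (4 * Y)" using T Y by (simp add: p_def power_mult_distrib power_divide)
  have q: "q\<^sup>2 = Q\<^sup>2 / (4 * Z * T)" using T Z by (simp add: q_def power_mult_distrib power_divide)
  have pq: "x * p * q = T * P * Q / (4 * Z)"
  proof -
    have "x * p * q = T * P * Q / 4 * (sqrt (Y / Z) * sqrt (T / Y) / sqrt (Z * T))"
      by (simp add: x_def p_def q_def)
    also have "sqrt (Y / Z) * sqrt (T / Y) / sqrt (Z * T) = sqrt (1 / Z\<^sup>2)"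
      using T Y Z by (simp flip: real_sqrt_mult real_sqrt_divide add: power2_eq_square)
    also have "\<dots> = 1 / Z" using Z by (simp add: real_sqrt_divide)
    finally show ?thesis by simp
  qed
  \<comment> \<open>x \<ge> 1 says r \<ge> s^m; raising this to the power P - 2 = 1/m - 1 \<ge> 0
    gives \<open>H \<ge> T\<close>.\<close>
  have xi: "H / T \<ge> 1" if "x\<^sup>2 \<ge> 1"
  proof -
    have "Z powr m * (T\<^sup>2) = Z"
      using Z by (simp add: T_def bell_tau_def powr_add[symmetric] powr_powr field_simps flip: powr_numeral)
    then have "Y \<ge> Z powr m" using that T Y Z unfolding x
      by (metis divide_self_if less_numeral_extra(3) mult.commute mult_le_cancel_right_pos pos_le_divide_eq mult_1 zero_less_power)
    then have "Y powr ((1 / m - 1) / 2) \<ge> (Z powr m) powr ((1 / m - 1) / 2)"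
      using m by (intro powr_mono2) (auto simp: field_simps)
    also have "(Z powr m) powr ((1 / m - 1) / 2) = T"
      using m by (simp add: powr_powr T_def bell_tau_def right_diff_distrib)
    finally show ?thesis using T by (simp add: H_def bell_theta_def)
  qed
  have N: "4 * ((1 + 1 / m) * ((1 + 1 / m) - 2) / 2 * (H / T) - 2 * m * c\<^sup>2 * (1 - c)) * p\<^sup>2
    + 8 * x * m * ((1 + 3 * m) / 2 * c\<^sup>2 - 2 * m * c^3) * p * q
    + 4 * (17 * (1 + m) * (m - 1) / 4 + 10 * m * (1 - c) *
        (- (1 + m) / 2 * ((1 + m) / 2 - m * c) + ((1 + m) / 2 - 2 * m * c) * m * (1 - c))) * q\<^sup>2
    + 2 * ((1 + 1 / m) * (H / T) + m * c\<^sup>2) * (T * A)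
    + 2 * (17 * (1 + m) / 2 + 10 * m * (1 - c) * ((1 + m) / 2 - m * c)) * (B / T)
    \<ge> m * (T * A / 2 + 8 * (B / T))"
  proof (rule bellman_form_normalized[OF m c(1,2) x(1)])
    show "x\<^sup>2 = 10 * (1 - c) / c" using x c by simp
    show "0 \<le> H / T" "1 \<le> x\<^sup>2 \<Longrightarrow> 1 \<le> H / T" using H T xi by auto
    show "p\<^sup>2 \<le> T * A" using P T Y by (simp add: p field_simps)
    show "q\<^sup>2 \<le> B / T" using Q T Z by (simp add: q field_simps)
  qed
  have 1: "4 * ((1 + 1 / m) * ((1 + 1 / m) - 2) / 2 * (H / T) - 2 * m * c\<^sup>2 * (1 - c)) * p\<^sup>2
    = bell_YY m Y Z * P\<^sup>2"
    unfolding p bell_YY_def T_def[symmetric] H_def[symmetric] c_def[symmetric]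
    using T Y m by (simp add: field_simps)
  have 2: "8 * x * m * ((1 + 3 * m) / 2 * c\<^sup>2 - 2 * m * c^3) * p * q = 2 * bell_YZ m Y Z * P * Q"
  proof -
    have "8 * x * m * ((1 + 3 * m) / 2 * c\<^sup>2 - 2 * m * c^3) * p * q
        = 8 * m * ((1 + 3 * m) / 2 * c\<^sup>2 - 2 * m * c^3) * (x * p * q)" by simp
    then show ?thesis unfolding pq bell_YZ_def T_def[symmetric] c_def[symmetric] by simp
  qed
  have 3: "4 * (17 * (1 + m) * (m - 1) / 4 + 10 * m * (1 - c) *
        (- (1 + m) / 2 * ((1 + m) / 2 - m * c) + ((1 + m) / 2 - 2 * m * c) * m * (1 - c))) * q\<^sup>2
     = bell_ZZ m Y Z * Q\<^sup>2"
  proof -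
    have "4 * X * (Q\<^sup>2 / (4 * Z * T)) = X / (T * Z) * Q\<^sup>2" for X using T Z by (simp add: field_simps)
    then show ?thesis unfolding q bell_ZZ_def T_def[symmetric] c_def[symmetric] .
  qed
  have 4: "2 * ((1 + 1 / m) * (H / T) + m * c\<^sup>2) * (T * A) = 2 * bell_Y m Y Z * A"
    unfolding bell_Y_def T_def[symmetric] H_def[symmetric] c_def[symmetric]
    using T by (simp add: field_simps)
  have 5: "2 * (17 * (1 + m) / 2 + 10 * m * (1 - c) * ((1 + m) / 2 - m * c)) * (B / T) = 2 * bell_Z m Y Z * B"
    unfolding bell_Z_def T_def[symmetric] c_def[symmetric] by simp
  show ?thesis using N unfolding 1 2 3 4 5 by (simp add: T_def)
qed

lemma bell_Y_nonneg: "Y > 0 \<Longrightarrow> Z > 0 \<Longrightarrow> m > 0 \<Longrightarrow> bell_Y m Y Z \<ge> 0"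
  using bell_theta_pos[of Y m] bell_tau_pos[of Z m] by (simp add: bell_Y_def)

lemma bell_Z_nonneg:
  assumes "Y > 0" "Z > 0" "0 < m" "m \<le> 1" shows "bell_Z m Y Z \<ge> 0"
proof -
  have c: "0 < bell_c m Y Z" "bell_c m Y Z < 1" using bell_c_bounds assms by auto
  have "m * bell_c m Y Z \<le> m" using assms c by (simp add: mult_left_le)
  then have "m * bell_c m Y Z \<le> (1 + m) / 2" using \<open>m \<le> 1\<close> by argo
  then show ?thesis using bell_tau_pos[of Z m] assms c by (simp add: bell_Z_def)
qed

lemma bell_nonneg: "Y > 0 \<Longrightarrow> Z > 0 \<Longrightarrow> m > 0 \<Longrightarrow> bell m Y Z \<ge> 0"
  using bell_theta_pos[of Y m] bell_tau_pos[of Z m] bell_c_bounds(1)[of Y Z m]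
  by (simp add: bell_def less_imp_le)

text \<open>The rational term is at most r^2 s^(1-m), and r^2 s^(1-m) \<le> r^P + s^Q according to
  whether s^(1-m) or r^(P-2) is larger. This raises the coefficients 2 and 17 of \<open>bell\<close>
  to 3 and 18.\<close>

lemma bell_le:
  assumes Y: "Y > 0" and Z: "Z > 0" and m: "0 < m" "m \<le> 1"
  shows "bell m Y Z \<le> 3 * Y powr ((1 + 1 / m) / 2) + 18 * Z powr ((1 + m) / 2)"
proof -
  define T where "T = bell_tau m Z"
  define H where "H = bell_theta m Y"
  have T: "T > 0" using bell_tau_pos Z by (simp add: T_def)
  have H: "H > 0" using bell_theta_pos Y by (simp add: H_def)
  have e1: "Y powr ((1 + 1 / m) / 2) = Y * H"
    using Y m by (simp add: H_def bell_theta_def powr_mult_base field_simps)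
  have e2: "Z powr ((1 + m) / 2) = Z / T"
  proof -
    have "Z / T = Z powr (1 - (1 - m) / 2)" using Z by (simp add: T_def bell_tau_def powr_diff)
    also have "1 - (1 - m) / 2 = (1 + m) / 2" by argo
    finally show ?thesis by simp
  qed
  have "Y * T \<le> Y * H + Z / T"
  proof (cases "T \<le> H")
    case True
    then have "Y * T \<le> Y * H" using Y by simp
    moreover have "Z / T > 0" using Z T by simp
    ultimately show ?thesis by linarith
  next
    case False
    have "Y < Z powr m"
    proof (rule ccontr)
      assume "\<not> ?thesis"
      then have "Y powr ((1 / m - 1) / 2) \<ge> (Z powr m) powr ((1 / m - 1) / 2)"
        using m by (intro powr_mono2) (auto simp: field_simps)
      also have "(Z powr m) powr ((1 / m - 1) / 2) = T"
        using m by (simp add: powr_powr T_def bell_tau_def right_diff_distrib)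
      finally show False using False by (simp add: H_def bell_theta_def)
    qed
    then have "Y * T\<^sup>2 \<le> Z powr m * T\<^sup>2" by (intro mult_right_mono) auto
    also have "\<dots> = Z"
      using Z by (simp add: T_def bell_tau_def powr_add[symmetric] powr_powr field_simps flip: powr_numeral)
    finally have "Y * T \<le> Z / T" using T by (simp add: field_simps power2_eq_square)
    moreover have "Y * H > 0" using Y H by simp
    ultimately show ?thesis by linarith
  qed
  moreover have "m * Y * T * bell_c m Y Z \<le> 1 * (Y * T) * 1"
    using bell_c_bounds[of Y Z m] m Y Z T by (subst mult.assoc, intro mult_mono) auto
  moreover have "bell m Y Z = 2 * (Y * H) + 17 * (Z / T) + m * Y * T * bell_c m Y Z"
    by (simp add: bell_def T_def H_def)
  ultimately show ?thesis unfolding e1 e2 by argo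
qed

lemma continuous_on_bell:
  fixes Y Z :: "'a::topological_space \<Rightarrow> real"
  assumes "continuous_on S Y" "continuous_on S Z" "\<And>x. x \<in> S \<Longrightarrow> Y x > 0" "\<And>x. x \<in> S \<Longrightarrow> Z x > 0"
  shows "continuous_on S (\<lambda>x. bell m (Y x) (Z x))"
    and "continuous_on S (\<lambda>x. bell_Y m (Y x) (Z x))" and "continuous_on S (\<lambda>x. bell_Z m (Y x) (Z x))"
    and "continuous_on S (\<lambda>x. bell_YY m (Y x) (Z x))" and "continuous_on S (\<lambda>x. bell_YZ m (Y x) (Z x))"
    and "continuous_on S (\<lambda>x. bell_ZZ m (Y x) (Z x))"
proof -
  have nz: "\<forall>x\<in>S. Y x \<noteq> 0" "\<forall>x\<in>S. Z x \<noteq> 0" using assms by force+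
  have t: "continuous_on S (\<lambda>x. bell_tau m (Z x))" unfolding bell_tau_def
    using assms nz by (intro continuous_intros; auto)
  have tnz: "\<forall>x\<in>S. bell_tau m (Z x) \<noteq> 0" using assms bell_tau_pos by (metis less_irrefl)
  have h: "continuous_on S (\<lambda>x. bell_theta m (Y x))" unfolding bell_theta_def
    using assms nz by (intro continuous_intros; auto)
  have "1 + Y x * (bell_tau m (Z x))\<^sup>2 / (10 * Z x) \<noteq> 0" if "x \<in> S" for x
    using assms(3,4)[OF that] by (smt (verit) divide_nonneg_nonneg mult_nonneg_nonneg zero_le_power2)
  then have c: "continuous_on S (\<lambda>x. bell_c m (Y x) (Z x))" unfolding bell_c_def
    using assms nz t by (intro continuous_intros; auto)
  note [continuous_intros] = assms(1,2) t h c
  show "continuous_on S (\<lambda>x. bell m (Y x) (Z x))"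
    unfolding bell_def using nz tnz by (intro continuous_intros; auto)
  show "continuous_on S (\<lambda>x. bell_Y m (Y x) (Z x))"
    unfolding bell_Y_def using nz tnz by (intro continuous_intros; auto)
  show "continuous_on S (\<lambda>x. bell_Z m (Y x) (Z x))"
    unfolding bell_Z_def using nz tnz by (intro continuous_intros; auto)
  show "continuous_on S (\<lambda>x. bell_YY m (Y x) (Z x))"
    unfolding bell_YY_def using nz tnz by (intro continuous_intros; auto)
  show "continuous_on S (\<lambda>x. bell_YZ m (Y x) (Z x))"
    unfolding bell_YZ_def using nz tnz by (intro continuous_intros; auto)
  show "continuous_on S (\<lambda>x. bell_ZZ m (Y x) (Z x))"
    unfolding bell_ZZ_def using nz tnz by (intro continuous_intros; auto)
qed

section \<open>Jacobi polynomials\<close>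

lemma jacobi_weight_measurable [measurable]: "jacobi_weight a b \<in> borel_measurable borel"
  unfolding jacobi_weight_def by measurable

text \<open>The substitution t = (1 + x) / 2 turns the Beta integrand into the weight, up to the
  factor 2^(a+b).\<close>

lemma jacobi_weight_integrable:
  assumes "a > - 1" "b > - 1"
  shows "set_integrable lborel {-1<..<1} (jacobi_weight a b)"
proof -
  let ?f = "\<lambda>t. t powr b * (1 - t) powr a"
  have "(?f has_integral Beta (b + 1) (a + 1)) {0<..<1}"
    using has_integral_Beta_real[of "b + 1" "a + 1"] assms by (simp add: has_integral_Icc_iff_Ioo)
  then have "?f absolutely_integrable_on {0<..<1}"
    by (intro nonnegative_absolutely_integrable_1) auto
  then have "integrable lborel (\<lambda>t. indicator {0<..<1} t *\<^sub>R ?f t)"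
    unfolding set_integrable_def by (subst (asm) integrable_completion) auto
  then have "integrable lborel (\<lambda>x. indicator {0<..<1} (1/2 + 1/2 * x) *\<^sub>R ?f (1/2 + 1/2 * x))"
    by (rule lborel_integrable_real_affine) simp
  then have "integrable lborel (\<lambda>x. 2 powr (a + b) *\<^sub>R (indicator {0<..<1} (1/2 + 1/2 * x) *\<^sub>R ?f (1/2 + 1/2 * x)))"
    by (rule integrable_scaleR_right)
  also have "(\<lambda>x. 2 powr (a + b) *\<^sub>R (indicator {0<..<1} (1/2 + 1/2 * x) *\<^sub>R ?f (1/2 + 1/2 * x)))
     = (\<lambda>x. indicator {-1<..<1} x *\<^sub>R jacobi_weight a b x)"
  proof
    fix x :: real
    show "2 powr (a + b) *\<^sub>R (indicator {0<..<1} (1/2 + 1/2 * x) *\<^sub>R ?f (1/2 + 1/2 * x))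
       = indicator {-1<..<1} x *\<^sub>R jacobi_weight a b x"
    proof (cases "x \<in> {-1<..<1}")
      case True
      have u: "1/2 + 1/2 * x = (1 + x) / 2" "1 - (1 + x) / 2 = (1 - x) / 2" by (auto simp: field_simps)
      have "?f (1/2 + 1/2 * x) = ((1 + x) / 2) powr b * ((1 - x) / 2) powr a" unfolding u ..
      also have "\<dots> = (1 + x) powr b * (1 - x) powr a / 2 powr (a + b)"
        by (subst (1 2) powr_divide) (use True in \<open>auto simp: powr_add mult.commute\<close>)
      finally have "?f (1/2 + 1/2 * x) = (1 + x) powr b * (1 - x) powr a / 2 powr (a + b)" .
      then show ?thesis using True by (simp add: jacobi_weight_def)
    qed (auto simp: indicator_def)
  qed
  finally show ?thesis unfolding set_integrable_def .
qed

context
  fixes a b :: real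
  assumes ab: "a > - 1" "b > - 1"
begin

lemma jacobi_weight_pos: "- 1 < x \<Longrightarrow> x < 1 \<Longrightarrow> jacobi_weight a b x > 0"
  by (simp add: jacobi_weight_def)

lemma jacobi_const_pos: "jacobi_const a b > 0"
proof -
  let ?f = "\<lambda>x. indicator {-1<..<1} x *\<^sub>R jacobi_weight a b x"
  have i: "integrable lborel ?f" using jacobi_weight_integrable[OF ab] by (simp add: set_integrable_def)
  have nn: "0 \<le> ?f x" for x using jacobi_weight_pos[of x] by (auto simp: indicator_def)
  have "integral\<^sup>L lborel ?f \<noteq> 0"
  proof
    assume "integral\<^sup>L lborel ?f = 0"
    then have "AE x in lborel. ?f x = 0" using integral_nonneg_eq_0_iff_AE[OF i] nn by simp
    then have "AE x in lborel. x \<notin> {-1<..<1::real}"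
      by eventually_elim (use jacobi_weight_pos in \<open>force simp: indicator_def\<close>)
    then have "{-1<..<1::real} \<in> null_sets lborel" by (simp add: AE_iff_null_sets)
    then show False by (simp add: null_sets_def)
  qed
  moreover have "integral\<^sup>L lborel ?f \<ge> 0" using nn by (intro integral_nonneg_AE AE_I2)
  ultimately show ?thesis by (simp add: jacobi_const_def set_lebesgue_integral_def)
qed

lemma space_jacobi_measure1: "space (jacobi_measure1 a b) = {-1<..<1}"
  by (simp add: jacobi_measure1_def space_restrict_space)

lemma sets_jacobi_measure1 [measurable_cong]: "sets (jacobi_measure1 a b) = sets (restrict_space borel {-1<..<1})"
  by (simp add: jacobi_measure1_def sets_restrict_space)

lemma measurable_jacobi_measure1I [measurable (raw)]:
  "f \<in> borel_measurable borel \<Longrightarrow> f \<in> borel_measurable (jacobi_measure1 a b)"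
  by (subst measurable_cong_sets[OF sets_jacobi_measure1 refl]) (rule measurable_restrict_space1)

lemma integral_jacobi_measure1:
  fixes f :: "real \<Rightarrow> real"
  assumes [measurable]: "f \<in> borel_measurable borel"
  shows "(\<integral>x. f x \<partial>jacobi_measure1 a b) = (LINT x:{-1<..<1}|lborel. jacobi_weight a b x * f x) / jacobi_const a b"
proof -
  have [measurable]: "f \<in> borel_measurable (restrict_space lborel {-1<..<1})"
    "jacobi_weight a b \<in> borel_measurable (restrict_space lborel {-1<..<1})"
    by (auto intro: measurable_restrict_space1)
  have "(\<integral>x. f x \<partial>jacobi_measure1 a b)
     = (\<integral>x. (jacobi_weight a b x / jacobi_const a b) *\<^sub>R f x \<partial>restrict_space lborel {-1<..<1})"
    unfolding jacobi_measure1_def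
  proof (rule integral_density)
    show "AE x in restrict_space lborel {-1<..<1}. 0 \<le> jacobi_weight a b x / jacobi_const a b"
      using jacobi_weight_pos jacobi_const_pos
      by (intro AE_I2) (auto simp: space_restrict_space intro!: divide_nonneg_nonneg less_imp_le)
  qed auto
  also have "\<dots> = (LINT x:{-1<..<1}|lborel. (jacobi_weight a b x / jacobi_const a b) *\<^sub>R f x)"
    by (subst integral_restrict_space) (auto simp: set_lebesgue_integral_def)
  also have "\<dots> = (LINT x:{-1<..<1}|lborel. (jacobi_weight a b x * f x) / jacobi_const a b)"
    by simp
  finally show ?thesis by (simp add: set_lebesgue_integral_def)
qed

lemma prob_space_jacobi_measure1: "prob_space (jacobi_measure1 a b)"
proof
  have [measurable]: "jacobi_weight a b \<in> borel_measurable (restrict_space lborel {-1<..<1})"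
    by (auto intro: measurable_restrict_space1)
  let ?f = "\<lambda>x. indicator {-1<..<1} x *\<^sub>R jacobi_weight a b x / jacobi_const a b"
  have i: "integrable lborel ?f"
    using jacobi_weight_integrable[OF ab] by (simp add: set_integrable_def)
  have nn: "0 \<le> ?f x" for x using jacobi_weight_pos[of x] jacobi_const_pos by (auto simp: indicator_def)
  have "emeasure (jacobi_measure1 a b) (space (jacobi_measure1 a b))
     = (\<integral>\<^sup>+x. ennreal (jacobi_weight a b x / jacobi_const a b) \<partial>restrict_space lborel {-1<..<1})"
    unfolding jacobi_measure1_def by (subst emeasure_density) (auto intro!: nn_integral_cong simp: indicator_def space_restrict_space sets_restrict_space_iff)
  also have "\<dots> = (\<integral>\<^sup>+x. ennreal (jacobi_weight a b x / jacobi_const a b) * indicator {-1<..<1} x \<partial>lborel)"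
    by (subst nn_integral_restrict_space) auto
  also have "\<dots> = (\<integral>\<^sup>+x. ennreal (?f x) \<partial>lborel)"
    by (intro nn_integral_cong) (auto simp: indicator_def)
  also have "\<dots> = ennreal (integral\<^sup>L lborel ?f)" by (rule nn_integral_eq_integral[OF i]) (use nn in auto)
  also have "integral\<^sup>L lborel ?f = 1"
    using jacobi_const_pos by (simp add: jacobi_const_def set_lebesgue_integral_def)
  finally show "emeasure (jacobi_measure1 a b) (space (jacobi_measure1 a b)) = 1" by simp
qed

lemma integrable_jacobi_measure1:
  fixes f :: "real \<Rightarrow> real"
  assumes "continuous_on UNIV f"
  shows "integrable (jacobi_measure1 a b) f"
proof -
  interpret prob_space "jacobi_measure1 a b" by (rule prob_space_jacobi_measure1)
  have "compact (f ` {-1..1})" by (intro compact_continuous_image continuous_on_subset[OF assms]) auto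
  then obtain B where "\<And>x. x \<in> {-1..1} \<Longrightarrow> norm (f x) \<le> B" by (meson compact_imp_bounded bounded_iff imageI)
  then show ?thesis using borel_measurable_continuous_onI[OF assms]
    by (intro integrable_const_bound[of _ B] AE_I2 measurable_jacobi_measure1I)
      (auto simp: space_jacobi_measure1)
qed

text \<open>The integrand is the derivative of \<open>(1 - s)\<^sup>a\<^sup>+\<^sup>1 (1 + s)\<^sup>b\<^sup>+\<^sup>1 g(s)\<close> divided by the weight.\<close>

lemma integral_jacobi_divergence:
  fixes g g' :: "real \<Rightarrow> real"
  assumes g: "\<And>s. (g has_real_derivative g' s) (at s)" and g': "continuous_on UNIV g'"
  shows "(\<integral>s. (1 - s\<^sup>2) * g' s + (b - a - (a + b + 2) * s) * g s \<partial>jacobi_measure1 a b) = 0"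
proof -
  have cg: "continuous_on UNIV g" using g by (meson DERIV_continuous_on DERIV_subset subset_UNIV)
  define h where "h = (\<lambda>s. (1 - s\<^sup>2) * g' s + (b - a - (a + b + 2) * s) * g s)"
  have ch: "continuous_on UNIV h" unfolding h_def by (intro continuous_intros cg g')
  have hm [measurable]: "h \<in> borel_measurable borel" by (rule borel_measurable_continuous_onI[OF ch])
  let ?G = "\<lambda>s. (1 - s) powr (a + 1) * (1 + s) powr (b + 1) * g s"
  have "((\<lambda>s. jacobi_weight a b s * h s) has_integral (?G 1 - ?G (-1))) {-1..1}"
  proof (rule fundamental_theorem_of_calculus_interior)
    \<comment> \<open>Here a + 1 and b + 1 have to be positive; the weight itself may be unbounded
      at the end points, but the function that is differentiated extends continuously by 0.\<close>
    show "continuous_on {-1..1} ?G"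
      using ab by (intro continuous_intros continuous_on_powr' continuous_on_subset[OF cg]) auto
    fix s :: real assume s: "s \<in> {-1<..<1}"
    have d1: "((\<lambda>s. (1 - s) powr (a + 1)) has_real_derivative - (a + 1) * (1 - s) powr a) (at s)"
      by (rule DERIV_cong, rule DERIV_fun_powr, (rule derivative_eq_intros refl)+) (use s in \<open>auto simp: algebra_simps\<close>)
    have d2: "((\<lambda>s. (1 + s) powr (b + 1)) has_real_derivative (b + 1) * (1 + s) powr b) (at s)"
      by (rule DERIV_cong, rule DERIV_fun_powr, (rule derivative_eq_intros refl)+) (use s in auto)
    have p: "(1 - s) powr (a + 1) = (1 - s) * (1 - s) powr a" "(1 + s) powr (b + 1) = (1 + s) * (1 + s) powr b"
      using s by (simp_all add: powr_add)
    have "(?G has_real_derivative jacobi_weight a b s * h s) (at s)"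
      by (rule DERIV_cong, (rule derivative_eq_intros d1 d2 g refl)+)
        (unfold p jacobi_weight_def h_def, simp add: algebra_simps power2_eq_square)
    then show "(?G has_vector_derivative jacobi_weight a b s * h s) (at s)"
      by (simp add: has_real_derivative_iff_has_vector_derivative)
  qed auto
  moreover have "?G 1 - ?G (-1) = 0" using ab by simp
  ultimately have I: "((\<lambda>s. jacobi_weight a b s * h s) has_integral 0) {-1<..<1}"
    by (simp add: has_integral_Icc_iff_Ioo)
  have "compact (h ` {-1..1})" by (intro compact_continuous_image continuous_on_subset[OF ch]) auto
  then obtain B where B: "\<And>x. x \<in> {-1..1} \<Longrightarrow> norm (h x) \<le> B" by (meson compact_imp_bounded bounded_iff imageI)
  have "set_integrable lborel {-1<..<1} (\<lambda>s. B * jacobi_weight a b s)"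
    using jacobi_weight_integrable[OF ab] by (intro set_integrable_mult_right) auto
  then have "set_integrable lborel {-1<..<1} (\<lambda>s. jacobi_weight a b s * h s)"
    unfolding set_integrable_def
  proof (rule Bochner_Integration.integrable_bound)
    show "AE x in lborel. norm (indicator {-1<..<1} x *\<^sub>R (jacobi_weight a b x * h x))
        \<le> norm (indicator {-1<..<1} x *\<^sub>R (B * jacobi_weight a b x))"
    proof (rule AE_I2)
      fix x :: real
      show "norm (indicator {-1<..<1} x *\<^sub>R (jacobi_weight a b x * h x))
        \<le> norm (indicator {-1<..<1} x *\<^sub>R (B * jacobi_weight a b x))"
      proof (cases "x \<in> {-1<..<1}")
        case True
        then have "\<bar>h x\<bar> \<le> \<bar>B\<bar>" using B[of x] by auto
        then show ?thesis using True by (simp add: abs_mult mult.commute mult_right_mono)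
      qed auto
    qed
  qed auto
  from set_borel_integral_eq_integral(2)[OF this] I
  have "(LINT s:{-1<..<1}|lborel. jacobi_weight a b s * h s) = 0" by (simp add: integral_unique)
  then show ?thesis by (simp add: integral_jacobi_measure1[OF hm] flip: h_def)
qed

lemma AE_jacobi_measure1_poly_nonzero:
  assumes "q \<noteq> 0"
  shows "AE x in jacobi_measure1 a b. poly q x \<noteq> 0"
proof -
  have [measurable]: "jacobi_weight a b \<in> borel_measurable (restrict_space lborel {-1<..<1})"
    by (auto intro: measurable_restrict_space1)
  have "{x. poly q x = 0} \<in> null_sets lborel"
    by (intro finite_imp_null_set_lborel poly_roots_finite assms)
  then have "AE x in lborel. poly q x \<noteq> 0" by (rule AE_I') auto
  then show ?thesis unfolding jacobi_measure1_def
    by (subst AE_density) (auto simp: AE_restrict_space_iff)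
qed

lemma integral_jacobi_measure1_poly_square_pos:
  assumes "q \<noteq> 0"
  shows "(\<integral>x. (poly q x)\<^sup>2 \<partial>jacobi_measure1 a b) > 0"
proof -
  interpret prob_space "jacobi_measure1 a b" by (rule prob_space_jacobi_measure1)
  have i: "integrable (jacobi_measure1 a b) (\<lambda>x. (poly q x)\<^sup>2)"
    by (intro integrable_jacobi_measure1 continuous_intros)
  have "(\<integral>x. (poly q x)\<^sup>2 \<partial>jacobi_measure1 a b) \<noteq> 0"
  proof
    assume "(\<integral>x. (poly q x)\<^sup>2 \<partial>jacobi_measure1 a b) = 0"
    then have "AE x in jacobi_measure1 a b. (poly q x)\<^sup>2 = 0"
      by (subst (asm) integral_nonneg_eq_0_iff_AE[OF i]) auto
    with AE_jacobi_measure1_poly_nonzero[OF assms] have "AE x in jacobi_measure1 a b. False"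
      by eventually_elim auto
    then show False by simp
  qed
  moreover have "(\<integral>x. (poly q x)\<^sup>2 \<partial>jacobi_measure1 a b) \<ge> 0" by (intro integral_nonneg_AE AE_I2) auto
  ultimately show ?thesis by linarith
qed

end


section \<open>Jacobi polynomials as formal polynomials: degree, differential equation,
  orthogonality\<close>

definition Jpoly :: "real \<Rightarrow> real \<Rightarrow> nat \<Rightarrow> real poly" where
  "Jpoly a b n = (\<Sum>s\<le>n. smult (((real n + a) gchoose (n - s)) * ((real n + b) gchoose s))
     ([:- 1 / 2, 1 / 2:] ^ s * [:1 / 2, 1 / 2:] ^ (n - s)))"

lemma poly_Jpoly: "poly (Jpoly a b n) = jacobi_poly a b n"
  by (rule ext) (simp add: Jpoly_def jacobi_poly_def poly_sum add_divide_distrib diff_divide_distrib mult.assoc add.commute)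

lemma gbinomial_pos:
  assumes "x > real k - 1" shows "(x::real) gchoose k > 0"
  unfolding gbinomial_prod_rev by (intro divide_pos_pos prod_pos) (use assms in auto)

text \<open>No cancellation can occur: each summand has degree exactly n and a positive leading
  coefficient, because for a, b > -1 all the generalized binomial coefficients are positive.\<close>

lemma degree_Jpoly:
  assumes "a > - 1" "b > - 1"
  shows "degree (Jpoly a b n) = n" and "coeff (Jpoly a b n) n > 0"
proof -
  let ?c = "\<lambda>s. ((real n + a) gchoose (n - s)) * ((real n + b) gchoose s)"
  let ?q = "\<lambda>s. [:- 1 / 2, 1 / 2:] ^ s * [:1 / 2, 1 / 2:] ^ (n - s) :: real poly"
  have dq: "degree (?q s) = n" if "s \<le> n" for s
    using that by (subst degree_mult_eq) (auto simp: degree_power_eq)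
  have cq: "coeff (?q s) n > 0" if "s \<le> n" for s
  proof -
    have "coeff (?q s) n = lead_coeff (?q s)" using dq[OF that] by simp
    also have "\<dots> = (1 / 2) ^ s * (1 / 2) ^ (n - s)"
      by (subst lead_coeff_mult, subst (1 2) lead_coeff_power) simp
    finally show ?thesis by simp
  qed
  have cpos: "?c s > 0" if "s \<le> n" for s
    using that assms by (intro mult_pos_pos gbinomial_pos) (auto simp: of_nat_diff)
  show c: "coeff (Jpoly a b n) n > 0"
    unfolding Jpoly_def coeff_sum coeff_smult
    by (intro sum_pos mult_pos_pos cq cpos) auto
  have "degree (Jpoly a b n) \<le> n" unfolding Jpoly_def
  proof (intro degree_sum_le finite_atMost)
    fix s assume "s \<in> {..n}"
    then show "degree (smult (?c s) (?q s)) \<le> n" by (intro order.trans[OF degree_smult_le]) (use dq in auto)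
  qed
  moreover have "n \<le> degree (Jpoly a b n)" using c by (intro le_degree) auto
  ultimately show "degree (Jpoly a b n) = n" by simp
qed

text \<open>The equation is verified on the explicit sum. With X = (x - 1) / 2 and Y = (x + 1) / 2
  one has 1 - x^2 = - 4 X Y, and the operator plus the eigenvalue maps the s-th summand to
  \<open>e s - f s\<close>. As \<open>f (Suc s) = e s\<close>, \<open>f 0 = 0\<close> and
  \<open>e n = 0\<close>, the sum telescopes to zero.\<close>

lemma Jpoly_ode:
  "(1 - x\<^sup>2) * poly (pderiv (pderiv (Jpoly a b n))) x + (b - a - (a + b + 2) * x) * poly (pderiv (Jpoly a b n)) x
    = - (real n * (real n + a + b + 1)) * poly (Jpoly a b n) x"
proof -
  define c where "c = (\<lambda>s. ((real n + a) gchoose (n - s)) * ((real n + b) gchoose s))"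
  define X where "X = (x - 1) / 2"
  define Y where "Y = (x + 1) / 2"
  define dX where "dX = (\<lambda>s. real s * X ^ (s - 1))"
  define dY where "dY = (\<lambda>k. real k * Y ^ (k - 1))"
  define ddX where "ddX = (\<lambda>s. real s * (real (s - 1) * X ^ (s - 1 - 1)))"
  define ddY where "ddY = (\<lambda>k. real k * (real (k - 1) * Y ^ (k - 1 - 1)))"
  have pX: "poly [:- 1 / 2, 1 / 2:] x = X" "poly [:1 / 2, 1 / 2:] x = Y"
    by (simp_all add: X_def Y_def field_simps)
  have pd: "pderiv [:- 1 / 2, 1 / 2:] = [:1 / 2::real:]" "pderiv [:1 / 2, 1 / 2:] = [:1 / 2::real:]"
    by (simp_all add: pderiv_pCons)
  have J0: "poly (Jpoly a b n) x = (\<Sum>s\<le>n. c s * (X ^ s * Y ^ (n - s)))"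
    by (simp only: Jpoly_def poly_sum poly_smult poly_mult poly_power pX c_def)
  have D: "pderiv (\<Sum>s\<le>n. f s) = (\<Sum>s\<le>n. pderiv (f s))" for f :: "nat \<Rightarrow> real poly"
    by (induction n) (simp_all add: pderiv_add)
  define F where "F = (\<lambda>s. [:- 1 / 2, 1 / 2::real:] ^ s)"
  define G where "G = (\<lambda>s. [:1 / 2, 1 / 2::real:] ^ s)"
  have F0: "poly (F s) x = X ^ s" for s by (simp only: F_def poly_power pX)
  have G0: "poly (G s) x = Y ^ s" for s by (simp only: G_def poly_power pX)
  have F': "pderiv (F s) = smult (real s / 2) (F (s - 1))" for s
    unfolding F_def pderiv_power pd by simp
  have G': "pderiv (G s) = smult (real s / 2) (G (s - 1))" for s
    unfolding G_def pderiv_power pd by simp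
  have F1: "poly (pderiv (F s)) x = dX s / 2" "poly (pderiv (pderiv (F s))) x = ddX s / 4" for s
    by (simp_all add: F' pderiv_smult F0 dX_def ddX_def)
  have G1: "poly (pderiv (G s)) x = dY s / 2" "poly (pderiv (pderiv (G s))) x = ddY s / 4" for s
    by (simp_all add: G' pderiv_smult G0 dY_def ddY_def)
  have J: "Jpoly a b n = (\<Sum>s\<le>n. smult (c s) (F s * G (n - s)))"
    by (simp add: Jpoly_def c_def F_def G_def)
  have J1: "poly (pderiv (Jpoly a b n)) x = (\<Sum>s\<le>n. c s * (1 / 2 * (dX s * Y ^ (n - s) + X ^ s * dY (n - s))))"
    unfolding J D poly_sum pderiv_smult poly_smult pderiv_mult poly_add poly_mult F1 G1 F0 G0
    by (intro sum.cong refl arg_cong2[where f = "(*)"]) (simp add: algebra_simps)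
  have J2: "poly (pderiv (pderiv (Jpoly a b n))) x = (\<Sum>s\<le>n. c s * (1 / 4 *
     (ddX s * Y ^ (n - s) + 2 * dX s * dY (n - s) + X ^ s * ddY (n - s))))"
    unfolding J D poly_sum pderiv_smult poly_smult pderiv_mult pderiv_add poly_add poly_mult F1 G1 F0 G0
    by (intro sum.cong refl arg_cong2[where f = "(*)"]) (simp add: algebra_simps)
  define e where "e = (\<lambda>s. c s * (real (n - s) + b) * (real (n - s) * X ^ s * Y ^ (n - s) - X ^ Suc s * dY (n - s)))"
  define f where "f = (\<lambda>s. c s * (real s + a) * (dX s * Y ^ Suc (n - s) - real s * X ^ s * Y ^ (n - s)))"
  have Xd: "X * dX s = real s * X ^ s" "X * ddX s = (real s - 1) * dX s" for s
    unfolding dX_def ddX_def by (cases s; cases "s - 1"; simp)+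
  have Yd: "Y * dY s = real s * Y ^ s" "Y * ddY s = (real s - 1) * dY s" for s
    unfolding dY_def ddY_def by (cases s; cases "s - 1"; simp)+
  have YX: "1 - x\<^sup>2 = - 4 * X * Y" "b - a - (a + b + 2) * x = - 2 * ((a + 1) * Y + (b + 1) * X)"
    by (simp_all add: X_def Y_def field_simps power2_eq_square)
  have summand: "(1 - x\<^sup>2) * (1 / 4 * (ddX s * Y ^ (n - s) + 2 * dX s * dY (n - s) + X ^ s * ddY (n - s)))
     + (b - a - (a + b + 2) * x) * (1 / 2 * (dX s * Y ^ (n - s) + X ^ s * dY (n - s)))
     + real n * (real n + a + b + 1) * (X ^ s * Y ^ (n - s))
    = (real (n - s) + b) * (real (n - s) * X ^ s * Y ^ (n - s) - X ^ Suc s * dY (n - s))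
      - (real s + a) * (dX s * Y ^ Suc (n - s) - real s * X ^ s * Y ^ (n - s))" if "s \<le> n" for s
  proof -
    define k where "k = n - s"
    have n: "real n = real s + real k" using that by (simp add: k_def)
    define S where "S = real s" define K where "K = real k"
    define U where "U = X ^ s" define V where "V = Y ^ k"
    have x1: "X * dX s = S * U" "X * ddX s = (S - 1) * dX s" using Xd[of s] by (auto simp: S_def U_def)
    have y1: "Y * dY k = K * V" "Y * ddY k = (K - 1) * dY k" using Yd[of k] by (auto simp: K_def V_def)
    have "- 4 * X * Y * (1 / 4 * (ddX s * V + 2 * dX s * dY k + U * ddY k))
      = - ((X * ddX s) * Y * V + 2 * (X * dX s) * (Y * dY k) + X * U * (Y * ddY k))" by (simp add: algebra_simps)
    also have "\<dots> = - ((S - 1) * dX s * Y * V + 2 * S * K * U * V + X * U * ((K - 1) * dY k))"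
      unfolding x1 y1 by (simp add: algebra_simps)
    finally have A: "- 4 * X * Y * (1 / 4 * (ddX s * V + 2 * dX s * dY k + U * ddY k)) = \<dots>" .
    have "- 2 * ((a + 1) * Y + (b + 1) * X) * (1 / 2 * (dX s * V + U * dY k))
      = - ((a + 1) * (Y * dX s * V + U * (Y * dY k)) + (b + 1) * ((X * dX s) * V + X * U * dY k))"
      by (simp add: algebra_simps)
    also have "\<dots> = - ((a + 1) * (Y * dX s * V + U * (K * V)) + (b + 1) * (S * U * V + X * U * dY k))"
      unfolding x1 y1 ..
    finally have B: "- 2 * ((a + 1) * Y + (b + 1) * X) * (1 / 2 * (dX s * V + U * dY k)) = \<dots>" .
    show ?thesis
      unfolding YX n k_def[symmetric] S_def[symmetric] K_def[symmetric] power_Suc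
        U_def[symmetric] V_def[symmetric] A B
      by (simp add: algebra_simps)
  qed
  \<comment> \<open>Only here do the coefficients matter: absorption for generalized binomials, (k +
    1) binom(n + a, k + 1) = (n + a - k) binom(n + a, k), applied once in a and once in b.\<close>
  have ef: "f (Suc s) = e s" if "s < n" for s
  proof -
    define k where "k = n - Suc s"
    have k: "n - s = Suc k" using that by (simp add: k_def)
    have nn: "real n = real s + 1 + real k" using that by (simp add: k_def)
    define p p' r r' where "p = (real n + a) gchoose Suc k" and "p' = (real n + a) gchoose k"
      and "r = (real n + b) gchoose Suc s" and "r' = (real n + b) gchoose s"
    have h1: "real (Suc k) * p = (real (Suc s) + a) * p'"
      using gbinomial_mult_1[of "real n + a" k] nn by (simp add: p_def p'_def algebra_simps)
    have h2: "real (Suc s) * r = (real (Suc k) + b) * r'"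
      using gbinomial_mult_1[of "real n + b" s] nn by (simp add: r_def r'_def algebra_simps)
    have "c (Suc s) * (real (Suc s) + a) * real (Suc s) = ((real (Suc s) + a) * p') * (real (Suc s) * r)"
      unfolding c_def k_def[symmetric] p'_def r_def by (simp only: mult_ac)
    also have "\<dots> = (real (Suc k) * p) * ((real (Suc k) + b) * r')" unfolding h1 h2 ..
    also have "\<dots> = c s * (real (Suc k) + b) * real (Suc k)"
      unfolding c_def k p_def r'_def by (simp only: mult_ac)
    finally have "c (Suc s) * (real (Suc s) + a) * real (Suc s) = c s * (real (Suc k) + b) * real (Suc k)" .
    moreover have "f (Suc s) = c (Suc s) * (real (Suc s) + a) * real (Suc s) * (X ^ s * Y ^ Suc k - X ^ Suc s * Y ^ k)"
      unfolding f_def dX_def k_def[symmetric] by (simp add: algebra_simps)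
    moreover have "e s = c s * (real (Suc k) + b) * real (Suc k) * (X ^ s * Y ^ Suc k - X ^ Suc s * Y ^ k)"
      unfolding e_def dY_def k by (simp add: algebra_simps)
    ultimately show ?thesis by simp
  qed
  have scale: "A * (k * u) + B * (k * v) + L * (k * w) = k * p1 * p2 - k * q1 * q2"
    if "A * u + B * v + L * w = p1 * p2 - q1 * q2" for A B L u v w p1 p2 q1 q2 k :: real
  proof -
    have "A * (k * u) + B * (k * v) + L * (k * w) = k * (A * u + B * v + L * w)" by (simp add: algebra_simps)
    then show ?thesis unfolding that by (simp add: algebra_simps)
  qed
  have "(1 - x\<^sup>2) * poly (pderiv (pderiv (Jpoly a b n))) x + (b - a - (a + b + 2) * x) * poly (pderiv (Jpoly a b n)) x
     + real n * (real n + a + b + 1) * poly (Jpoly a b n) x = (\<Sum>s\<le>n. e s - f s)"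
    unfolding J0 J1 J2 sum_distrib_left sum.distrib[symmetric]
  proof (rule sum.cong[OF refl])
    fix s assume "s \<in> {..n}"
    then have "s \<le> n" by simp
    show "(1 - x\<^sup>2) * (c s * (1 / 4 * (ddX s * Y ^ (n - s) + 2 * dX s * dY (n - s) + X ^ s * ddY (n - s))))
       + (b - a - (a + b + 2) * x) * (c s * (1 / 2 * (dX s * Y ^ (n - s) + X ^ s * dY (n - s))))
       + real n * (real n + a + b + 1) * (c s * (X ^ s * Y ^ (n - s))) = e s - f s"
      unfolding e_def f_def by (rule scale[OF summand[OF \<open>s \<le> n\<close>]])
  qed
  also have "\<dots> = (\<Sum>s\<le>n. e s) - (\<Sum>s\<le>n. f s)" by (rule sum_subtractf)
  also have "(\<Sum>s\<le>n. f s) = (\<Sum>s<n. f (Suc s))"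
    by (simp add: lessThan_Suc_atMost[symmetric] sum.lessThan_Suc_shift f_def dX_def del: sum.lessThan_Suc)
  also have "\<dots> = (\<Sum>s<n. e s)" by (intro sum.cong) (auto simp: ef)
  also have "(\<Sum>s\<le>n. e s) = (\<Sum>s<n. e s)"
    by (simp add: lessThan_Suc_atMost[symmetric] e_def dY_def)
  finally show ?thesis by simp
qed

definition Npoly :: "real \<Rightarrow> real \<Rightarrow> nat \<Rightarrow> real poly" where
  "Npoly a b n = smult (1 / Lp_norm (jacobi_measure1 a b) 2 (jacobi_poly a b n)) (Jpoly a b n)"

lemma poly_Npoly: "poly (Npoly a b n) = jacobi_poly_normalized a b n"
  by (rule ext) (simp add: Npoly_def jacobi_poly_normalized_def poly_Jpoly)

lemma Lp_norm_2: "Lp_norm M 2 (f :: _ \<Rightarrow> real) = sqrt (\<integral>x. (f x)\<^sup>2 \<partial>M)"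
  by (simp add: Lp_norm_def powr_half_sqrt integral_nonneg_AE)

context
  fixes a b :: real
  assumes ab: "a \<ge> - 1 / 2" "b \<ge> - 1 / 2"
begin

private lemma ab1: "a > - 1" "b > - 1" using ab by auto

lemma Jpoly_nonzero: "Jpoly a b n \<noteq> 0"
  using degree_Jpoly(2)[OF ab1, of n] by force

lemma norm_Jpoly_pos: "Lp_norm (jacobi_measure1 a b) 2 (jacobi_poly a b n) > 0"
  unfolding Lp_norm_2 poly_Jpoly[symmetric]
  using integral_jacobi_measure1_poly_square_pos[OF ab1 Jpoly_nonzero] by simp

lemma degree_Npoly: "degree (Npoly a b n) = n"
  using norm_Jpoly_pos[of n] degree_Jpoly(1)[OF ab1] by (simp add: Npoly_def)

lemma Npoly_ode:
  "(1 - x\<^sup>2) * poly (pderiv (pderiv (Npoly a b n))) x + (b - a - (a + b + 2) * x) * poly (pderiv (Npoly a b n)) x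
    = - (real n * (real n + a + b + 1)) * poly (Npoly a b n) x"
proof -
  define r where "r = 1 / Lp_norm (jacobi_measure1 a b) 2 (jacobi_poly a b n)"
  from arg_cong[OF Jpoly_ode[of x a b n], of "\<lambda>u. r * u"] show ?thesis
    by (simp add: Npoly_def pderiv_smult r_def[symmetric] algebra_simps)
qed

text \<open>For n \<noteq> k the divergence identity is applied to the Wronskian p' q - p q', which
  by the differential equation leaves (\<lambda>_k - \<lambda>_n) p q. The eigenvalues differ since
  a + b + 1 \<ge> 0 and n + k \<ge> 1.\<close>

lemma Npoly_orthonormal:
  "(\<integral>x. poly (Npoly a b n) x * poly (Npoly a b k) x \<partial>jacobi_measure1 a b) = (if n = k then 1 else 0)"
proof (cases "n = k")
  case True
  let ?N = "Lp_norm (jacobi_measure1 a b) 2 (jacobi_poly a b n)"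
  have "(\<integral>x. poly (Npoly a b n) x * poly (Npoly a b n) x \<partial>jacobi_measure1 a b)
     = (\<integral>x. (1 / ?N\<^sup>2) * (jacobi_poly a b n x)\<^sup>2 \<partial>jacobi_measure1 a b)"
    by (intro Bochner_Integration.integral_cong refl)
      (simp add: Npoly_def poly_Jpoly power2_eq_square)
  also have "\<dots> = 1 / ?N\<^sup>2 * (\<integral>x. (jacobi_poly a b n x)\<^sup>2 \<partial>jacobi_measure1 a b)" by simp
  also have "(\<integral>x. (jacobi_poly a b n x)\<^sup>2 \<partial>jacobi_measure1 a b) = ?N\<^sup>2"
    using norm_Jpoly_pos[of n] unfolding Lp_norm_2 by (simp add: integral_nonneg_AE)
  finally show ?thesis using True norm_Jpoly_pos[of n] by simp
next
  case False
  let ?p = "Npoly a b n" and ?q = "Npoly a b k"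
  let ?l = "\<lambda>n. real n * (real n + a + b + 1)"
  have "(\<integral>x. (1 - x\<^sup>2) * poly (pderiv (pderiv ?p * ?q - ?p * pderiv ?q)) x
    + (b - a - (a + b + 2) * x) * poly (pderiv ?p * ?q - ?p * pderiv ?q) x \<partial>jacobi_measure1 a b) = 0"
    by (intro integral_jacobi_divergence[OF ab1] poly_DERIV continuous_intros)
  also have "(\<lambda>x. (1 - x\<^sup>2) * poly (pderiv (pderiv ?p * ?q - ?p * pderiv ?q)) x
    + (b - a - (a + b + 2) * x) * poly (pderiv ?p * ?q - ?p * pderiv ?q) x)
    = (\<lambda>x. (?l k - ?l n) * (poly ?p x * poly ?q x))"
  proof
    fix x
    have "(1 - x\<^sup>2) * poly (pderiv (pderiv ?p * ?q - ?p * pderiv ?q)) x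
      + (b - a - (a + b + 2) * x) * poly (pderiv ?p * ?q - ?p * pderiv ?q) x
      = ((1 - x\<^sup>2) * poly (pderiv (pderiv ?p)) x + (b - a - (a + b + 2) * x) * poly (pderiv ?p) x) * poly ?q x
       - ((1 - x\<^sup>2) * poly (pderiv (pderiv ?q)) x + (b - a - (a + b + 2) * x) * poly (pderiv ?q) x) * poly ?p x"
      by (simp add: pderiv_mult pderiv_diff algebra_simps)
    then show "(1 - x\<^sup>2) * poly (pderiv (pderiv ?p * ?q - ?p * pderiv ?q)) x
      + (b - a - (a + b + 2) * x) * poly (pderiv ?p * ?q - ?p * pderiv ?q) x
      = (?l k - ?l n) * (poly ?p x * poly ?q x)"
      unfolding Npoly_ode by (simp add: algebra_simps)
  qed
  finally have "(?l k - ?l n) * (\<integral>x. poly ?p x * poly ?q x \<partial>jacobi_measure1 a b) = 0" by simp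
  moreover have "?l k - ?l n = (real k - real n) * (real k + real n + a + b + 1)" by (simp add: algebra_simps)
  moreover have "real k + real n + a + b + 1 > 0" using False ab
    by (cases "n = 0"; cases "k = 0") auto
  ultimately show ?thesis using False by auto
qed

text \<open>Integration by parts: the divergence identity for p' q, with the differential equation
  for p, reduces the left side to \<lambda>_n times the inner product of p and q.\<close>

lemma Npoly_gradient_orthogonal:
  "(\<integral>x. (1 - x\<^sup>2) * poly (pderiv (Npoly a b n)) x * poly (pderiv (Npoly a b k)) x \<partial>jacobi_measure1 a b)
    = (if n = k then real n * (real n + a + b + 1) else 0)"
proof -
  let ?p = "Npoly a b n" and ?q = "Npoly a b k"
  have "(\<integral>x. (1 - x\<^sup>2) * poly (pderiv (pderiv ?p * ?q)) x
    + (b - a - (a + b + 2) * x) * poly (pderiv ?p * ?q) x \<partial>jacobi_measure1 a b) = 0"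
    by (intro integral_jacobi_divergence[OF ab1] poly_DERIV continuous_intros)
  also have "(\<lambda>x. (1 - x\<^sup>2) * poly (pderiv (pderiv ?p * ?q)) x
    + (b - a - (a + b + 2) * x) * poly (pderiv ?p * ?q) x)
    = (\<lambda>x. (1 - x\<^sup>2) * poly (pderiv ?p) x * poly (pderiv ?q) x
        - (real n * (real n + a + b + 1)) * (poly ?p x * poly ?q x))"
  proof
    fix x
    have "(1 - x\<^sup>2) * poly (pderiv (pderiv ?p * ?q)) x
      + (b - a - (a + b + 2) * x) * poly (pderiv ?p * ?q) x
      = ((1 - x\<^sup>2) * poly (pderiv (pderiv ?p)) x + (b - a - (a + b + 2) * x) * poly (pderiv ?p) x) * poly ?q x
       + (1 - x\<^sup>2) * poly (pderiv ?p) x * poly (pderiv ?q) x"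
      by (simp add: pderiv_mult algebra_simps)
    then show "(1 - x\<^sup>2) * poly (pderiv (pderiv ?p * ?q)) x
      + (b - a - (a + b + 2) * x) * poly (pderiv ?p * ?q) x
      = (1 - x\<^sup>2) * poly (pderiv ?p) x * poly (pderiv ?q) x
        - (real n * (real n + a + b + 1)) * (poly ?p x * poly ?q x)"
      unfolding Npoly_ode by (simp add: algebra_simps)
  qed
  finally have "(\<integral>x. (1 - x\<^sup>2) * poly (pderiv ?p) x * poly (pderiv ?q) x \<partial>jacobi_measure1 a b)
     - (real n * (real n + a + b + 1)) * (\<integral>x. poly ?p x * poly ?q x \<partial>jacobi_measure1 a b) = 0"
    by (subst (asm) Bochner_Integration.integral_diff)
      (auto intro!: integrable_jacobi_measure1[OF ab1] continuous_intros)
  then show ?thesis unfolding Npoly_orthonormal by auto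
qed

lemma poly_Npoly_expansion:
  assumes "degree q \<le> N"
  shows "\<exists>c. q = (\<Sum>j\<le>N. smult (c j) (Npoly a b j))"
  using assms
proof (induction N arbitrary: q)
  case 0
  have "Npoly a b 0 \<noteq> 0" using norm_Jpoly_pos[of 0] Jpoly_nonzero by (simp add: Npoly_def)
  moreover obtain u where u: "q = [:u:]" using 0 by (auto elim: degree_eq_zeroE)
  moreover obtain v where v: "Npoly a b 0 = [:v:]" using degree_Npoly[of 0] by (auto elim: degree_eq_zeroE)
  ultimately have "q = smult (u / v) (Npoly a b 0)" by auto
  then show ?case by (intro exI[of _ "\<lambda>_. u / v"]) simp
next
  case (Suc N)
  let ?p = "Npoly a b (Suc N)"
  define r where "r = coeff q (Suc N) / coeff ?p (Suc N)"
  have "coeff ?p (Suc N) \<noteq> 0" using degree_Npoly[of "Suc N"]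
    by (metis degree_0 leading_coeff_0_iff nat.distinct(1))
  then have "coeff (q - smult r ?p) (Suc N) = 0" by (simp add: r_def)
  moreover have "degree (q - smult r ?p) \<le> Suc N"
    using Suc.prems degree_Npoly[of "Suc N"] by (intro degree_diff_le) (auto intro: order.trans[OF degree_smult_le])
  ultimately have "degree (q - smult r ?p) \<le> N"
    by (metis Suc_n_not_le_n eq_zero_or_degree_less le_Suc_eq less_Suc_eq_le degree_0 zero_le)
  from Suc.IH[OF this] obtain c where c: "q - smult r ?p = (\<Sum>j\<le>N. smult (c j) (Npoly a b j))" by blast
  then have "q = (\<Sum>j\<le>N. smult (c j) (Npoly a b j)) + smult r ?p" by (simp add: algebra_simps)
  also have "\<dots> = (\<Sum>j\<le>Suc N. smult ((c(Suc N := r)) j) (Npoly a b j))" by simp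
  finally show ?case by blast
qed

end

section \<open>The product measure and tensor products\<close>

text \<open>Partial derivatives are expressed throughout as derivatives of
  \<open>\<lambda>s. f (upd x i s)\<close> at an arbitrary \<open>s\<close>, which is also the form
  in which fibres of the product measure are integrated.\<close>

definition upd :: "'a ^ 'n \<Rightarrow> 'n \<Rightarrow> 'a \<Rightarrow> 'a ^ 'n" where
  "upd x i s = (\<chi> j. if j = i then s else x $ j)"

lemma upd_nth [simp]: "upd x i s $ j = (if j = i then s else x $ j)"
  by (simp add: upd_def)

lemma upd_same [simp]: "upd x i (x $ i) = x"
  by (simp add: vec_eq_iff)

lemma continuous_on_upd [continuous_intros]:
  "continuous_on S f \<Longrightarrow> continuous_on S g \<Longrightarrow> continuous_on S (\<lambda>x. upd (f x :: real ^ 'n) i (g x :: real))"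
  unfolding upd_def
proof (rule continuous_on_vec_lambda)
  fix j assume "continuous_on S f" "continuous_on S g"
  then show "continuous_on S (\<lambda>x. if j = i then g x else f x $ j)"
    by (cases "j = i") (auto intro!: continuous_intros)
qed

definition tensor :: "('n \<Rightarrow> real poly) \<Rightarrow> real ^ 'n \<Rightarrow> real" where
  "tensor A x = (\<Prod>i\<in>UNIV. poly (A i) (x $ i))"

text \<open>Acts on the factors, so that \<open>tensor (pd i A)\<close> is the i-th partial
  derivative of \<open>tensor A\<close>. Derivatives of tensors thus remain tensors, and partial
  derivatives commute already on the factors.\<close>

definition pd :: "'n \<Rightarrow> ('n \<Rightarrow> real poly) \<Rightarrow> 'n \<Rightarrow> real poly" where
  "pd i A = A(i := pderiv (A i))"

lemma pd_commute: "pd i (pd j A) = pd j (pd i A)"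
  by (auto simp: pd_def fun_eq_iff)

lemma tensor_split: "tensor A x = poly (A i) (x $ i) * (\<Prod>j\<in>UNIV - {i}. poly (A j) (x $ j))"
  unfolding tensor_def by (subst prod.remove[of UNIV i]) auto

lemma tensor_upd: "tensor (A(i := q)) x = poly q (x $ i) * (\<Prod>j\<in>UNIV - {i}. poly (A j) (x $ j))"
  by (subst tensor_split[of _ _ i]) (auto intro!: prod.cong)

lemma DERIV_tensor:
  "((\<lambda>s. tensor A (upd x i s)) has_real_derivative tensor (pd i A) (upd x i s)) (at s)"
proof -
  have e: "tensor B (upd x i s) = poly (B i) s * (\<Prod>j\<in>UNIV - {i}. poly (B j) (x $ j))" for B s
    by (subst tensor_split[of _ _ i]) (auto intro!: prod.cong)
  have "(\<Prod>j\<in>UNIV - {i}. poly (pd i A j) (x $ j)) = (\<Prod>j\<in>UNIV - {i}. poly (A j) (x $ j))"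
    by (intro prod.cong) (auto simp: pd_def)
  then show ?thesis unfolding e
    by (auto intro!: DERIV_cmult_right poly_DERIV simp: pd_def)
qed

lemma continuous_on_tensor [continuous_intros]:
  "continuous_on S f \<Longrightarrow> continuous_on S (\<lambda>x. tensor A (f x))"
  unfolding tensor_def by (intro continuous_intros)

locale jacobi =
  fixes \<alpha> \<beta> :: "real ^ 'n"
  assumes \<alpha>: "\<And>i. \<alpha> $ i \<ge> - 1 / 2" and \<beta>: "\<And>i. \<beta> $ i \<ge> - 1 / 2"
begin

abbreviation "\<nu> \<equiv> jacobi_measure \<alpha> \<beta>"
abbreviation "\<mu> i \<equiv> jacobi_measure1 (\<alpha> $ i) (\<beta> $ i)"

lemma ab1: "\<alpha> $ i > - 1" "\<beta> $ i > - 1"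
  using \<alpha>[of i] \<beta>[of i] by auto

lemma prob_\<mu>: "prob_space (\<mu> i)"
  by (rule prob_space_jacobi_measure1[OF ab1])

sublocale prod: product_prob_space \<mu> UNIV
  by (rule product_prob_spaceI) (rule prob_\<mu>)

lemma measurable_vec [measurable]:
  "(\<lambda>x. \<chi> i. x i) \<in> measurable (PiM UNIV \<mu>) (restrict_space borel open_cube)"
proof (rule measurable_restrict_space2)
  have c: "(\<lambda>x. x i) \<in> borel_measurable (PiM UNIV \<mu>)" for i
  proof -
    have "(\<lambda>x. x) \<in> borel_measurable (\<mu> i)" by (rule measurable_jacobi_measure1I[OF ab1]) simp
    from measurable_compose[OF measurable_component_singleton[of i UNIV \<mu>] this] show ?thesis by simp
  qed
  show "(\<lambda>x. \<chi> i. x i) \<in> borel_measurable (PiM UNIV \<mu>)"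
    by (subst borel_measurable_euclidean_space) (auto simp: Basis_vec_def inner_axis c)
  show "(\<lambda>x. \<chi> i. x i) \<in> space (PiM UNIV \<mu>) \<rightarrow> open_cube"
    by (auto simp: space_PiM PiE_iff space_jacobi_measure1[OF ab1] open_cube_def)
qed

lemma space_\<nu>: "space \<nu> = open_cube"
  by (simp add: jacobi_measure_def space_restrict_space)

lemma sets_\<nu> [measurable_cong]: "sets \<nu> = sets (restrict_space borel open_cube)"
  by (simp add: jacobi_measure_def)

lemma measurable_\<nu>I [measurable (raw)]: "f \<in> borel_measurable borel \<Longrightarrow> f \<in> borel_measurable \<nu>"
  by (subst measurable_cong_sets[OF sets_\<nu> refl]) (rule measurable_restrict_space1)

lemma prob_\<nu>: "prob_space \<nu>"
  unfolding jacobi_measure_def by (rule prod.P.prob_space_distr[OF measurable_vec])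

sublocale nu: prob_space \<nu> by (rule prob_\<nu>)

lemma integral_\<nu>:
  fixes f :: "real ^ 'n \<Rightarrow> real"
  assumes "f \<in> borel_measurable borel"
  shows "(\<integral>x. f x \<partial>\<nu>) = (\<integral>x. f (\<chi> i. x i) \<partial>PiM UNIV \<mu>)"
  unfolding jacobi_measure_def
  by (rule integral_distr) (auto intro: measurable_restrict_space1 assms)

lemma bounded_on_cube:
  fixes f :: "real ^ 'n \<Rightarrow> real"
  assumes "continuous_on UNIV f"
  obtains B where "\<And>x. x \<in> open_cube \<Longrightarrow> \<bar>f x\<bar> \<le> B"
proof -
  have "compact (f ` cbox (\<chi> i. -1) (\<chi> i. 1))"
    by (intro compact_continuous_image continuous_on_subset[OF assms]) auto
  then obtain B where B: "\<And>x. x \<in> cbox (\<chi> i. -1) (\<chi> i. 1) \<Longrightarrow> norm (f x) \<le> B"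
    by (meson compact_imp_bounded bounded_iff imageI)
  have "x \<in> cbox (\<chi> i. -1) (\<chi> i. 1)" if "x \<in> open_cube" for x :: "real ^ 'n"
    using that by (auto simp: open_cube_def mem_box_cart less_imp_le)
  with B show ?thesis by (intro that[of B]) auto
qed

lemma continuous_measurable_\<nu>: "continuous_on UNIV f \<Longrightarrow> f \<in> borel_measurable \<nu>"
  by (intro measurable_\<nu>I borel_measurable_continuous_onI)

lemma continuous_integrable_\<nu>:
  fixes f :: "real ^ 'n \<Rightarrow> real"
  assumes "continuous_on UNIV f" shows "integrable \<nu> f"
proof -
  obtain B where "\<And>x. x \<in> open_cube \<Longrightarrow> \<bar>f x\<bar> \<le> B" using bounded_on_cube[OF assms] by blast
  then show ?thesis
    by (intro nu.integrable_const_bound[of _ B] continuous_measurable_\<nu> assms AE_I2) (auto simp: space_\<nu>)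
qed

text \<open>Replacing the i-th coordinate of a random point by an independent copy does not change
  the product measure. By Fubini the integral is therefore an average of integrals over fibres,
  without splitting the cube into factors.\<close>

lemma integral_zero_of_fibres:
  fixes f :: "real ^ 'n \<Rightarrow> real"
  assumes f: "continuous_on UNIV f" and 0: "\<And>x. (\<integral>s. f (upd x i s) \<partial>\<mu> i) = 0"
  shows "(\<integral>x. f x \<partial>\<nu>) = 0"
proof -
  interpret i: prob_space "\<mu> i" by (rule prob_\<mu>)
  interpret pair_sigma_finite "\<mu> i" "PiM UNIV \<mu>" by unfold_locales
  let ?u = "\<lambda>(s::real, X::'n \<Rightarrow> real). X(i := s)"
  let ?g = "\<lambda>x. f (\<chi> i. x i)"
  have fm: "f \<in> borel_measurable (restrict_space borel open_cube)"
    by (intro measurable_restrict_space1 borel_measurable_continuous_onI f)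
  have gm: "?g \<in> borel_measurable (PiM UNIV \<mu>)"
    by (rule measurable_compose[OF measurable_vec fm])
  have D: "distr (\<mu> i \<Otimes>\<^sub>M PiM UNIV \<mu>) (PiM UNIV \<mu>) ?u = PiM UNIV \<mu>"
    using distr_pair_PiM_eq_PiM[of UNIV \<mu> i] prob_\<mu> by simp
  have um: "?u \<in> measurable (\<mu> i \<Otimes>\<^sub>M PiM UNIV \<mu>) (PiM UNIV \<mu>)"
    by (simp add: case_prod_beta') (rule measurable_fun_upd[where J = UNIV]; auto)
  have int: "integrable (PiM UNIV \<mu>) ?g"
  proof -
    have "integrable (distr (PiM UNIV \<mu>) (restrict_space borel open_cube) (\<lambda>x. \<chi> i. x i)) f"
      using continuous_integrable_\<nu>[OF f] by (simp add: jacobi_measure_def)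
    then show ?thesis by (subst (asm) integrable_distr_eq) (auto intro: fm)
  qed
  have "(\<integral>x. f x \<partial>\<nu>) = (\<integral>x. ?g x \<partial>distr (\<mu> i \<Otimes>\<^sub>M PiM UNIV \<mu>) (PiM UNIV \<mu>) ?u)"
    unfolding D by (intro integral_\<nu> borel_measurable_continuous_onI f)
  also have "\<dots> = (\<integral>z. ?g (?u z) \<partial>(\<mu> i \<Otimes>\<^sub>M PiM UNIV \<mu>))"
    by (rule integral_distr[OF um gm])
  also have "\<dots> = (\<integral>X. (\<integral>s. ?g (?u (s, X)) \<partial>\<mu> i) \<partial>PiM UNIV \<mu>)"
  proof -
    have "integrable (distr (\<mu> i \<Otimes>\<^sub>M PiM UNIV \<mu>) (PiM UNIV \<mu>) ?u) ?g" unfolding D by (rule int)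
    then have "integrable (\<mu> i \<Otimes>\<^sub>M PiM UNIV \<mu>) (\<lambda>z. ?g (?u z))"
      by (subst (asm) integrable_distr_eq[OF um gm])
    then have "integrable (\<mu> i \<Otimes>\<^sub>M PiM UNIV \<mu>) (\<lambda>(s, X). ?g (?u (s, X)))" by (simp add: case_prod_beta')
    from integral_snd[OF this] show ?thesis by (simp add: case_prod_beta')
  qed
  also have "(\<lambda>X. \<integral>s. ?g (?u (s, X)) \<partial>\<mu> i) = (\<lambda>X. 0)"
  proof
    fix X :: "'n \<Rightarrow> real"
    have "(\<chi> j. (X(i := s)) j) = upd (\<chi> j. X j) i s" for s by (simp add: vec_eq_iff)
    then show "(\<integral>s. ?g (?u (s, X)) \<partial>\<mu> i) = 0" using 0[of "\<chi> j. X j"] by simp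
  qed
  finally show ?thesis by simp
qed

text \<open>With \<open>g\<close> the i-th partial derivative of a function h, the integrand is the
  i-th summand of - L h; this is how L disappears after integration in x.\<close>

lemma integral_divergence_\<nu>:
  fixes g g' :: "real ^ 'n \<Rightarrow> real"
  assumes g: "continuous_on UNIV g" and g': "continuous_on UNIV g'"
    and D: "\<And>x s. ((\<lambda>s. g (upd x i s)) has_real_derivative g' (upd x i s)) (at s)"
  shows "(\<integral>x. (1 - (x $ i)\<^sup>2) * g' x + (\<beta> $ i - \<alpha> $ i - (\<alpha> $ i + \<beta> $ i + 2) * x $ i) * g x \<partial>\<nu>) = 0"
proof (rule integral_zero_of_fibres)
  show "continuous_on UNIV (\<lambda>x. (1 - (x $ i)\<^sup>2) * g' x + (\<beta> $ i - \<alpha> $ i - (\<alpha> $ i + \<beta> $ i + 2) * x $ i) * g x)"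
    by (intro continuous_intros g g')
  fix x
  have "continuous_on UNIV (\<lambda>s. g' (upd x i s))"
    by (rule continuous_on_compose2[OF g']) (auto intro!: continuous_intros)
  from integral_jacobi_divergence[OF ab1 D this]
  show "(\<integral>s. (1 - (upd x i s $ i)\<^sup>2) * g' (upd x i s)
    + (\<beta> $ i - \<alpha> $ i - (\<alpha> $ i + \<beta> $ i + 2) * upd x i s $ i) * g (upd x i s) \<partial>\<mu> i) = 0" by simp
qed

lemma integral_\<nu>_prod:
  fixes f :: "'n \<Rightarrow> real \<Rightarrow> real"
  assumes "\<And>i. continuous_on UNIV (f i)"
  shows "(\<integral>x. (\<Prod>i\<in>UNIV. f i (x $ i)) \<partial>\<nu>) = (\<Prod>i\<in>UNIV. \<integral>s. f i s \<partial>\<mu> i)"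
proof -
  have "continuous_on UNIV (\<lambda>x. \<Prod>i\<in>UNIV. f i (x $ i))"
    by (intro continuous_on_prod continuous_on_compose2[OF assms]) (auto intro!: continuous_intros)
  from integral_\<nu>[OF borel_measurable_continuous_onI[OF this]]
  have "(\<integral>x. (\<Prod>i\<in>UNIV. f i (x $ i)) \<partial>\<nu>) = (\<integral>x. (\<Prod>i\<in>UNIV. f i (x i)) \<partial>PiM UNIV \<mu>)" by simp
  also have "\<dots> = (\<Prod>i\<in>UNIV. \<integral>s. f i s \<partial>\<mu> i)"
    by (rule prod.product_integral_prod) (auto intro!: integrable_jacobi_measure1[OF ab1] assms)
  finally show ?thesis .
qed

section \<open>The tensor basis: eigenvalues and orthogonality\<close>

definition basis_polys :: "nat ^ 'n \<Rightarrow> 'n \<Rightarrow> real poly" where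
  "basis_polys k i = Npoly (\<alpha> $ i) (\<beta> $ i) (k $ i)"

lemma jacobi_basis_eq_tensor: "jacobi_basis \<alpha> \<beta> k = tensor (basis_polys k)"
  by (rule ext) (simp add: jacobi_basis_def tensor_def basis_polys_def poly_Npoly)

definition eigen1 :: "'n \<Rightarrow> nat ^ 'n \<Rightarrow> real" where
  "eigen1 i k = real (k $ i) * (real (k $ i) + \<alpha> $ i + \<beta> $ i + 1)"

lemma jacobi_eigenvalue_eq: "jacobi_eigenvalue \<alpha> \<beta> k = (\<Sum>i\<in>UNIV. eigen1 i k)"
  by (simp add: jacobi_eigenvalue_def eigen1_def)

lemma eigen1_nonneg: "eigen1 i k \<ge> 0"
  unfolding eigen1_def using \<alpha>[of i] \<beta>[of i] by (intro mult_nonneg_nonneg) auto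

lemma eigenvalue_pos:
  assumes "k \<noteq> 0" shows "jacobi_eigenvalue \<alpha> \<beta> k > 0"
proof -
  obtain i where "k $ i \<noteq> 0" using assms by (metis vec_eq_iff zero_index)
  then have "eigen1 i k > 0" unfolding eigen1_def using \<alpha>[of i] \<beta>[of i] by (intro mult_pos_pos) auto
  then show ?thesis unfolding jacobi_eigenvalue_eq by (intro sum_pos2[of _ i]) (auto simp: eigen1_nonneg)
qed

lemma basis_orthonormal:
  "(\<integral>x. tensor (basis_polys k) x * tensor (basis_polys l) x \<partial>\<nu>) = (if k = l then 1 else 0)"
proof -
  have "(\<integral>x. tensor (basis_polys k) x * tensor (basis_polys l) x \<partial>\<nu>)
    = (\<integral>x. (\<Prod>i\<in>UNIV. poly (basis_polys k i) (x $ i) * poly (basis_polys l i) (x $ i)) \<partial>\<nu>)"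
    by (simp add: tensor_def prod.distrib)
  also have "\<dots> = (\<Prod>i\<in>UNIV. \<integral>s. poly (basis_polys k i) s * poly (basis_polys l i) s \<partial>\<mu> i)"
    by (rule integral_\<nu>_prod) (intro continuous_intros)
  also have "\<dots> = (\<Prod>i\<in>UNIV. if k $ i = l $ i then 1 else 0)"
    unfolding basis_polys_def Npoly_orthonormal[OF \<alpha> \<beta>] ..
  also have "\<dots> = (if k = l then 1 else 0)" by (auto simp: vec_eq_iff prod_zero_iff)
  finally show ?thesis .
qed

lemma basis_gradient_orthogonal:
  "(\<integral>x. (1 - (x $ i)\<^sup>2) * tensor (pd i (basis_polys k)) x * tensor (pd i (basis_polys l)) x \<partial>\<nu>)
    = (if k = l then eigen1 i k else 0)"
proof -
  let ?f = "\<lambda>j s. if j = i then (1 - s\<^sup>2) * poly (pderiv (basis_polys k i)) s * poly (pderiv (basis_polys l i)) s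
       else poly (basis_polys k j) s * poly (basis_polys l j) s"
  have "(\<integral>x. (1 - (x $ i)\<^sup>2) * tensor (pd i (basis_polys k)) x * tensor (pd i (basis_polys l)) x \<partial>\<nu>)
    = (\<integral>x. (\<Prod>j\<in>UNIV. ?f j (x $ j)) \<partial>\<nu>)"
  proof (intro Bochner_Integration.integral_cong refl)
    fix x :: "real ^ 'n"
    have "(\<Prod>j\<in>UNIV. ?f j (x $ j)) = ?f i (x $ i) * (\<Prod>j\<in>UNIV-{i}. ?f j (x $ j))"
      by (subst prod.remove[of UNIV i]) auto
    also have "(\<Prod>j\<in>UNIV-{i}. ?f j (x $ j)) = (\<Prod>j\<in>UNIV-{i}. poly (basis_polys k j) (x $ j)) * (\<Prod>j\<in>UNIV-{i}. poly (basis_polys l j) (x $ j))"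
      unfolding prod.distrib[symmetric] by (intro prod.cong) auto
    finally show "(1 - (x $ i)\<^sup>2) * tensor (pd i (basis_polys k)) x * tensor (pd i (basis_polys l)) x
       = (\<Prod>j\<in>UNIV. ?f j (x $ j))"
      unfolding pd_def tensor_upd by simp
  qed
  also have "\<dots> = (\<Prod>j\<in>UNIV. \<integral>s. ?f j s \<partial>\<mu> j)"
  proof (rule integral_\<nu>_prod)
    show "continuous_on UNIV (?f j)" for j by (cases "j = i") (auto intro!: continuous_intros)
  qed
  also have "\<dots> = (\<integral>s. ?f i s \<partial>\<mu> i) * (\<Prod>j\<in>UNIV-{i}. \<integral>s. ?f j s \<partial>\<mu> j)"
    by (subst prod.remove[of UNIV i]) auto
  also have "(\<integral>s. ?f i s \<partial>\<mu> i) = (if k $ i = l $ i then eigen1 i k else 0)"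
    unfolding basis_polys_def eigen1_def by (simp add: Npoly_gradient_orthogonal[OF \<alpha> \<beta>])
  also have "(\<Prod>j\<in>UNIV-{i}. \<integral>s. ?f j s \<partial>\<mu> j) = (\<Prod>j\<in>UNIV-{i}. if k $ j = l $ j then 1 else 0)"
    unfolding basis_polys_def by (intro prod.cong) (auto simp: Npoly_orthonormal[OF \<alpha> \<beta>])
  also have "(if k $ i = l $ i then eigen1 i k else 0) * (\<Prod>j\<in>UNIV-{i}. if k $ j = l $ j then 1 else 0)
     = (if k = l then eigen1 i k else 0)"
    by (auto simp: vec_eq_iff prod_zero_iff)
  finally show ?thesis .
qed

text \<open>By \<open>polynomial_jspan\<close> and \<open>jspan_polynomial\<close> these are exactly
  the polynomials; in this form Riesz transforms and Poisson extensions of polynomials are finite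
  sums.\<close>

definition jspan :: "(real ^ 'n \<Rightarrow> real) set" where
  "jspan = {f. \<exists>F c. finite F \<and> f = (\<lambda>x. \<Sum>k\<in>F. c k * tensor (basis_polys k) x)}"

lemma jspanI: "finite F \<Longrightarrow> (\<lambda>x. \<Sum>k\<in>F. c k * tensor (basis_polys k) x) \<in> jspan"
  unfolding jspan_def by blast

lemma jspan_basis: "tensor (basis_polys k) \<in> jspan"
  unfolding jspan_def by (intro CollectI exI[of _ "{k}"] exI[of _ "\<lambda>_. 1"]) auto

lemma jspan_add:
  assumes "f \<in> jspan" "g \<in> jspan" shows "(\<lambda>x. f x + g x) \<in> jspan"
proof -
  obtain F c where F: "finite F" "f = (\<lambda>x. \<Sum>k\<in>F. c k * tensor (basis_polys k) x)"
    using assms by (auto simp: jspan_def)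
  obtain G d where G: "finite G" "g = (\<lambda>x. \<Sum>k\<in>G. d k * tensor (basis_polys k) x)"
    using assms by (auto simp: jspan_def)
  let ?c = "\<lambda>k. (if k \<in> F then c k else 0) + (if k \<in> G then d k else 0)"
  have "f x = (\<Sum>k\<in>F \<union> G. (if k \<in> F then c k else 0) * tensor (basis_polys k) x)" for x
    unfolding F by (intro sum.mono_neutral_cong_left) (auto simp: F G)
  moreover have "g x = (\<Sum>k\<in>F \<union> G. (if k \<in> G then d k else 0) * tensor (basis_polys k) x)" for x
    unfolding G by (intro sum.mono_neutral_cong_left) (auto simp: F G)
  ultimately have "(\<lambda>x. f x + g x) = (\<lambda>x. \<Sum>k\<in>F \<union> G. ?c k * tensor (basis_polys k) x)"
    by (simp add: sum.distrib[symmetric] distrib_right)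
  then show ?thesis using jspanI[of "F \<union> G" ?c] F G by simp
qed

lemma jspan_scale:
  assumes "f \<in> jspan" shows "(\<lambda>x. r * f x) \<in> jspan"
proof -
  obtain F c where F: "finite F" "f = (\<lambda>x. \<Sum>k\<in>F. c k * tensor (basis_polys k) x)"
    using assms by (auto simp: jspan_def)
  then have "(\<lambda>x. r * f x) = (\<lambda>x. \<Sum>k\<in>F. (r * c k) * tensor (basis_polys k) x)"
    by (simp add: sum_distrib_left mult.assoc)
  then show ?thesis using jspanI[of F "\<lambda>k. r * c k"] F by simp
qed

lemma jspan_sum: "finite I \<Longrightarrow> (\<And>i. i \<in> I \<Longrightarrow> f i \<in> jspan) \<Longrightarrow> (\<lambda>x. \<Sum>i\<in>I. f i x) \<in> jspan"
proof (induction I rule: finite_induct)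
  case empty
  show ?case using jspan_scale[OF jspan_basis[of undefined], of 0] by simp
next
  case (insert i I)
  then show ?case using jspan_add[of "f i" "\<lambda>x. \<Sum>i\<in>I. f i x"] by simp
qed

text \<open>The normalized Jacobi polynomials of one variable span all polynomials, so the new
  factor is expanded and the rest kept. This covers multiplication by a coordinate, partial
  derivatives and antiderivatives in one variable.\<close>

lemma jspan_tensor_upd: "tensor ((basis_polys k)(i := q)) \<in> jspan"
proof -
  obtain c where c: "q = (\<Sum>j\<le>degree q. smult (c j) (Npoly (\<alpha> $ i) (\<beta> $ i) j))"
    using poly_Npoly_expansion[OF \<alpha> \<beta> order.refl] by blast
  have e: "basis_polys (upd k i j) = (basis_polys k)(i := Npoly (\<alpha> $ i) (\<beta> $ i) j)" for j
    by (auto simp: basis_polys_def fun_eq_iff)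
  have "tensor ((basis_polys k)(i := q)) = (\<lambda>x. \<Sum>j\<le>degree q. c j * tensor (basis_polys (upd k i j)) x)"
  proof
    fix x
    show "tensor ((basis_polys k)(i := q)) x = (\<Sum>j\<le>degree q. c j * tensor (basis_polys (upd k i j)) x)"
      unfolding e tensor_upd by (subst c) (simp add: poly_sum sum_distrib_right mult.assoc)
  qed
  also have "\<dots> \<in> jspan" by (intro jspan_sum jspan_scale jspan_basis) auto
  finally show ?thesis .
qed

lemma jspan_one: "(\<lambda>x. 1) \<in> jspan"
proof -
  have "\<exists>v. basis_polys 0 i = [:v:]" for i
    using degree_Npoly[OF \<alpha> \<beta>, of i i 0] unfolding basis_polys_def zero_index by (auto elim: degree_eq_zeroE)
  then obtain v where v: "\<And>i. basis_polys 0 i = [:v i:]" by metis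
  have "v i \<noteq> 0" for i
  proof
    assume "v i = 0"
    then have "Npoly (\<alpha> $ i) (\<beta> $ i) 0 = 0" using v[of i] by (simp add: basis_polys_def)
    then show False using Npoly_orthonormal[OF \<alpha> \<beta>, of i i 0 0] by simp
  qed
  then have "(\<lambda>x. 1) = (\<lambda>x. (1 / (\<Prod>i\<in>UNIV. v i)) * tensor (basis_polys 0) x)"
    by (simp add: tensor_def v prod_zero_iff)
  also have "\<dots> \<in> jspan" by (intro jspan_scale jspan_basis)
  finally show ?thesis .
qed

lemma jspan_coordinate_mult:
  assumes "f \<in> jspan" shows "(\<lambda>x. x $ i * f x) \<in> jspan"
proof -
  obtain F c where F: "finite F" "f = (\<lambda>x. \<Sum>k\<in>F. c k * tensor (basis_polys k) x)"
    using assms by (auto simp: jspan_def)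
  have "x $ i * tensor (basis_polys k) x = tensor ((basis_polys k)(i := [:0, 1:] * basis_polys k i)) x" for x k
    unfolding tensor_upd by (subst tensor_split[of _ _ i]) simp
  then have "(\<lambda>x. x $ i * f x)
     = (\<lambda>x. \<Sum>k\<in>F. c k * tensor ((basis_polys k)(i := [:0, 1:] * basis_polys k i)) x)"
    unfolding F by (simp add: sum_distrib_left algebra_simps)
  also have "\<dots> \<in> jspan" by (intro jspan_sum jspan_scale jspan_tensor_upd F)
  finally show ?thesis .
qed

text \<open>The statement about products is what the induction supports: closure of
  \<open>jspan\<close> under products is not at hand in the multiplication case, whereas multiplying
  by one polynomial after the other is. Membership follows with \<open>g = 1\<close>.\<close>

lemma polynomial_mult_jspan:
  "real_polynomial_function f \<Longrightarrow> g \<in> jspan \<Longrightarrow> (\<lambda>x. f x * g x) \<in> jspan"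
proof (induction f arbitrary: g rule: real_polynomial_function.induct)
  case (linear f)
  interpret bounded_linear f by fact
  have e: "f x = (\<Sum>i\<in>UNIV. f (axis i 1) * x $ i)" for x
  proof -
    have "f x = f (\<Sum>i\<in>UNIV. x $ i *\<^sub>R axis i 1)"
      using basis_expansion[of x] by (simp add: scalar_mult_eq_scaleR)
    then show ?thesis by (simp add: sum scaleR mult.commute)
  qed
  have "(\<lambda>x. f x * g x) = (\<lambda>x. \<Sum>i\<in>UNIV. f (axis i 1) * (x $ i * g x))"
    by (rule ext, subst e) (simp only: sum_distrib_right mult.assoc)
  also have "\<dots> \<in> jspan" by (intro jspan_sum jspan_scale jspan_coordinate_mult linear.prems) auto
  finally show ?case .
next
  case (const c)
  then show ?case by (rule jspan_scale)
next
  case (add f g h)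
  then show ?case using jspan_add[of "\<lambda>x. f x * h x" "\<lambda>x. g x * h x"] by (simp add: distrib_right)
next
  case (mult f g h)
  then show ?case using mult.IH(1)[OF mult.IH(2)[OF mult.prems]] by (simp add: mult.assoc)
qed

lemma polynomial_jspan: "real_polynomial_function f \<Longrightarrow> f \<in> jspan"
  using polynomial_mult_jspan[of f "\<lambda>x. 1", OF _ jspan_one] by simp

lemma jspan_polynomial:
  assumes "f \<in> jspan" shows "real_polynomial_function f"
proof -
  have c: "real_polynomial_function (\<lambda>x::real^'n. x $ i)" for i
    by (intro real_polynomial_function.intros(1) bounded_linear_vec_nth)
  have p: "real_polynomial_function (\<lambda>x::real^'n. poly q (x $ i))" for q i
  proof (induction q)
    case 0
    show ?case using real_polynomial_function.intros(2)[of 0] by simp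
  next
    case (pCons u q)
    have "real_polynomial_function (\<lambda>x::real^'n. u + x $ i * poly q (x $ i))"
      by (rule real_polynomial_function.intros(3)[OF real_polynomial_function.intros(2)
          real_polynomial_function.intros(4)[OF c pCons(2)]])
    then show ?case by simp
  qed
  have t: "real_polynomial_function (tensor A)" for A :: "'n \<Rightarrow> real poly"
    unfolding tensor_def[abs_def] by (rule real_polynomial_function_prod[OF _ p]) simp
  obtain F c where F: "finite F" "f = (\<lambda>x. \<Sum>k\<in>F. c k * tensor (basis_polys k) x)"
    using assms by (auto simp: jspan_def)
  show ?thesis unfolding F(2)
    by (rule real_polynomial_function_sum[OF F(1)])
      (rule real_polynomial_function.intros(4)[OF real_polynomial_function.intros(2) t])
qed

end

section \<open>Bellman function and Poisson extensions\<close>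

context jacobi
begin

section \<open>The flow argument for general functions Y and Z\<close>

abbreviation drift :: "'n \<Rightarrow> real ^ 'n \<Rightarrow> real" where
  "drift i x \<equiv> \<beta> $ i - \<alpha> $ i - (\<alpha> $ i + \<beta> $ i + 2) * x $ i"

text \<open>Dominated convergence: by the mean value theorem all difference quotients with |h| \<le>
  1 are bounded by the maximum of |D| over [t - 1, t + 1] times the closed cube.\<close>

lemma DERIV_integral_\<nu>:
  fixes G D :: "real \<Rightarrow> real ^ 'n \<Rightarrow> real"
  assumes G: "continuous_on UNIV (\<lambda>(t, x). G t x)" and D: "continuous_on UNIV (\<lambda>(t, x). D t x)"
    and DG: "\<And>t x. ((\<lambda>t. G t x) has_real_derivative D t x) (at t)"
  shows "((\<lambda>t. \<integral>x. G t x \<partial>\<nu>) has_real_derivative (\<integral>x. D t x \<partial>\<nu>)) (at t)"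
proof -
  have Gx: "continuous_on UNIV (G t)" and Dx: "continuous_on UNIV (D t)" for t
    using continuous_on_compose2[OF G continuous_on_Pair[OF continuous_on_const continuous_on_id, of UNIV t]]
      continuous_on_compose2[OF D continuous_on_Pair[OF continuous_on_const continuous_on_id, of UNIV t]]
    by auto
  have "compact ((\<lambda>(t, x). D t x) ` ({t - 1..t + 1} \<times> cbox (\<chi> i. -1) (\<chi> i. 1)))"
    by (intro compact_continuous_image continuous_on_subset[OF D] compact_Times) auto
  then obtain B where B: "\<And>s x. s \<in> {t - 1..t + 1} \<Longrightarrow> x \<in> cbox (\<chi> i. -1) (\<chi> i. 1) \<Longrightarrow> \<bar>D s x\<bar> \<le> B"
    unfolding compact_eq_bounded_closed bounded_iff by (fastforce simp: image_iff)
  have Bq: "\<bar>(G (t + h) x - G t x) / h\<bar> \<le> B" if h: "h \<noteq> 0" "\<bar>h\<bar> \<le> 1" and x: "x \<in> open_cube" for h x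
  proof -
    have xc: "x \<in> cbox (\<chi> i. -1) (\<chi> i. 1)"
      using x by (auto simp: open_cube_def mem_box_cart less_imp_le)
    obtain \<xi> where "\<xi> \<in> {t - 1..t + 1}" "G (t + h) x - G t x = h * D \<xi> x"
    proof (cases "h > 0")
      case True
      then obtain z where "t < z" "z < t + h" "G (t + h) x - G t x = (t + h - t) * D z x"
        using MVT2[of t "t + h" "\<lambda>t. G t x" "\<lambda>t. D t x"] DG by auto
      then show ?thesis using h True by (intro that[of z]) auto
    next
      case False
      then obtain z where "t + h < z" "z < t" "G t x - G (t + h) x = (t - (t + h)) * D z x"
        using MVT2[of "t + h" t "\<lambda>t. G t x" "\<lambda>t. D t x"] DG h by auto
      then show ?thesis using h False by (intro that[of z]) (auto simp: algebra_simps)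
    qed
    then show ?thesis using B[OF _ xc, of \<xi>] h by simp
  qed
  have "((\<lambda>h. ((\<integral>x. G (t + h) x \<partial>\<nu>) - (\<integral>x. G t x \<partial>\<nu>)) / h) \<longlongrightarrow> (\<integral>x. D t x \<partial>\<nu>)) (at 0)"
    unfolding tendsto_at_iff_sequentially
  proof (intro allI impI)
    fix X :: "nat \<Rightarrow> real" assume X0: "\<forall>i. X i \<in> UNIV - {0}" and X: "X \<longlonglongrightarrow> 0"
    obtain N where N: "\<And>n. n \<ge> N \<Longrightarrow> \<bar>X n\<bar> \<le> 1"
      using X by (metis LIMSEQ_iff diff_zero less_eq_real_def real_norm_def zero_less_one)
    have q: "((\<integral>x. G (t + h) x \<partial>\<nu>) - (\<integral>x. G t x \<partial>\<nu>)) / h = (\<integral>x. (G (t + h) x - G t x) / h \<partial>\<nu>)" for h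
      by (simp add: Bochner_Integration.integral_diff continuous_integrable_\<nu> Gx)
    have "(\<lambda>n. \<integral>x. (G (t + X (n + N)) x - G t x) / X (n + N) \<partial>\<nu>) \<longlonglongrightarrow> (\<integral>x. D t x \<partial>\<nu>)"
    proof (rule integral_dominated_convergence[where w = "\<lambda>_. B"])
      show "AE x in \<nu>. (\<lambda>n. (G (t + X (n + N)) x - G t x) / X (n + N)) \<longlonglongrightarrow> D t x"
      proof (rule AE_I2)
        fix x
        have "(\<lambda>h. (G (t + h) x - G t x) / h) \<midarrow>0\<rightarrow> D t x" using DG[of x t] by (simp add: DERIV_def)
        then have "((\<lambda>h. (G (t + h) x - G t x) / h) \<circ> X) \<longlonglongrightarrow> D t x"
          unfolding tendsto_at_iff_sequentially using X X0 by blast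
        then show "(\<lambda>n. (G (t + X (n + N)) x - G t x) / X (n + N)) \<longlonglongrightarrow> D t x"
          unfolding o_def by (rule LIMSEQ_ignore_initial_segment)
      qed
      show "AE x in \<nu>. norm ((G (t + X (n + N)) x - G t x) / X (n + N)) \<le> B" for n
        using X0 N[of "n + N"] by (intro AE_I2) (auto simp: space_\<nu> intro!: Bq[simplified])
      show "D t \<in> borel_measurable \<nu>" by (intro continuous_measurable_\<nu> Dx)
      show "(\<lambda>x. (G (t + X (n + N)) x - G t x) / X (n + N)) \<in> borel_measurable \<nu>" for n
        using X0 by (intro continuous_measurable_\<nu> continuous_intros Gx) auto
    qed auto
    then show "((\<lambda>h. ((\<integral>x. G (t + h) x \<partial>\<nu>) - (\<integral>x. G t x \<partial>\<nu>)) / h) \<circ> X) \<longlonglongrightarrow> (\<integral>x. D t x \<partial>\<nu>)"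
      unfolding o_def q by (rule LIMSEQ_offset)
  qed
  then show ?thesis unfolding DERIV_def .
qed

text \<open>The derivatives are carried along as data, since they are explicit in the application.
  Mixed second derivatives are absent because the operator \<partial>_t^2 - L has no mixed terms.
  All properties are required on the whole space, not only on the cube, so that no one-sided
  derivatives arise.\<close>

definition C2_data :: "(real \<Rightarrow> real ^ 'n \<Rightarrow> real) \<Rightarrow> (real \<Rightarrow> real ^ 'n \<Rightarrow> real) \<Rightarrow> (real \<Rightarrow> real ^ 'n \<Rightarrow> real) \<Rightarrow>
    ('n \<Rightarrow> real \<Rightarrow> real ^ 'n \<Rightarrow> real) \<Rightarrow> ('n \<Rightarrow> real \<Rightarrow> real ^ 'n \<Rightarrow> real) \<Rightarrow> bool" where
  "C2_data Y Yt Ytt Yx Yxx \<longleftrightarrow>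
     (continuous_on UNIV (\<lambda>(t, x). Y t x) \<and> continuous_on UNIV (\<lambda>(t, x). Yt t x) \<and>
      continuous_on UNIV (\<lambda>(t, x). Ytt t x) \<and> (\<forall>i. continuous_on UNIV (\<lambda>(t, x). Yx i t x)) \<and>
      (\<forall>i. continuous_on UNIV (\<lambda>(t, x). Yxx i t x))) \<and>
     (\<forall>t x. ((\<lambda>t. Y t x) has_real_derivative Yt t x) (at t)) \<and>
     (\<forall>t x. ((\<lambda>t. Yt t x) has_real_derivative Ytt t x) (at t)) \<and>
     (\<forall>i t x s. ((\<lambda>s. Y t (upd x i s)) has_real_derivative Yx i t (upd x i s)) (at s)) \<and>
     (\<forall>i t x s. ((\<lambda>s. Yx i t (upd x i s)) has_real_derivative Yxx i t (upd x i s)) (at s))"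

lemma C2_dataD:
  assumes "C2_data Y Yt Ytt Yx Yxx"
  shows "continuous_on UNIV (\<lambda>(t, x). Y t x)" "continuous_on UNIV (\<lambda>(t, x). Yt t x)"
    "continuous_on UNIV (\<lambda>(t, x). Ytt t x)" "continuous_on UNIV (\<lambda>(t, x). Yx i t x)"
    "continuous_on UNIV (\<lambda>(t, x). Yxx i t x)"
    "((\<lambda>t. Y t x) has_real_derivative Yt t x) (at t)" "((\<lambda>t. Yt t x) has_real_derivative Ytt t x) (at t)"
    "((\<lambda>s. Y t (upd x i s)) has_real_derivative Yx i t (upd x i s)) (at s)"
    "((\<lambda>s. Yx i t (upd x i s)) has_real_derivative Yxx i t (upd x i s)) (at s)"
  using assms unfolding C2_data_def by blast+

text \<open>
  For \<open>Y = |u|\<^sup>2 + e\<close> this holds with \<open>p = |\<partial>\<^sub>t u|\<^sup>2\<close> and \<open>a i = |\<delta>\<^sub>i u|\<^sup>2\<close>.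
\<close>

definition energy_bound :: "(real \<Rightarrow> real ^ 'n \<Rightarrow> real) \<Rightarrow> (real \<Rightarrow> real ^ 'n \<Rightarrow> real) \<Rightarrow> (real \<Rightarrow> real ^ 'n \<Rightarrow> real) \<Rightarrow>
    ('n \<Rightarrow> real \<Rightarrow> real ^ 'n \<Rightarrow> real) \<Rightarrow> ('n \<Rightarrow> real \<Rightarrow> real ^ 'n \<Rightarrow> real) \<Rightarrow> real \<Rightarrow> real ^ 'n \<Rightarrow>
    real \<Rightarrow> ('n \<Rightarrow> real) \<Rightarrow> bool" where
  "energy_bound Y Yt Ytt Yx Yxx t x p a \<longleftrightarrow>
     (Yt t x)\<^sup>2 \<le> 4 * Y t x * p \<and> p \<ge> 0 \<and> (\<forall>i. a i \<ge> 0) \<and>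
     (\<forall>i. (1 - (x $ i)\<^sup>2) * (Yx i t x)\<^sup>2 \<le> 4 * Y t x * a i) \<and>
     Ytt t x + (\<Sum>i\<in>UNIV. (1 - (x $ i)\<^sup>2) * Yxx i t x + drift i x * Yx i t x) \<ge> 2 * (p + (\<Sum>i\<in>UNIV. a i))"

text \<open>\<open>E\<close> is an antiderivative of t \<integral> J, which replaces integrals over
  a half-line by limits of \<open>E T\<close>. The bound \<open>K\<close> makes b bounded on [0,
  \<infinity>), which together with convexity forces b' \<le> 0; its size does not enter the
  conclusion.\<close>

lemma bellman_heat_flow_global:
  assumes m: "0 < m" "m \<le> 1"
    and SY: "C2_data Y Yt Ytt Yx Yxx" and SZ: "C2_data Z Zt Ztt Zx Zxx"
    and cJ: "continuous_on UNIV (\<lambda>(t, x). J t x)"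
    and pos: "\<And>t x. Y t x > 0" "\<And>t x. Z t x > 0"
    and bd: "\<And>t x. t \<ge> 0 \<Longrightarrow> x \<in> open_cube \<Longrightarrow> Y t x \<le> K" "\<And>t x. t \<ge> 0 \<Longrightarrow> x \<in> open_cube \<Longrightarrow> Z t x \<le> K"
    and grad: "\<And>t x. x \<in> open_cube \<Longrightarrow> \<exists>p q a b.
      energy_bound Y Yt Ytt Yx Yxx t x p a \<and> energy_bound Z Zt Ztt Zx Zxx t x q b \<and>
      (J t x)\<^sup>2 \<le> (p + (\<Sum>i\<in>UNIV. a i)) * (q + (\<Sum>i\<in>UNIV. b i))"
    and E: "\<And>t. (E has_real_derivative t * (\<integral>x. J t x \<partial>\<nu>)) (at t)"
    and T: "T \<ge> 0"
  shows "4 * m * (E T - E 0) \<le> (\<integral>x. bell m (Y 0 x) (Z 0 x) \<partial>\<nu>)"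
proof -
  note cont = C2_dataD(1-3)[OF SY] C2_dataD(1-3)[OF SZ] cJ C2_dataD(4,5)[OF SY] C2_dataD(4,5)[OF SZ]
  note D = C2_dataD(6,7)[OF SY] C2_dataD(6,7)[OF SZ] C2_dataD(8,9)[OF SY] C2_dataD(8,9)[OF SZ]
  define bY bZ bYY bYZ bZZ where "bY = (\<lambda>t x. bell_Y m (Y t x) (Z t x))" and "bZ = (\<lambda>t x. bell_Z m (Y t x) (Z t x))"
    and "bYY = (\<lambda>t x. bell_YY m (Y t x) (Z t x))" and "bYZ = (\<lambda>t x. bell_YZ m (Y t x) (Z t x))"
    and "bZZ = (\<lambda>t x. bell_ZZ m (Y t x) (Z t x))"
  note bdef = bY_def bZ_def bYY_def bYZ_def bZZ_def
  define G where "G = (\<lambda>t x. bell m (Y t x) (Z t x))"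
  define Gt where "Gt = (\<lambda>t x. bY t x * Yt t x + bZ t x * Zt t x)"
  define Gtt where "Gtt = (\<lambda>t x. bYY t x * (Yt t x)\<^sup>2 + 2 * bYZ t x * Yt t x * Zt t x + bZZ t x * (Zt t x)\<^sup>2
     + bY t x * Ytt t x + bZ t x * Ztt t x)"
  define G1 where "G1 = (\<lambda>i t x. bY t x * Yx i t x + bZ t x * Zx i t x)"
  define G2 where "G2 = (\<lambda>i t x. bYY t x * (Yx i t x)\<^sup>2 + 2 * bYZ t x * Yx i t x * Zx i t x + bZZ t x * (Zx i t x)\<^sup>2
     + bY t x * Yxx i t x + bZ t x * Zxx i t x)"
  have c': "continuous_on S (\<lambda>z. W (f z) (g z))"
    if "continuous_on UNIV (\<lambda>(t, x). W t x)" "continuous_on S f" "continuous_on S g"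
    for W :: "real \<Rightarrow> real ^ 'n \<Rightarrow> real" and S :: "'b::topological_space set" and f g
    using continuous_on_compose2[OF that(1) continuous_on_Pair[OF that(2,3)]] by simp
  note cc = cont[THEN c']
  have cb: "continuous_on S (\<lambda>z. G (f z) (g z))" "continuous_on S (\<lambda>z. bY (f z) (g z))"
    "continuous_on S (\<lambda>z. bZ (f z) (g z))" "continuous_on S (\<lambda>z. bYY (f z) (g z))"
    "continuous_on S (\<lambda>z. bYZ (f z) (g z))" "continuous_on S (\<lambda>z. bZZ (f z) (g z))"
    if "continuous_on S f" "continuous_on S g" for S :: "'b::topological_space set" and f g
    unfolding G_def bdef by (rule continuous_on_bell; (rule cc that pos)+)+
  have cG: "continuous_on S (\<lambda>z. Gt (f z) (g z))" "continuous_on S (\<lambda>z. Gtt (f z) (g z))"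
    "continuous_on S (\<lambda>z. G1 i (f z) (g z))" "continuous_on S (\<lambda>z. G2 i (f z) (g z))"
    if "continuous_on S f" "continuous_on S g" for S :: "'b::topological_space set" and f g i
    unfolding Gt_def Gtt_def G1_def G2_def by (intro continuous_intros cc cb that)+
  have cp: "continuous_on UNIV (\<lambda>(t, x). W t x)" if "continuous_on UNIV (\<lambda>z. W (fst z) (snd z))"
    for W :: "real \<Rightarrow> real ^ 'n \<Rightarrow> real"
    using that by (simp add: case_prod_beta')
  have DG: "((\<lambda>t. G t x) has_real_derivative Gt t x) (at t)" for t x
    unfolding G_def Gt_def bdef by (rule DERIV_bell[OF D(1) pos(1) D(3) pos(2) m(1)])
  have DGt: "((\<lambda>t. Gt t x) has_real_derivative Gtt t x) (at t)" for t x
    unfolding Gt_def Gtt_def bdef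
    by (rule DERIV_cong, (rule derivative_eq_intros D refl DERIV_bell_Y[OF D(1) pos(1) D(3) pos(2) m(1)]
        DERIV_bell_Z[OF D(1) pos(1) D(3) pos(2) m(1)])+) (simp add: algebra_simps power2_eq_square)
  have DG1: "((\<lambda>s. G t (upd x i s)) has_real_derivative G1 i t (upd x i s)) (at s)" for i t x s
    unfolding G_def G1_def bdef by (rule DERIV_bell[OF D(5) pos(1) D(7) pos(2) m(1)])
  have DG2: "((\<lambda>s. G1 i t (upd x i s)) has_real_derivative G2 i t (upd x i s)) (at s)" for i t x s
    unfolding G1_def G2_def bdef
    by (rule DERIV_cong, (rule derivative_eq_intros D refl DERIV_bell_Y[OF D(5) pos(1) D(7) pos(2) m(1)]
        DERIV_bell_Z[OF D(5) pos(1) D(7) pos(2) m(1)])+) (simp add: algebra_simps power2_eq_square)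
  define b where "b = (\<lambda>t. \<integral>x. G t x \<partial>\<nu>)"
  define b' where "b' = (\<lambda>t. \<integral>x. Gt t x \<partial>\<nu>)"
  define b'' where "b'' = (\<lambda>t. \<integral>x. Gtt t x \<partial>\<nu>)"
  have Db: "(b has_real_derivative b' t) (at t)" for t
    unfolding b_def b'_def by (intro DERIV_integral_\<nu> cp cb cG DG continuous_intros)
  have Db': "(b' has_real_derivative b'' t) (at t)" for t
    unfolding b'_def b''_def by (intro DERIV_integral_\<nu> cp cb cG DGt continuous_intros)
  have pointwise: "Gtt t x + (\<Sum>i\<in>UNIV. (1 - (x $ i)\<^sup>2) * G2 i t x + drift i x * G1 i t x) \<ge> 4 * m * \<bar>J t x\<bar>"
    if x: "x \<in> open_cube" for t x
  proof -
    obtain p q a b where g: "(Yt t x)\<^sup>2 \<le> 4 * Y t x * p" "(Zt t x)\<^sup>2 \<le> 4 * Z t x * q" "p \<ge> 0" "q \<ge> 0"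
      "\<And>i. a i \<ge> 0" "\<And>i. b i \<ge> 0"
      "\<And>i. (1 - (x $ i)\<^sup>2) * (Yx i t x)\<^sup>2 \<le> 4 * Y t x * a i"
      "\<And>i. (1 - (x $ i)\<^sup>2) * (Zx i t x)\<^sup>2 \<le> 4 * Z t x * b i"
      "Ytt t x + (\<Sum>i\<in>UNIV. (1 - (x $ i)\<^sup>2) * Yxx i t x + drift i x * Yx i t x) \<ge> 2 * (p + (\<Sum>i\<in>UNIV. a i))"
      "Ztt t x + (\<Sum>i\<in>UNIV. (1 - (x $ i)\<^sup>2) * Zxx i t x + drift i x * Zx i t x) \<ge> 2 * (q + (\<Sum>i\<in>UNIV. b i))"
      "(J t x)\<^sup>2 \<le> (p + (\<Sum>i\<in>UNIV. a i)) * (q + (\<Sum>i\<in>UNIV. b i))"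
      using grad[OF x, of t] unfolding energy_bound_def by blast
    \<comment> \<open>\<open>\<tau>\<close> depends on the point (t, x) but not on the direction, so
      the estimates for t and for each coordinate add up to one for the total energies
      \<open>A\<close> and \<open>B\<close>.\<close>
    define \<tau> where "\<tau> = bell_tau m (Z t x)"
    have \<tau>: "\<tau> > 0" using bell_tau_pos pos by (simp add: \<tau>_def)
    define A where "A = p + (\<Sum>i\<in>UNIV. a i)"
    define B where "B = q + (\<Sum>i\<in>UNIV. b i)"
    have AB: "A \<ge> 0" "B \<ge> 0" using g by (auto simp: A_def B_def intro!: add_nonneg_nonneg sum_nonneg)
    define Q where "Q = (\<lambda>P R. bYY t x * P\<^sup>2 + 2 * bYZ t x * P * R + bZZ t x * R\<^sup>2)"
    have Qt: "Q (Yt t x) (Zt t x) + 2 * bY t x * p + 2 * bZ t x * q \<ge> m * (\<tau> * p / 2 + 8 * q / \<tau>)"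
      unfolding Q_def bdef \<tau>_def by (rule bell_form_ge[OF pos m g(1,2)])
    have Qi: "(1 - (x $ i)\<^sup>2) * Q (Yx i t x) (Zx i t x) + 2 * bY t x * a i + 2 * bZ t x * b i
       \<ge> m * (\<tau> * a i / 2 + 8 * b i / \<tau>)" for i
    proof -
      define r where "r = sqrt (1 - (x $ i)\<^sup>2)"
      have "\<bar>x $ i\<bar> \<le> 1" using x by (simp add: open_cube_def abs_le_iff minus_le_iff less_imp_le)
      then have "(x $ i)\<^sup>2 \<le> 1" by (simp add: abs_square_le_1)
      then have r: "1 - (x $ i)\<^sup>2 = r\<^sup>2" by (simp add: r_def)
      have "Q (r * Yx i t x) (r * Zx i t x) + 2 * bY t x * a i + 2 * bZ t x * b i
         \<ge> m * (\<tau> * a i / 2 + 8 * b i / \<tau>)"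
        unfolding Q_def bdef \<tau>_def
        by (rule bell_form_ge[OF pos m]) (use g(7,8)[of i] in \<open>simp_all add: r power_mult_distrib\<close>)
      moreover have "Q (r * Yx i t x) (r * Zx i t x) = (1 - (x $ i)\<^sup>2) * Q (Yx i t x) (Zx i t x)"
        unfolding r Q_def by (simp add: algebra_simps power2_eq_square)
      ultimately show ?thesis by simp
    qed
    have sumQ: "(\<Sum>i\<in>UNIV. (1 - (x $ i)\<^sup>2) * Q (Yx i t x) (Zx i t x)) + 2 * bY t x * (\<Sum>i\<in>UNIV. a i) + 2 * bZ t x * (\<Sum>i\<in>UNIV. b i)
       \<ge> m * (\<tau> * (\<Sum>i\<in>UNIV. a i) / 2 + 8 * (\<Sum>i\<in>UNIV. b i) / \<tau>)"
    proof -
      have "(\<Sum>i\<in>UNIV. m * (\<tau> * a i / 2 + 8 * b i / \<tau>)) \<le>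
        (\<Sum>i\<in>UNIV. (1 - (x $ i)\<^sup>2) * Q (Yx i t x) (Zx i t x) + 2 * bY t x * a i + 2 * bZ t x * b i)"
        by (intro sum_mono Qi)
      then show ?thesis
        by (simp add: sum.distrib sum_distrib_left sum_divide_distrib distrib_left)
    qed
    define LY where "LY = Ytt t x + (\<Sum>i\<in>UNIV. (1 - (x $ i)\<^sup>2) * Yxx i t x + drift i x * Yx i t x)"
    define LZ where "LZ = Ztt t x + (\<Sum>i\<in>UNIV. (1 - (x $ i)\<^sup>2) * Zxx i t x + drift i x * Zx i t x)"
    have nn: "bY t x \<ge> 0" "bZ t x \<ge> 0" unfolding bdef by (intro bell_Y_nonneg bell_Z_nonneg pos m)+
    have L: "bY t x * LY \<ge> bY t x * (2 * A)" "bZ t x * LZ \<ge> bZ t x * (2 * B)"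
      using g nn by (auto simp: LY_def LZ_def A_def B_def intro!: mult_left_mono)
    have "Gtt t x + (\<Sum>i\<in>UNIV. (1 - (x $ i)\<^sup>2) * G2 i t x + drift i x * G1 i t x)
       = Q (Yt t x) (Zt t x) + (\<Sum>i\<in>UNIV. (1 - (x $ i)\<^sup>2) * Q (Yx i t x) (Zx i t x)) + bY t x * LY + bZ t x * LZ"
    proof -
      have "(\<Sum>i\<in>UNIV. (1 - (x $ i)\<^sup>2) * G2 i t x + drift i x * G1 i t x)
        = (\<Sum>i\<in>UNIV. (1 - (x $ i)\<^sup>2) * Q (Yx i t x) (Zx i t x)
           + bY t x * ((1 - (x $ i)\<^sup>2) * Yxx i t x + drift i x * Yx i t x)
           + bZ t x * ((1 - (x $ i)\<^sup>2) * Zxx i t x + drift i x * Zx i t x))"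
        unfolding G1_def G2_def Q_def by (intro sum.cong refl) (simp add: algebra_simps)
      also have "\<dots> = (\<Sum>i\<in>UNIV. (1 - (x $ i)\<^sup>2) * Q (Yx i t x) (Zx i t x))
           + bY t x * (\<Sum>i\<in>UNIV. (1 - (x $ i)\<^sup>2) * Yxx i t x + drift i x * Yx i t x)
           + bZ t x * (\<Sum>i\<in>UNIV. (1 - (x $ i)\<^sup>2) * Zxx i t x + drift i x * Zx i t x)"
        by (simp only: sum.distrib[symmetric] sum_distrib_left)
      finally show ?thesis unfolding LY_def LZ_def Gtt_def Q_def by (simp only: distrib_left)
    qed
    also have "\<dots> \<ge> m * (\<tau> * A / 2 + 8 * B / \<tau>)"
    proof -
      have "m * (\<tau> * A / 2 + 8 * B / \<tau>) = m * (\<tau> * p / 2 + 8 * q / \<tau>)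
         + m * (\<tau> * (\<Sum>i\<in>UNIV. a i) / 2 + 8 * (\<Sum>i\<in>UNIV. b i) / \<tau>)"
        unfolding A_def B_def by (simp add: distrib_left add_divide_distrib)
      moreover have "bY t x * (2 * A) = 2 * bY t x * p + 2 * bY t x * (\<Sum>i\<in>UNIV. a i)"
        "bZ t x * (2 * B) = 2 * bZ t x * q + 2 * bZ t x * (\<Sum>i\<in>UNIV. b i)"
        unfolding A_def B_def by (simp_all add: distrib_left)
      ultimately show ?thesis using Qt sumQ L by linarith
    qed
    \<comment> \<open>Arithmetic-geometric mean: 2 sqrt((\<tau> A / 2) (8 B / \<tau>)) = 4 sqrt(A
      B). The weights 1/2 and 8 in the Hessian estimate are chosen with product 4 to produce this
      factor 4.\<close>
    also have "m * (\<tau> * A / 2 + 8 * B / \<tau>) \<ge> m * (4 * \<bar>J t x\<bar>)"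
    proof (rule mult_left_mono)
      have "(4 * \<bar>J t x\<bar>)\<^sup>2 \<le> 16 * (A * B)" using g(11) by (simp add: power_mult_distrib A_def B_def)
      also have "\<dots> \<le> (\<tau> * A / 2 + 8 * B / \<tau>)\<^sup>2"
      proof -
        have "(\<tau> * A / 2 + 8 * B / \<tau>)\<^sup>2 = (\<tau> * A / 2 - 8 * B / \<tau>)\<^sup>2 + 16 * (A * B)"
          using \<tau> by (simp add: power2_eq_square field_simps)
        then show ?thesis by simp
      qed
      finally show "4 * \<bar>J t x\<bar> \<le> \<tau> * A / 2 + 8 * B / \<tau>"
        by (rule power2_le_imp_le) (use AB \<tau> in auto)
    qed (use m in auto)
    finally show ?thesis by (simp add: mult.assoc mult.left_commute)
  qed
  have b''_ge: "b'' t \<ge> 4 * m * \<bar>\<integral>x. J t x \<partial>\<nu>\<bar>" for t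
  proof -
    have J: "continuous_on UNIV (J t)" using cc(7)[of UNIV "\<lambda>_. t" "\<lambda>x. x"] by (auto intro!: continuous_intros)
    have ci: "continuous_on UNIV (Gtt t)" "continuous_on UNIV (G1 i t)" "continuous_on UNIV (G2 i t)" for i
      using cG[of UNIV "\<lambda>_. t" "\<lambda>x. x"] by (auto intro!: continuous_intros)
    \<comment> \<open>\<open>V\<close> is - L applied to B(u, v) at time t, a sum of
      divergences.\<close>
    define V where "V = (\<lambda>x. \<Sum>i\<in>UNIV. (1 - (x $ i)\<^sup>2) * G2 i t x + drift i x * G1 i t x)"
    have V: "(\<integral>x. V x \<partial>\<nu>) = 0" unfolding V_def
      by (subst Bochner_Integration.integral_sum)
        (auto intro!: continuous_integrable_\<nu> continuous_intros ci sum.neutral integral_divergence_\<nu> DG2)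
    have iV: "integrable \<nu> V" unfolding V_def by (intro continuous_integrable_\<nu> continuous_intros ci)
    have iG: "integrable \<nu> (Gtt t)" by (intro continuous_integrable_\<nu> ci)
    have "4 * m * \<bar>\<integral>x. J t x \<partial>\<nu>\<bar> \<le> 4 * m * (\<integral>x. \<bar>J t x\<bar> \<partial>\<nu>)"
      using m by (intro mult_left_mono integral_abs_bound) auto
    also have "\<dots> = (\<integral>x. 4 * m * \<bar>J t x\<bar> \<partial>\<nu>)" by simp
    also have "\<dots> \<le> (\<integral>x. Gtt t x + V x \<partial>\<nu>)"
    proof (rule integral_mono)
      show "integrable \<nu> (\<lambda>x. 4 * m * \<bar>J t x\<bar>)" by (intro continuous_integrable_\<nu> continuous_intros J)
      show "integrable \<nu> (\<lambda>x. Gtt t x + V x)" by (intro Bochner_Integration.integrable_add iG iV)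
    qed (unfold V_def space_\<nu>, rule pointwise)
    also have "\<dots> = b'' t" using V iV iG by (simp add: b''_def)
    finally show ?thesis .
  qed
  have b''_nn: "b'' t \<ge> 0" for t
    using b''_ge[of t] m by (smt (verit) mult_nonneg_nonneg abs_ge_zero)
  define Kb where "Kb = 3 * K powr ((1 + 1 / m) / 2) + 18 * K powr ((1 + m) / 2)"
  have b_bound: "0 \<le> b t" "b t \<le> Kb" if t: "t \<ge> 0" for t
  proof -
    have cGt: "integrable \<nu> (G t)"
      using cb(1)[of UNIV "\<lambda>_. t" "\<lambda>x. x"] by (auto intro!: continuous_integrable_\<nu> continuous_intros)
    show "0 \<le> b t" unfolding b_def G_def using bell_nonneg pos m by (intro integral_nonneg_AE AE_I2) auto
    have "b t \<le> (\<integral>x. Kb \<partial>\<nu>)" unfolding b_def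
    proof (rule integral_mono[OF cGt])
      fix x assume "x \<in> space \<nu>"
      then have x: "x \<in> open_cube" by (simp add: space_\<nu>)
      have "G t x \<le> 3 * Y t x powr ((1 + 1 / m) / 2) + 18 * Z t x powr ((1 + m) / 2)"
        unfolding G_def by (rule bell_le[OF pos m])
      also have "\<dots> \<le> Kb" unfolding Kb_def
        using bd[OF t x] pos[of t x] m by (intro add_mono mult_left_mono powr_mono2) (auto simp: less_imp_le)
      finally show "G t x \<le> Kb" .
    qed auto
    then show "b t \<le> Kb" by (simp add: nu.prob_space)
  qed
  have b'_mono: "b' s \<le> b' t" if "s \<le> t" for s t
    using DERIV_nonneg_imp_nondecreasing[OF that, of b'] Db' b''_nn by blast
  \<comment> \<open>A positive value of b' at T would persist by monotonicity and raise b by at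
    least \<open>Kb + 1\<close> over an interval of length \<open>s\<close>, against 0 \<le> b \<le>
    \<open>Kb\<close>.\<close>
  have b'_nonpos: "b' T \<le> 0"
  proof (rule ccontr)
    assume "\<not> ?thesis"
    then have p: "b' T > 0" by simp
    define s where "s = (Kb + 1) / b' T"
    have Kb: "Kb \<ge> 0" using b_bound[of 0] by simp
    have s: "s > 0" using p Kb by (simp add: s_def)
    obtain z where z: "T < z" "z < T + s" "b (T + s) - b T = (T + s - T) * b' z"
      using MVT2[of T "T + s" b b'] s Db by auto
    have "s * b' T \<le> s * b' z" using b'_mono[of T z] z s by (intro mult_left_mono) auto
    also have "\<dots> = b (T + s) - b T" using z by simp
    also have "\<dots> \<le> Kb" using b_bound[of "T + s"] b_bound[of T] T s by simp
    finally show False using p by (simp add: s_def)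
  qed
  define H where "H = (\<lambda>t. t * b' t - b t - 4 * m * E t)"
  have "H 0 \<le> H T"
  proof (rule DERIV_nonneg_imp_nondecreasing[OF T])
    fix t assume t: "0 \<le> t" "t \<le> T"
    have "(H has_real_derivative t * (b'' t - 4 * m * (\<integral>x. J t x \<partial>\<nu>))) (at t)"
      unfolding H_def by (rule DERIV_cong, (rule derivative_eq_intros Db Db' E refl)+) (simp add: algebra_simps)
    moreover have "t * (b'' t - 4 * m * (\<integral>x. J t x \<partial>\<nu>)) \<ge> 0"
    proof -
      have "4 * m * (\<integral>x. J t x \<partial>\<nu>) \<le> 4 * m * \<bar>\<integral>x. J t x \<partial>\<nu>\<bar>" using m by (intro mult_left_mono) auto
      then show ?thesis using b''_ge[of t] t by (intro mult_nonneg_nonneg) linarith+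
    qed
    ultimately show "\<exists>y. (H has_real_derivative y) (at t) \<and> 0 \<le> y" by blast
  qed
  moreover have "T * b' T \<le> 0" using b'_nonpos T by (simp add: mult_nonneg_nonpos)
  ultimately have "4 * m * E T - 4 * m * E 0 \<le> b 0" using b_bound[OF T] by (simp add: H_def)
  then show ?thesis by (simp add: b_def G_def right_diff_distrib)
qed

section \<open>A cutoff that keeps Y and Z positive off the cube\<close>

lemma DERIV_max_power:
  "((\<lambda>y::real. max 0 y ^ (n + 2)) has_real_derivative real (n + 2) * max 0 y ^ (n + 1)) (at y)"
proof (cases y "0::real" rule: linorder_cases)
  case less
  show ?thesis
    by (rule has_field_derivative_transform_within_open[OF _ open_lessThan[of 0], of "\<lambda>_. 0"]) (use less in auto)
next
  case greater
  show ?thesis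
    by (rule has_field_derivative_transform_within_open[OF _ open_greaterThan[of 0], of "\<lambda>y. y ^ (n + 2)"],
        rule DERIV_cong[OF DERIV_pow]) (use greater in auto)
next
  case equal
  have "((\<lambda>h::real. max 0 h ^ (n + 2) / h) \<longlongrightarrow> 0) (at 0)"
  proof (rule Lim_null_comparison)
    show "\<forall>\<^sub>F h in at 0. norm (max 0 h ^ (n + 2) / h) \<le> \<bar>h ^ (n + 1)\<bar>"
      by (intro always_eventually allI) (auto simp: max_def)
    show "((\<lambda>h::real. \<bar>h ^ (n + 1)\<bar>) \<longlongrightarrow> 0) (at 0)" by (auto intro!: tendsto_eq_intros)
  qed
  then show ?thesis unfolding equal DERIV_def by simp
qed

text \<open>
  On the cube \<open>Y, Z \<ge> e\<close>, but outside it they may vanish. Composing with a positive \<open>C\<^sup>2\<close> function that is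
  the identity on \<open>[e, \<infinity>)\<close> makes the calculus global without changing anything on the cube.
\<close>

definition cut0 :: "real \<Rightarrow> real \<Rightarrow> real" where "cut0 e z = z + max 0 (e - z) ^ 4 / e ^ 3"
definition cut1 :: "real \<Rightarrow> real \<Rightarrow> real" where "cut1 e z = 1 - 4 * max 0 (e - z) ^ 3 / e ^ 3"
definition cut2 :: "real \<Rightarrow> real \<Rightarrow> real" where "cut2 e z = 12 * max 0 (e - z) ^ 2 / e ^ 3"

lemma cut_id: "z \<ge> e \<Longrightarrow> cut0 e z = z" "z \<ge> e \<Longrightarrow> cut1 e z = 1" "z \<ge> e \<Longrightarrow> cut2 e z = 0"
  by (simp_all add: cut0_def cut1_def cut2_def)

text \<open>Below \<open>e\<close> the function equals e (1 - s + s^4) with s = (e - z) / e > 0, and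
  1 - s + s^4 is positive: for s < 1 because of 1 - s, for s \<ge> 1 because s^4 \<ge> s.\<close>

lemma cut0_pos: assumes "e > 0" shows "cut0 e z > 0"
proof (cases "z \<ge> e")
  case True
  then show ?thesis using assms by (simp add: cut_id)
next
  case False
  define s where "s = (e - z) / e"
  have s: "s > 0" using False assms by (simp add: s_def)
  have z: "e - z = e * s" using assms by (simp add: s_def)
  have "cut0 e z = e * (1 - s + s ^ 4)"
  proof -
    have "max 0 (e - z) = e * s" using False z by (simp add: max_def)
    then have "cut0 e z = z + (e * s) ^ 4 / e ^ 3" by (simp add: cut0_def)
    also have "(e * s) ^ 4 / e ^ 3 = e * s ^ 4" using assms by (simp add: power_mult_distrib power4_eq_xxxx power3_eq_cube)
    finally show ?thesis using z by (simp add: algebra_simps)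
  qed
  moreover have "1 - s + s ^ 4 > 0"
  proof (cases "s < 1")
    case True
    then show ?thesis using s by (smt (verit) zero_less_power)
  next
    case False
    then have "s ^ 1 \<le> s ^ 4" by (intro power_increasing) auto
    then show ?thesis by simp
  qed
  ultimately show ?thesis using assms by simp
qed

lemma DERIV_cut:
  assumes "(f has_real_derivative f') (at t)"
  shows "((\<lambda>t. cut0 e (f t)) has_real_derivative cut1 e (f t) * f') (at t)"
    and "((\<lambda>t. cut1 e (f t)) has_real_derivative cut2 e (f t) * f') (at t)"
proof -
  have d: "((\<lambda>t. e - f t) has_real_derivative - f') (at t)" using assms by (auto intro!: derivative_eq_intros)
  have m4: "((\<lambda>y::real. max 0 y ^ 4) has_real_derivative 4 * max 0 y ^ 3) (at y)"
    and m3: "((\<lambda>y::real. max 0 y ^ 3) has_real_derivative 3 * max 0 y ^ 2) (at y)" for y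
    using DERIV_max_power[of 2 y] DERIV_max_power[of 1 y] by (simp_all add: eval_nat_numeral)
  note D4 = DERIV_chain2[OF m4 d]
  note D3 = DERIV_chain2[OF m3 d]
  show "((\<lambda>t. cut0 e (f t)) has_real_derivative cut1 e (f t) * f') (at t)"
    unfolding cut0_def cut1_def
    by (rule DERIV_cong, rule DERIV_add[OF assms DERIV_cdivide[OF D4]]) (simp add: algebra_simps)
  show "((\<lambda>t. cut1 e (f t)) has_real_derivative cut2 e (f t) * f') (at t)"
    unfolding cut1_def cut2_def
    by (rule DERIV_cong, rule DERIV_diff[OF DERIV_const DERIV_cdivide[OF DERIV_cmult[OF D3]]])
      (simp add: algebra_simps)
qed

lemma continuous_on_cut [continuous_intros]:
  assumes "continuous_on S f"
  shows "continuous_on S (\<lambda>x. cut0 e (f x))" "continuous_on S (\<lambda>x. cut1 e (f x))" "continuous_on S (\<lambda>x. cut2 e (f x))"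
  unfolding cut0_def cut1_def cut2_def divide_inverse by (intro continuous_intros assms)+

lemma C2_data_cut:
  assumes "C2_data Y Yt Ytt Yx Yxx"
  shows "C2_data (\<lambda>t x. cut0 e (Y t x)) (\<lambda>t x. cut1 e (Y t x) * Yt t x)
     (\<lambda>t x. cut2 e (Y t x) * (Yt t x)\<^sup>2 + cut1 e (Y t x) * Ytt t x)
     (\<lambda>i t x. cut1 e (Y t x) * Yx i t x) (\<lambda>i t x. cut2 e (Y t x) * (Yx i t x)\<^sup>2 + cut1 e (Y t x) * Yxx i t x)"
  unfolding C2_data_def
proof (intro conjI allI)
  note D = C2_dataD(6-9)[OF assms]
  note cont = C2_dataD(1-5)[OF assms, unfolded case_prod_beta']
  show "continuous_on UNIV (\<lambda>(t, x). cut0 e (Y t x))" "continuous_on UNIV (\<lambda>(t, x). cut1 e (Y t x) * Yt t x)"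
    "continuous_on UNIV (\<lambda>(t, x). cut2 e (Y t x) * (Yt t x)\<^sup>2 + cut1 e (Y t x) * Ytt t x)"
    "continuous_on UNIV (\<lambda>(t, x). cut1 e (Y t x) * Yx i t x)"
    "continuous_on UNIV (\<lambda>(t, x). cut2 e (Y t x) * (Yx i t x)\<^sup>2 + cut1 e (Y t x) * Yxx i t x)" for i
    unfolding case_prod_beta' by (intro continuous_intros cont)+
  show "((\<lambda>t. cut0 e (Y t x)) has_real_derivative cut1 e (Y t x) * Yt t x) (at t)"
    "((\<lambda>t. cut1 e (Y t x) * Yt t x) has_real_derivative cut2 e (Y t x) * (Yt t x)\<^sup>2 + cut1 e (Y t x) * Ytt t x) (at t)"
    "((\<lambda>s. cut0 e (Y t (upd x i s))) has_real_derivative cut1 e (Y t (upd x i s)) * Yx i t (upd x i s)) (at s)"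
    "((\<lambda>s. cut1 e (Y t (upd x i s)) * Yx i t (upd x i s)) has_real_derivative
       cut2 e (Y t (upd x i s)) * (Yx i t (upd x i s))\<^sup>2 + cut1 e (Y t (upd x i s)) * Yxx i t (upd x i s)) (at s)" for t x i s
    by (rule DERIV_cong, (rule DERIV_mult DERIV_cut D)+, simp add: power2_eq_square algebra_simps)+
qed

text \<open>Off the cube the global version asks only for smoothness and positivity, which the
  cutoff provides. On the cube Y, Z \<ge> e, where \<open>cut1\<close> is 1 and \<open>cut2\<close>
  is 0, so values, derivatives and energy bounds are the original ones.\<close>

lemma bellman_heat_flow:
  assumes m: "0 < m" "m \<le> 1"
    and SY: "C2_data Y Yt Ytt Yx Yxx" and SZ: "C2_data Z Zt Ztt Zx Zxx"
    and cJ: "continuous_on UNIV (\<lambda>(t, x). J t x)"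
    and pos: "e > 0" "\<And>t x. x \<in> open_cube \<Longrightarrow> Y t x \<ge> e" "\<And>t x. x \<in> open_cube \<Longrightarrow> Z t x \<ge> e"
    and bd: "\<And>t x. t \<ge> 0 \<Longrightarrow> x \<in> open_cube \<Longrightarrow> Y t x \<le> K" "\<And>t x. t \<ge> 0 \<Longrightarrow> x \<in> open_cube \<Longrightarrow> Z t x \<le> K"
    and grad: "\<And>t x. x \<in> open_cube \<Longrightarrow> \<exists>p q a b.
      energy_bound Y Yt Ytt Yx Yxx t x p a \<and> energy_bound Z Zt Ztt Zx Zxx t x q b \<and>
      (J t x)\<^sup>2 \<le> (p + (\<Sum>i\<in>UNIV. a i)) * (q + (\<Sum>i\<in>UNIV. b i))"
    and E: "\<And>t. (E has_real_derivative t * (\<integral>x. J t x \<partial>\<nu>)) (at t)"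
    and T: "T \<ge> 0"
  shows "4 * m * (E T - E 0) \<le> (\<integral>x. bell m (Y 0 x) (Z 0 x) \<partial>\<nu>)"
proof -
  have "4 * m * (E T - E 0) \<le> (\<integral>x. bell m (cut0 e (Y 0 x)) (cut0 e (Z 0 x)) \<partial>\<nu>)"
  proof (rule bellman_heat_flow_global[OF m C2_data_cut[OF SY] C2_data_cut[OF SZ] cJ _ _ _ _ _ E T])
    show "cut0 e (Y t x) > 0" "cut0 e (Z t x) > 0" for t x using cut0_pos[OF pos(1)] by auto
    show "cut0 e (Y t x) \<le> K" "cut0 e (Z t x) \<le> K" if "t \<ge> 0" "x \<in> open_cube" for t x
      using bd[OF that] pos(2,3)[OF that(2)] by (auto simp: cut_id)
  qed (use grad in \<open>simp add: energy_bound_def cut_id pos\<close>)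
  also have "(\<integral>x. bell m (cut0 e (Y 0 x)) (cut0 e (Z 0 x)) \<partial>\<nu>) = (\<integral>x. bell m (Y 0 x) (Z 0 x) \<partial>\<nu>)"
    by (intro Bochner_Integration.integral_cong refl) (simp add: space_\<nu> cut_id pos)
  finally show ?thesis .
qed

section \<open>Poisson extensions of finite expansions\<close>

definition rt :: "nat ^ 'n \<Rightarrow> real" where
  "rt k = sqrt (jacobi_eigenvalue \<alpha> \<beta> k)"

lemma eigenvalue_nonneg: "jacobi_eigenvalue \<alpha> \<beta> k \<ge> 0"
  unfolding jacobi_eigenvalue_eq by (intro sum_nonneg eigen1_nonneg)

lemma rt_nonneg: "rt k \<ge> 0" and rt_square: "(rt k)\<^sup>2 = jacobi_eigenvalue \<alpha> \<beta> k"
  using eigenvalue_nonneg by (simp_all add: rt_def)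

lemma rt_pos: "k \<noteq> 0 \<Longrightarrow> rt k > 0"
  using eigenvalue_pos by (simp add: rt_def)

text \<open>\<open>exp (- t \<surd>L)\<close> on combinations of basis elements, and the semigroup it is intertwined with on their derivatives.\<close>

definition poisson :: "(nat ^ 'n) set \<Rightarrow> (nat ^ 'n \<Rightarrow> real) \<Rightarrow> (nat ^ 'n \<Rightarrow> 'n \<Rightarrow> real poly) \<Rightarrow> real \<Rightarrow> real ^ 'n \<Rightarrow> real" where
  "poisson F c A t x = (\<Sum>k\<in>F. c k * exp (- rt k * t) * tensor (A k) x)"

lemma DERIV_poisson_t: "((\<lambda>t. poisson F c A t x) has_real_derivative poisson F (\<lambda>k. - rt k * c k) A t x) (at t)"
  unfolding poisson_def
  by (rule DERIV_cong, (rule derivative_eq_intros refl)+) (auto intro!: sum.cong)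

lemma DERIV_poisson_x: "((\<lambda>s. poisson F c A t (upd x i s)) has_real_derivative poisson F c (\<lambda>k. pd i (A k)) t (upd x i s)) (at s)"
  unfolding poisson_def by (intro DERIV_sum DERIV_cmult DERIV_tensor)

lemma continuous_on_poisson [continuous_intros]:
  "continuous_on S f \<Longrightarrow> continuous_on S g \<Longrightarrow> continuous_on S (\<lambda>z. poisson F c A (f z) (g z))"
  unfolding poisson_def by (intro continuous_intros)

lemma poisson_bounded:
  assumes "finite F"
  shows "\<exists>K\<ge>0. \<forall>t\<ge>0. \<forall>x\<in>open_cube. \<bar>poisson F c A t x\<bar> \<le> K"
proof -
  have "\<exists>B. \<forall>x\<in>open_cube. \<bar>tensor (A k) x\<bar> \<le> B" for k
    using bounded_on_cube[of "tensor (A k)"] continuous_on_tensor[OF continuous_on_id] by metis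
  then obtain B where B: "\<And>k x. x \<in> open_cube \<Longrightarrow> \<bar>tensor (A k) x\<bar> \<le> B k" by metis
  show ?thesis
  proof (intro exI[of _ "\<bar>\<Sum>k\<in>F. \<bar>c k\<bar> * 1 * B k\<bar>"] conjI allI impI ballI)
    fix t :: real and x :: "real ^ 'n" assume t: "t \<ge> 0" and x: "x \<in> open_cube"
    have "\<bar>poisson F c A t x\<bar> \<le> (\<Sum>k\<in>F. \<bar>c k * exp (- rt k * t) * tensor (A k) x\<bar>)"
      unfolding poisson_def by (rule sum_abs)
    also have "\<dots> \<le> (\<Sum>k\<in>F. \<bar>c k\<bar> * 1 * B k)"
    proof (rule sum_mono)
      fix k
      have "exp (- rt k * t) \<le> 1" using rt_nonneg[of k] t by (simp add: mult_nonneg_nonneg)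
      then show "\<bar>c k * exp (- rt k * t) * tensor (A k) x\<bar> \<le> \<bar>c k\<bar> * 1 * B k"
        unfolding abs_mult using B[OF x, of k] by (intro mult_mono) auto
    qed
    finally show "\<bar>poisson F c A t x\<bar> \<le> \<bar>\<Sum>k\<in>F. \<bar>c k\<bar> * 1 * B k\<bar>" by linarith
  qed simp
qed

lemma basis_ode1:
  "(1 - (x $ i)\<^sup>2) * tensor (pd i (pd i (basis_polys k))) x + drift i x * tensor (pd i (basis_polys k)) x
     = - eigen1 i k * tensor (basis_polys k) x"
proof -
  let ?R = "\<Prod>j\<in>UNIV - {i}. poly (basis_polys k j) (x $ j)"
  have "tensor (pd i (pd i (basis_polys k))) x = poly (pderiv (pderiv (basis_polys k i))) (x $ i) * ?R"
    "tensor (pd i (basis_polys k)) x = poly (pderiv (basis_polys k i)) (x $ i) * ?R"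
    "tensor (basis_polys k) x = poly (basis_polys k i) (x $ i) * ?R"
    by (simp_all add: pd_def tensor_upd tensor_split[of "basis_polys k" x i])
  moreover have "(1 - (x $ i)\<^sup>2) * (poly (pderiv (pderiv (basis_polys k i))) (x $ i) * ?R)
      + drift i x * (poly (pderiv (basis_polys k i)) (x $ i) * ?R)
    = ((1 - (x $ i)\<^sup>2) * poly (pderiv (pderiv (basis_polys k i))) (x $ i) + drift i x * poly (pderiv (basis_polys k i)) (x $ i)) * ?R"
    by (simp add: algebra_simps)
  moreover have "(1 - (x $ i)\<^sup>2) * poly (pderiv (pderiv (basis_polys k i))) (x $ i) + drift i x * poly (pderiv (basis_polys k i)) (x $ i)
     = - eigen1 i k * poly (basis_polys k i) (x $ i)"
    unfolding basis_polys_def eigen1_def by (rule Npoly_ode[OF \<alpha> \<beta>])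
  ultimately show ?thesis by simp
qed

text \<open>Obtained by differentiating \<open>basis_ode1\<close> in the j-th variable. The
  coefficients of the i-th operator depend on the i-th coordinate alone, so a commutator term arises
  for i = j only.\<close>

lemma basis_ode2:
  "(1 - (x $ i)\<^sup>2) * tensor (pd i (pd i (pd j (basis_polys k)))) x + drift i x * tensor (pd i (pd j (basis_polys k))) x
     = - eigen1 i k * tensor (pd j (basis_polys k)) x
       + (if i = j then 2 * x $ j * tensor (pd j (pd j (basis_polys k))) x + (\<alpha> $ j + \<beta> $ j + 2) * tensor (pd j (basis_polys k)) x else 0)"
proof -
  have D1: "((\<lambda>s. (1 - (upd x j s $ i)\<^sup>2) * tensor (pd i (pd i (basis_polys k))) (upd x j s) + drift i (upd x j s) * tensor (pd i (basis_polys k)) (upd x j s))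
    has_real_derivative (if i = j then - 2 * s * tensor (pd i (pd i (basis_polys k))) (upd x j s)
        - (\<alpha> $ i + \<beta> $ i + 2) * tensor (pd i (basis_polys k)) (upd x j s) else 0)
     + (1 - (upd x j s $ i)\<^sup>2) * tensor (pd j (pd i (pd i (basis_polys k)))) (upd x j s)
     + drift i (upd x j s) * tensor (pd j (pd i (basis_polys k))) (upd x j s)) (at s)" for s
    by (cases "i = j"; simp; rule DERIV_cong, (rule derivative_eq_intros DERIV_tensor refl)+)
      (auto simp: algebra_simps)
  have D2: "((\<lambda>s. - eigen1 i k * tensor (basis_polys k) (upd x j s)) has_real_derivative
     - eigen1 i k * tensor (pd j (basis_polys k)) (upd x j s)) (at s)" for s
    by (intro DERIV_cmult DERIV_tensor)
  from DERIV_unique[OF D1[of "x $ j", unfolded basis_ode1] D2]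
  have "(if i = j then - 2 * x $ j * tensor (pd i (pd i (basis_polys k))) x
        - (\<alpha> $ i + \<beta> $ i + 2) * tensor (pd i (basis_polys k)) x else 0)
     + (1 - (x $ i)\<^sup>2) * tensor (pd j (pd i (pd i (basis_polys k)))) x
     + drift i x * tensor (pd j (pd i (basis_polys k))) x = - eigen1 i k * tensor (pd j (basis_polys k)) x"
    by (cases "i = j") (simp_all del: upd_nth)
  then show ?thesis by (simp add: pd_commute[of j i] split: if_splits)
qed

lemma poisson_harmonic:
  "poisson F (\<lambda>k. - rt k * (- rt k * c k)) basis_polys t x
    + (\<Sum>i\<in>UNIV. (1 - (x $ i)\<^sup>2) * poisson F c (\<lambda>k. pd i (pd i (basis_polys k))) t x
        + drift i x * poisson F c (\<lambda>k. pd i (basis_polys k)) t x) = 0"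
proof -
  have "(1 - (x $ i)\<^sup>2) * poisson F c (\<lambda>k. pd i (pd i (basis_polys k))) t x + drift i x * poisson F c (\<lambda>k. pd i (basis_polys k)) t x
     = (\<Sum>k\<in>F. c k * exp (- rt k * t) * (- eigen1 i k * tensor (basis_polys k) x))" for i
    unfolding poisson_def basis_ode1[symmetric] sum_distrib_left sum.distrib[symmetric]
    by (intro sum.cong refl) (simp add: algebra_simps)
  then have "(\<Sum>i\<in>UNIV. (1 - (x $ i)\<^sup>2) * poisson F c (\<lambda>k. pd i (pd i (basis_polys k))) t x
        + drift i x * poisson F c (\<lambda>k. pd i (basis_polys k)) t x)
     = (\<Sum>i\<in>UNIV. \<Sum>k\<in>F. c k * exp (- rt k * t) * (- eigen1 i k * tensor (basis_polys k) x))" by simp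
  also have "\<dots> = (\<Sum>k\<in>F. - (rt k)\<^sup>2 * (c k * exp (- rt k * t) * tensor (basis_polys k) x))"
    unfolding rt_square jacobi_eigenvalue_eq
    by (subst sum.swap) (intro sum.cong refl, simp add: sum_distrib_right sum_distrib_left sum_negf algebra_simps)
  finally show ?thesis by (simp add: poisson_def sum.distrib[symmetric] power2_eq_square algebra_simps)
qed

text \<open>The right side is the commutator of the plain derivative \<partial>_j with L. It has no
  sign yet; the sign appears once the factor sqrt(1 - x_j^2), which turns \<partial>_j into
  \<delta>_j, is taken into account.\<close>

lemma poisson_pd_harmonic:
  "poisson F (\<lambda>k. - rt k * (- rt k * c k)) (\<lambda>k. pd j (basis_polys k)) t x
    + (\<Sum>i\<in>UNIV. (1 - (x $ i)\<^sup>2) * poisson F c (\<lambda>k. pd i (pd i (pd j (basis_polys k)))) t x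
        + drift i x * poisson F c (\<lambda>k. pd i (pd j (basis_polys k))) t x)
   = 2 * x $ j * poisson F c (\<lambda>k. pd j (pd j (basis_polys k))) t x
     + (\<alpha> $ j + \<beta> $ j + 2) * poisson F c (\<lambda>k. pd j (basis_polys k)) t x"
proof -
  let ?S = "2 * x $ j * poisson F c (\<lambda>k. pd j (pd j (basis_polys k))) t x
     + (\<alpha> $ j + \<beta> $ j + 2) * poisson F c (\<lambda>k. pd j (basis_polys k)) t x"
  have "(1 - (x $ i)\<^sup>2) * poisson F c (\<lambda>k. pd i (pd i (pd j (basis_polys k)))) t x + drift i x * poisson F c (\<lambda>k. pd i (pd j (basis_polys k))) t x
     = (\<Sum>k\<in>F. c k * exp (- rt k * t) * (- eigen1 i k * tensor (pd j (basis_polys k)) x)) + (if i = j then ?S else 0)" for i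
  proof -
    have "(1 - (x $ i)\<^sup>2) * poisson F c (\<lambda>k. pd i (pd i (pd j (basis_polys k)))) t x + drift i x * poisson F c (\<lambda>k. pd i (pd j (basis_polys k))) t x
      = (\<Sum>k\<in>F. c k * exp (- rt k * t) * ((1 - (x $ i)\<^sup>2) * tensor (pd i (pd i (pd j (basis_polys k)))) x + drift i x * tensor (pd i (pd j (basis_polys k))) x))"
      unfolding poisson_def sum_distrib_left sum.distrib[symmetric]
      by (intro sum.cong refl) (simp add: algebra_simps)
    also have "\<dots> = (\<Sum>k\<in>F. c k * exp (- rt k * t) * (- eigen1 i k * tensor (pd j (basis_polys k)) x))
       + (\<Sum>k\<in>F. c k * exp (- rt k * t) * (if i = j then 2 * x $ j * tensor (pd j (pd j (basis_polys k))) x + (\<alpha> $ j + \<beta> $ j + 2) * tensor (pd j (basis_polys k)) x else 0))"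
      unfolding basis_ode2 sum.distrib[symmetric] by (simp only: distrib_left)
    also have "(\<Sum>k\<in>F. c k * exp (- rt k * t) * (if i = j then 2 * x $ j * tensor (pd j (pd j (basis_polys k))) x + (\<alpha> $ j + \<beta> $ j + 2) * tensor (pd j (basis_polys k)) x else 0))
       = (if i = j then ?S else 0)"
      unfolding poisson_def sum_distrib_left sum.distrib[symmetric] by (auto intro!: sum.cong simp: algebra_simps)
    finally show ?thesis .
  qed
  then have "(\<Sum>i\<in>UNIV. (1 - (x $ i)\<^sup>2) * poisson F c (\<lambda>k. pd i (pd i (pd j (basis_polys k)))) t x
        + drift i x * poisson F c (\<lambda>k. pd i (pd j (basis_polys k))) t x)
     = (\<Sum>i\<in>UNIV. \<Sum>k\<in>F. c k * exp (- rt k * t) * (- eigen1 i k * tensor (pd j (basis_polys k)) x)) + ?S"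
    by (simp only: sum.distrib sum.delta finite_UNIV UNIV_I if_True) simp
  also have "(\<Sum>i\<in>UNIV. \<Sum>k\<in>F. c k * exp (- rt k * t) * (- eigen1 i k * tensor (pd j (basis_polys k)) x))
     = (\<Sum>k\<in>F. - (rt k)\<^sup>2 * (c k * exp (- rt k * t) * tensor (pd j (basis_polys k)) x))"
    unfolding rt_square jacobi_eigenvalue_eq
    by (subst sum.swap) (intro sum.cong refl, simp add: sum_distrib_right sum_distrib_left sum_negf algebra_simps)
  finally have S: "(\<Sum>i\<in>UNIV. (1 - (x $ i)\<^sup>2) * poisson F c (\<lambda>k. pd i (pd i (pd j (basis_polys k)))) t x
        + drift i x * poisson F c (\<lambda>k. pd i (pd j (basis_polys k))) t x)
     = (\<Sum>k\<in>F. - (rt k)\<^sup>2 * (c k * exp (- rt k * t) * tensor (pd j (basis_polys k)) x)) + ?S" .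
  have "poisson F (\<lambda>k. - rt k * (- rt k * c k)) (\<lambda>k. pd j (basis_polys k)) t x
     + (\<Sum>k\<in>F. - (rt k)\<^sup>2 * (c k * exp (- rt k * t) * tensor (pd j (basis_polys k)) x)) = 0"
    by (simp add: poisson_def sum.distrib[symmetric] power2_eq_square algebra_simps)
  then show ?thesis unfolding S by simp
qed

text \<open>For f = \<Sum> c_k P_k and g_i = \<delta>_i \<Sum> d_ik P_k, orthogonality of the
  gradients makes \<open>S\<close> the pairing of R f with g, while \<open>Y0\<close> = f^2 + e and
  \<open>Z0\<close> = |g|^2 + e. Both orders of the arguments of \<open>bell\<close> are recorded,
  as the first one carries the larger exponent. The factor 4 of the flow estimate cancels against
  the integral 1 / (4 rt) of t rt exp(- 2 rt t) over [0, \<infinity>).\<close>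

lemma poisson_bilinear_estimate:
  fixes c :: "nat ^ 'n \<Rightarrow> real" and d :: "'n \<Rightarrow> nat ^ 'n \<Rightarrow> real"
  assumes F: "finite F" "0 \<notin> F" and m: "0 < m" "m \<le> 1" and e: "e > 0"
  defines "Y0 \<equiv> \<lambda>x. (\<Sum>k\<in>F. c k * tensor (basis_polys k) x)\<^sup>2 + e"
    and "Z0 \<equiv> \<lambda>x. (\<Sum>j\<in>UNIV. (1 - (x $ j)\<^sup>2) * (\<Sum>k\<in>F. d j k * tensor (pd j (basis_polys k)) x)\<^sup>2) + e"
    and "S \<equiv> \<Sum>i\<in>UNIV. \<Sum>k\<in>F. c k * d i k * eigen1 i k / rt k"
  shows "m * S \<le> (\<integral>x. bell m (Y0 x) (Z0 x) \<partial>\<nu>)" and "m * S \<le> (\<integral>x. bell m (Z0 x) (Y0 x) \<partial>\<nu>)"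
proof -
  \<comment> \<open>Time derivatives act on the coefficients, space derivatives on the factors; all
    the functions below are therefore instances of \<open>poisson\<close>.\<close>
  define dt where "dt = (\<lambda>(c :: nat ^ 'n \<Rightarrow> real) k. - rt k * c k)"
  define u where "u = poisson F c basis_polys"
  define ut where "ut = poisson F (dt c) basis_polys"
  define utt where "utt = poisson F (dt (dt c)) basis_polys"
  define u1 where "u1 = (\<lambda>i. poisson F c (\<lambda>k. pd i (basis_polys k)))"
  define u2 where "u2 = (\<lambda>i. poisson F c (\<lambda>k. pd i (pd i (basis_polys k))))"
  define w where "w = (\<lambda>j. poisson F (d j) (\<lambda>k. pd j (basis_polys k)))"
  define wt where "wt = (\<lambda>j. poisson F (dt (d j)) (\<lambda>k. pd j (basis_polys k)))"
  define wtt where "wtt = (\<lambda>j. poisson F (dt (dt (d j))) (\<lambda>k. pd j (basis_polys k)))"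
  define w1 where "w1 = (\<lambda>i j. poisson F (d j) (\<lambda>k. pd i (pd j (basis_polys k))))"
  define w2 where "w2 = (\<lambda>i j. poisson F (d j) (\<lambda>k. pd i (pd i (pd j (basis_polys k)))))"
  note defs = u_def ut_def utt_def u1_def u2_def w_def wt_def wtt_def w1_def w2_def
  have Du: "((\<lambda>t. u t x) has_real_derivative ut t x) (at t)" "((\<lambda>t. ut t x) has_real_derivative utt t x) (at t)"
    "((\<lambda>t. w j t x) has_real_derivative wt j t x) (at t)" "((\<lambda>t. wt j t x) has_real_derivative wtt j t x) (at t)" for t x j
    unfolding defs dt_def by (rule DERIV_poisson_t)+
  have Dx: "((\<lambda>s. u t (upd x i s)) has_real_derivative u1 i t (upd x i s)) (at s)"
    "((\<lambda>s. u1 i t (upd x i s)) has_real_derivative u2 i t (upd x i s)) (at s)"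
    "((\<lambda>s. w j t (upd x i s)) has_real_derivative w1 i j t (upd x i s)) (at s)"
    "((\<lambda>s. w1 i j t (upd x i s)) has_real_derivative w2 i j t (upd x i s)) (at s)" for t x i j s
    unfolding defs by (rule DERIV_poisson_x)+
  have cu: "continuous_on U (\<lambda>z. u (f z) (g z))" "continuous_on U (\<lambda>z. ut (f z) (g z))" "continuous_on U (\<lambda>z. utt (f z) (g z))"
     "continuous_on U (\<lambda>z. u1 i (f z) (g z))" "continuous_on U (\<lambda>z. u2 i (f z) (g z))"
     "continuous_on U (\<lambda>z. w j (f z) (g z))" "continuous_on U (\<lambda>z. wt j (f z) (g z))" "continuous_on U (\<lambda>z. wtt j (f z) (g z))"
     "continuous_on U (\<lambda>z. w1 i j (f z) (g z))" "continuous_on U (\<lambda>z. w2 i j (f z) (g z))"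
    if "continuous_on U f" "continuous_on U g" for U :: "'b::topological_space set" and f g i j
    unfolding defs by (intro continuous_intros that)+
  define Y where "Y = (\<lambda>t x. (u t x)\<^sup>2 + e)"
  define Yt where "Yt = (\<lambda>t x. 2 * u t x * ut t x)"
  define Ytt where "Ytt = (\<lambda>t x. 2 * (ut t x)\<^sup>2 + 2 * u t x * utt t x)"
  define Yx where "Yx = (\<lambda>i t x. 2 * u t x * u1 i t x)"
  define Yxx where "Yxx = (\<lambda>i t x. 2 * (u1 i t x)\<^sup>2 + 2 * u t x * u2 i t x)"
  \<comment> \<open>\<open>w j\<close> uses the plain derivative \<partial>_j instead of \<delta>_j;
    the missing factor sqrt(1 - x_j^2) enters \<open>Z\<close> only squared, so \<open>Z\<close>
    stays polynomial in x.\<close>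
  define Z where "Z = (\<lambda>t x. (\<Sum>j\<in>UNIV. (1 - (x $ j)\<^sup>2) * (w j t x)\<^sup>2) + e)"
  define Zt where "Zt = (\<lambda>t x. \<Sum>j\<in>UNIV. (1 - (x $ j)\<^sup>2) * (2 * w j t x * wt j t x))"
  define Ztt where "Ztt = (\<lambda>t x. \<Sum>j\<in>UNIV. (1 - (x $ j)\<^sup>2) * (2 * (wt j t x)\<^sup>2 + 2 * w j t x * wtt j t x))"
  define Zx where "Zx = (\<lambda>i t x. \<Sum>j\<in>UNIV. (if j = i then - 2 * x $ i * (w j t x)\<^sup>2 else 0)
     + (1 - (x $ j)\<^sup>2) * (2 * w j t x * w1 i j t x))"
  define Zxx where "Zxx = (\<lambda>i t x. \<Sum>j\<in>UNIV. (if j = i then - 2 * (w j t x)\<^sup>2 - 8 * x $ i * w j t x * w1 i j t x else 0)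
     + (1 - (x $ j)\<^sup>2) * (2 * (w1 i j t x)\<^sup>2 + 2 * w j t x * w2 i j t x))"
  define J where "J = (\<lambda>t x. - (\<Sum>i\<in>UNIV. (1 - (x $ i)\<^sup>2) * u1 i t x * wt i t x))"
  \<comment> \<open>Termwise, - (t / 2 + 1 / (4 rt)) exp(- 2 rt t) is an antiderivative of t rt
    exp(- 2 rt t). As 0 is not in \<open>F\<close>, every rt is positive: \<open>E\<close> tends to
    0 at infinity, and \<open>E 0 = - S / 4\<close>.\<close>
  define E where "E = (\<lambda>t. \<Sum>i\<in>UNIV. \<Sum>k\<in>F. - (c k * d i k * eigen1 i k) * ((t / 2 + 1 / (4 * rt k)) * exp (- 2 * rt k * t)))"
  have E0: "E 0 = - S / 4"
    unfolding E_def S_def by (simp add: sum_divide_distrib sum_negf field_simps)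
  have Elim: "(E \<longlongrightarrow> 0) at_top"
  proof -
    have "((\<lambda>t::real. (t / 2 + 1 / (4 * rt k)) * exp (- 2 * rt k * t)) \<longlongrightarrow> 0) at_top" if "k \<in> F" for k
    proof -
      have r: "rt k > 0" using rt_pos F that by metis
      have lim: "((\<lambda>t::real. t ^ n * exp (- 2 * rt k * t)) \<longlongrightarrow> 0) at_top" for n :: nat
      proof -
        have "((\<lambda>t::real. t ^ n / exp t) \<longlongrightarrow> 0) at_top" by (rule tendsto_power_div_exp_0)
        moreover have "filterlim (\<lambda>t. 2 * rt k * t) at_top at_top"
          using r by (intro filterlim_tendsto_pos_mult_at_top[OF tendsto_const] filterlim_ident) auto
        ultimately have "((\<lambda>t. (2 * rt k * t) ^ n / exp (2 * rt k * t)) \<longlongrightarrow> 0) at_top"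
          by (rule filterlim_compose)
        then have "((\<lambda>t. (1 / (2 * rt k) ^ n) * ((2 * rt k * t) ^ n / exp (2 * rt k * t))) \<longlongrightarrow> (1 / (2 * rt k) ^ n) * 0) at_top"
          by (intro tendsto_intros)
        then show ?thesis using r by (simp add: power_mult_distrib exp_minus field_simps)
      qed
      have "((\<lambda>t::real. 1 / 2 * (t ^ 1 * exp (- 2 * rt k * t)) + 1 / (4 * rt k) * (t ^ 0 * exp (- 2 * rt k * t))) \<longlongrightarrow> 1 / 2 * 0 + 1 / (4 * rt k) * 0) at_top"
        by (intro tendsto_add tendsto_mult tendsto_const lim)
      then show ?thesis by (simp add: algebra_simps)
    qed
    then have "(E \<longlongrightarrow> (\<Sum>i\<in>UNIV. \<Sum>k\<in>F. - (c k * d i k * eigen1 i k) * 0)) at_top"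
      unfolding E_def by (intro tendsto_sum tendsto_mult tendsto_const) auto
    then show ?thesis by simp
  qed
  have intJ: "(\<integral>x. J t x \<partial>\<nu>) = (\<Sum>i\<in>UNIV. \<Sum>k\<in>F. c k * d i k * eigen1 i k * rt k * exp (- 2 * rt k * t))" for t
  proof -
    have int: "integrable \<nu> (\<lambda>x. (1 - (x $ i)\<^sup>2) * tensor (pd i (basis_polys k)) x * tensor (pd i (basis_polys l)) x)" for i k l
      by (intro continuous_integrable_\<nu> continuous_intros)
    have "J t x = (\<Sum>i\<in>UNIV. \<Sum>k\<in>F. \<Sum>l\<in>F. c k * exp (- rt k * t) * (rt l * d i l * exp (- rt l * t)) *
       ((1 - (x $ i)\<^sup>2) * tensor (pd i (basis_polys k)) x * tensor (pd i (basis_polys l)) x))" for x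
    proof -
      have "- ((1 - (x $ i)\<^sup>2) * u1 i t x * wt i t x)
        = (\<Sum>k\<in>F. \<Sum>l\<in>F. c k * exp (- rt k * t) * (rt l * d i l * exp (- rt l * t)) *
       ((1 - (x $ i)\<^sup>2) * tensor (pd i (basis_polys k)) x * tensor (pd i (basis_polys l)) x))" for i
      proof -
        have "u1 i t x * wt i t x = (\<Sum>k\<in>F. \<Sum>l\<in>F. (c k * exp (- rt k * t) * tensor (pd i (basis_polys k)) x) *
            (- rt l * d i l * exp (- rt l * t) * tensor (pd i (basis_polys l)) x))"
          unfolding u1_def wt_def dt_def poisson_def by (rule sum_product)
        then have "- ((1 - (x $ i)\<^sup>2) * u1 i t x * wt i t x) = - (1 - (x $ i)\<^sup>2) * (\<Sum>k\<in>F. \<Sum>l\<in>F. (c k * exp (- rt k * t) * tensor (pd i (basis_polys k)) x) *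
            (- rt l * d i l * exp (- rt l * t) * tensor (pd i (basis_polys l)) x))"
          by (simp only: mult.assoc mult_minus_left)
        then show ?thesis unfolding sum_distrib_left
          by (rule trans) (intro sum.cong refl, simp add: algebra_simps)
      qed
      then show ?thesis unfolding J_def sum_negf[symmetric] by simp
    qed
    then have "(\<integral>x. J t x \<partial>\<nu>) = (\<Sum>i\<in>UNIV. \<Sum>k\<in>F. \<Sum>l\<in>F. c k * exp (- rt k * t) * (rt l * d i l * exp (- rt l * t)) *
       (if k = l then eigen1 i k else 0))"
      by (simp add: Bochner_Integration.integral_sum int basis_gradient_orthogonal del: mult_eq_0_iff)
    also have "\<dots> = (\<Sum>i\<in>UNIV. \<Sum>k\<in>F. \<Sum>l\<in>F. if k = l then c k * d i k * eigen1 i k * rt k * exp (- 2 * rt k * t) else 0)"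
      by (intro sum.cong refl) (auto simp: exp_add[symmetric] algebra_simps)
    also have "\<dots> = (\<Sum>i\<in>UNIV. \<Sum>k\<in>F. c k * d i k * eigen1 i k * rt k * exp (- 2 * rt k * t))"
      using F by (simp add: sum.delta')
    finally show ?thesis .
  qed
  have DE: "(E has_real_derivative t * (\<integral>x. J t x \<partial>\<nu>)) (at t)" for t
  proof -
    have "((\<lambda>t. - (c k * d i k * eigen1 i k) * ((t / 2 + 1 / (4 * rt k)) * exp (- 2 * rt k * t)))
      has_real_derivative t * (c k * d i k * eigen1 i k * rt k * exp (- 2 * rt k * t))) (at t)" if "k \<in> F" for i k
    proof -
      have r: "rt k > 0" using rt_pos F that by metis
      have d1: "((\<lambda>t. exp (- 2 * rt k * t)) has_real_derivative - 2 * rt k * exp (- 2 * rt k * t)) (at t)"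
        by (auto intro!: derivative_eq_intros)
      have d2: "((\<lambda>t. t / 2 + 1 / (4 * rt k)) has_real_derivative 1 / 2) (at t)"
        by (auto intro!: derivative_eq_intros)
      show ?thesis
        by (rule DERIV_cong[OF DERIV_cmult[OF DERIV_mult[OF d2 d1]]]) (use r in \<open>simp add: field_simps\<close>)
    qed
    then show ?thesis unfolding E_def intJ sum_distrib_left by (intro DERIV_sum)
  qed
  have cont: "continuous_on UNIV (\<lambda>(t, x). Y t x)" "continuous_on UNIV (\<lambda>(t, x). Yt t x)" "continuous_on UNIV (\<lambda>(t, x). Ytt t x)"
      "continuous_on UNIV (\<lambda>(t, x). Z t x)" "continuous_on UNIV (\<lambda>(t, x). Zt t x)" "continuous_on UNIV (\<lambda>(t, x). Ztt t x)"
      "continuous_on UNIV (\<lambda>(t, x). J t x)"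
      "\<And>i. continuous_on UNIV (\<lambda>(t, x). Yx i t x)" "\<And>i. continuous_on UNIV (\<lambda>(t, x). Yxx i t x)"
    unfolding Y_def Yt_def Ytt_def Z_def Zt_def Ztt_def J_def Yx_def Yxx_def case_prod_beta'
    by (intro continuous_intros cu)+
  have if_cont: "continuous_on UNIV (\<lambda>z. (if P then f z else 0) + h z)"
    if "continuous_on UNIV f" "continuous_on UNIV h" for P and f h :: "real \<times> (real ^ 'n) \<Rightarrow> real"
    using that by (cases P) (auto intro: continuous_intros)
  have contZ: "continuous_on UNIV (\<lambda>(t, x). Zx i t x)" "continuous_on UNIV (\<lambda>(t, x). Zxx i t x)" for i
    unfolding Zx_def Zxx_def case_prod_beta'
    by (rule continuous_on_sum, rule if_cont; intro continuous_intros cu)+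
  have D: "((\<lambda>t. Y t x) has_real_derivative Yt t x) (at t)" "((\<lambda>t. Yt t x) has_real_derivative Ytt t x) (at t)"
      "((\<lambda>t. Z t x) has_real_derivative Zt t x) (at t)" "((\<lambda>t. Zt t x) has_real_derivative Ztt t x) (at t)"
      "((\<lambda>s. Y t (upd x i s)) has_real_derivative Yx i t (upd x i s)) (at s)"
      "((\<lambda>s. Yx i t (upd x i s)) has_real_derivative Yxx i t (upd x i s)) (at s)" for i t x s
    unfolding Y_def Yt_def Ytt_def Z_def Zt_def Ztt_def Yx_def Yxx_def
    by (rule DERIV_cong, (rule derivative_eq_intros Du Dx refl)+, simp add: algebra_simps power2_eq_square sum.distrib sum_distrib_left)+
  have DZ1: "((\<lambda>s. Z t (upd x i s)) has_real_derivative Zx i t (upd x i s)) (at s)" for i t x s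
  proof -
    have "((\<lambda>s. (1 - (upd x i s $ j)\<^sup>2) * (w j t (upd x i s))\<^sup>2) has_real_derivative
      (if j = i then - 2 * upd x i s $ i * (w j t (upd x i s))\<^sup>2 else 0)
        + (1 - (upd x i s $ j)\<^sup>2) * (2 * w j t (upd x i s) * w1 i j t (upd x i s))) (at s)" for j
      by (cases "j = i"; simp; rule DERIV_cong, (rule derivative_eq_intros Dx refl)+) (simp_all add: algebra_simps)
    then have "((\<lambda>s. (\<Sum>j\<in>UNIV. (1 - (upd x i s $ j)\<^sup>2) * (w j t (upd x i s))\<^sup>2) + e) has_real_derivative Zx i t (upd x i s) + 0) (at s)"
      unfolding Zx_def by (intro DERIV_add DERIV_sum DERIV_const)
    then show ?thesis unfolding Z_def by simp
  qed
  have DZ2: "((\<lambda>s. Zx i t (upd x i s)) has_real_derivative Zxx i t (upd x i s)) (at s)" for i t x s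
    unfolding Zx_def Zxx_def
  proof (rule DERIV_sum)
    fix j
    show "((\<lambda>s. (if j = i then - 2 * upd x i s $ i * (w j t (upd x i s))\<^sup>2 else 0)
        + (1 - (upd x i s $ j)\<^sup>2) * (2 * w j t (upd x i s) * w1 i j t (upd x i s))) has_real_derivative
      (if j = i then - 2 * (w j t (upd x i s))\<^sup>2 - 8 * upd x i s $ i * w j t (upd x i s) * w1 i j t (upd x i s) else 0)
     + (1 - (upd x i s $ j)\<^sup>2) * (2 * (w1 i j t (upd x i s))\<^sup>2 + 2 * w j t (upd x i s) * w2 i j t (upd x i s))) (at s)"
      by (cases "j = i"; simp; rule DERIV_cong, (rule derivative_eq_intros Dx refl)+) (simp_all add: algebra_simps power2_eq_square)
  qed
  have harm: "utt t x + (\<Sum>i\<in>UNIV. (1 - (x $ i)\<^sup>2) * u2 i t x + drift i x * u1 i t x) = 0"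
    "wtt j t x + (\<Sum>i\<in>UNIV. (1 - (x $ i)\<^sup>2) * w2 i j t x + drift i x * w1 i j t x)
      = 2 * x $ j * w1 j j t x + (\<alpha> $ j + \<beta> $ j + 2) * w j t x" for t x j
    unfolding defs dt_def by (rule poisson_harmonic poisson_pd_harmonic)+
  \<comment> \<open>\<open>v j\<close> is the actual component of the field and \<open>g i j\<close>
    is \<delta>_i applied to it; for i = j the product rule contributes the term - x_j w_j.\<close>
  define v where "v = (\<lambda>j t x. sqrt (1 - (x $ j)\<^sup>2) * w j t x)"
  define g where "g = (\<lambda>i j t x. if j = i then (1 - (x $ j)\<^sup>2) * w1 i j t x - x $ j * w j t x
      else sqrt (1 - (x $ i)\<^sup>2) * sqrt (1 - (x $ j)\<^sup>2) * w1 i j t x)"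
  define p where "p = (\<lambda>t x. (ut t x)\<^sup>2)"
  define a where "a = (\<lambda>t x i. (1 - (x $ i)\<^sup>2) * (u1 i t x)\<^sup>2)"
  define q where "q = (\<lambda>t x. \<Sum>j\<in>UNIV. (1 - (x $ j)\<^sup>2) * (wt j t x)\<^sup>2)"
  define b where "b = (\<lambda>t x i. \<Sum>j\<in>UNIV. (g i j t x)\<^sup>2)"
  have cube: "1 - (x $ i)\<^sup>2 \<ge> 0" if "x \<in> open_cube" for x :: "real ^ 'n" and i
  proof -
    have "\<bar>x $ i\<bar> \<le> 1" using that by (simp add: open_cube_def abs_le_iff minus_le_iff less_imp_le)
    then show ?thesis by (simp add: abs_square_le_1)
  qed
  have CS: "(\<Sum>j\<in>UNIV. f j * h j)\<^sup>2 \<le> (\<Sum>j\<in>UNIV. (f j)\<^sup>2) * (\<Sum>j\<in>UNIV. (h j)\<^sup>2)" for f h :: "'n \<Rightarrow> real"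
    by (rule Cauchy_Schwarz_ineq_sum)
  have Yge: "Y t x \<ge> (u t x)\<^sup>2" "Y t x \<ge> e" for t x using e by (auto simp: Y_def)
  have Zge: "Z t x \<ge> (\<Sum>j\<in>UNIV. (v j t x)\<^sup>2)" "Z t x \<ge> e" if x: "x \<in> open_cube" for t x
  proof -
    have "(\<Sum>j\<in>UNIV. (v j t x)\<^sup>2) = (\<Sum>j\<in>UNIV. (1 - (x $ j)\<^sup>2) * (w j t x)\<^sup>2)"
      unfolding v_def using cube[OF x] by (simp add: power_mult_distrib)
    then show "Z t x \<ge> (\<Sum>j\<in>UNIV. (v j t x)\<^sup>2)" using e by (simp add: Z_def)
    have "(\<Sum>j\<in>UNIV. (1 - (x $ j)\<^sup>2) * (w j t x)\<^sup>2) \<ge> 0" using cube[OF x] by (intro sum_nonneg mult_nonneg_nonneg) auto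
    then show "Z t x \<ge> e" by (simp add: Z_def)
  qed
  have nn: "p t x \<ge> 0" "q t x \<ge> 0" "a t x i \<ge> 0" "b t x i \<ge> 0" if x: "x \<in> open_cube" for t x i
    unfolding p_def q_def a_def b_def using cube[OF x] by (auto intro!: sum_nonneg mult_nonneg_nonneg)
  have gY: "(Yt t x)\<^sup>2 \<le> 4 * Y t x * p t x" "(1 - (x $ i)\<^sup>2) * (Yx i t x)\<^sup>2 \<le> 4 * Y t x * a t x i"
    if x: "x \<in> open_cube" for t x i
  proof -
    have "(u t x)\<^sup>2 * p t x \<le> Y t x * p t x" by (intro mult_right_mono Yge nn x)
    then show "(Yt t x)\<^sup>2 \<le> 4 * Y t x * p t x" by (simp add: Yt_def p_def power_mult_distrib)
    have "(u t x)\<^sup>2 * a t x i \<le> Y t x * a t x i" by (intro mult_right_mono Yge nn x)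
    then show "(1 - (x $ i)\<^sup>2) * (Yx i t x)\<^sup>2 \<le> 4 * Y t x * a t x i"
      by (simp add: Yx_def a_def power_mult_distrib algebra_simps)
  qed
  have gZt: "(Zt t x)\<^sup>2 \<le> 4 * Z t x * q t x" if x: "x \<in> open_cube" for t x
  proof -
    have "Zt t x = 2 * (\<Sum>j\<in>UNIV. v j t x * (sqrt (1 - (x $ j)\<^sup>2) * wt j t x))"
      unfolding Zt_def v_def sum_distrib_left using cube[OF x]
      by (intro sum.cong refl) (simp add: algebra_simps flip: power2_eq_square)
    then have "(Zt t x)\<^sup>2 = 4 * (\<Sum>j\<in>UNIV. v j t x * (sqrt (1 - (x $ j)\<^sup>2) * wt j t x))\<^sup>2"
      by (simp add: power_mult_distrib)
    also have "\<dots> \<le> 4 * ((\<Sum>j\<in>UNIV. (v j t x)\<^sup>2) * (\<Sum>j\<in>UNIV. (sqrt (1 - (x $ j)\<^sup>2) * wt j t x)\<^sup>2))"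
      using CS by (intro mult_left_mono) auto
    also have "(\<Sum>j\<in>UNIV. (sqrt (1 - (x $ j)\<^sup>2) * wt j t x)\<^sup>2) = q t x"
      unfolding q_def using cube[OF x] by (simp add: power_mult_distrib)
    also have "4 * ((\<Sum>j\<in>UNIV. (v j t x)\<^sup>2) * q t x) \<le> 4 * (Z t x * q t x)"
      by (intro mult_left_mono mult_right_mono Zge nn x) auto
    finally show ?thesis by simp
  qed
  have gZi: "(1 - (x $ i)\<^sup>2) * (Zx i t x)\<^sup>2 \<le> 4 * Z t x * b t x i" if x: "x \<in> open_cube" for t x i
  proof -
    have "sqrt (1 - (x $ i)\<^sup>2) * Zx i t x = 2 * (\<Sum>j\<in>UNIV. v j t x * g i j t x)"
      unfolding Zx_def v_def g_def sum_distrib_left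
    proof (intro sum.cong refl)
      fix j :: 'n
      show "sqrt (1 - (x $ i)\<^sup>2) * ((if j = i then - 2 * x $ i * (w j t x)\<^sup>2 else 0) + (1 - (x $ j)\<^sup>2) * (2 * w j t x * w1 i j t x))
         = 2 * (sqrt (1 - (x $ j)\<^sup>2) * w j t x *
         (if j = i then (1 - (x $ j)\<^sup>2) * w1 i j t x - x $ j * w j t x
          else sqrt (1 - (x $ i)\<^sup>2) * sqrt (1 - (x $ j)\<^sup>2) * w1 i j t x))"
      proof (cases "j = i")
        case True
        then show ?thesis by (simp add: algebra_simps power2_eq_square)
      next
        case False
        have "1 - (x $ j)\<^sup>2 = sqrt (1 - (x $ j)\<^sup>2) * sqrt (1 - (x $ j)\<^sup>2)" using cube[OF x] by simp
        then show ?thesis using False by (simp only: if_False) (simp add: algebra_simps)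
      qed
    qed
    then have "(sqrt (1 - (x $ i)\<^sup>2) * Zx i t x)\<^sup>2 = 4 * (\<Sum>j\<in>UNIV. v j t x * g i j t x)\<^sup>2"
      by (simp add: power_mult_distrib)
    also have "\<dots> \<le> 4 * ((\<Sum>j\<in>UNIV. (v j t x)\<^sup>2) * b t x i)"
      unfolding b_def using CS by (intro mult_left_mono) auto
    also have "\<dots> \<le> 4 * (Z t x * b t x i)"
      by (intro mult_left_mono mult_right_mono Zge nn x) auto
    finally show ?thesis using cube[OF x] by (simp add: power_mult_distrib)
  qed
  have LY: "Ytt t x + (\<Sum>i\<in>UNIV. (1 - (x $ i)\<^sup>2) * Yxx i t x + drift i x * Yx i t x) \<ge> 2 * (p t x + (\<Sum>i\<in>UNIV. a t x i))" for t x
  proof -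
    have "(\<Sum>i\<in>UNIV. (1 - (x $ i)\<^sup>2) * Yxx i t x + drift i x * Yx i t x)
      = (\<Sum>i\<in>UNIV. 2 * a t x i + 2 * u t x * ((1 - (x $ i)\<^sup>2) * u2 i t x + drift i x * u1 i t x))"
      unfolding Yx_def Yxx_def a_def by (intro sum.cong refl) (simp add: algebra_simps)
    also have "\<dots> = 2 * (\<Sum>i\<in>UNIV. a t x i) + 2 * u t x * (\<Sum>i\<in>UNIV. (1 - (x $ i)\<^sup>2) * u2 i t x + drift i x * u1 i t x)"
      by (simp only: sum.distrib[of "\<lambda>i. 2 * a t x i"] sum_distrib_left[symmetric])
    also have "(\<Sum>i\<in>UNIV. (1 - (x $ i)\<^sup>2) * u2 i t x + drift i x * u1 i t x) = - utt t x"
      using harm(1)[of t x] by linarith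
    finally show ?thesis by (simp add: Ytt_def p_def)
  qed
  have LZ: "Ztt t x + (\<Sum>i\<in>UNIV. (1 - (x $ i)\<^sup>2) * Zxx i t x + drift i x * Zx i t x) \<ge> 2 * (q t x + (\<Sum>i\<in>UNIV. b t x i))"
    if x: "x \<in> open_cube" for t x
  proof -
    define zi where "zi = (\<lambda>i j. (1 - (x $ i)\<^sup>2) * ((if j = i then - 2 * (w j t x)\<^sup>2 - 8 * x $ i * w j t x * w1 i j t x else 0)
     + (1 - (x $ j)\<^sup>2) * (2 * (w1 i j t x)\<^sup>2 + 2 * w j t x * w2 i j t x))
      + drift i x * ((if j = i then - 2 * x $ i * (w j t x)\<^sup>2 else 0) + (1 - (x $ j)\<^sup>2) * (2 * w j t x * w1 i j t x)))"
    have "(1 - (x $ i)\<^sup>2) * Zxx i t x + drift i x * Zx i t x = (\<Sum>j\<in>UNIV. zi i j)" for i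
      unfolding Zx_def Zxx_def zi_def sum_distrib_left sum.distrib[symmetric] ..
    then have "Ztt t x + (\<Sum>i\<in>UNIV. (1 - (x $ i)\<^sup>2) * Zxx i t x + drift i x * Zx i t x)
      = (\<Sum>j\<in>UNIV. (1 - (x $ j)\<^sup>2) * (2 * (wt j t x)\<^sup>2 + 2 * w j t x * wtt j t x) + (\<Sum>i\<in>UNIV. zi i j))"
      unfolding Ztt_def by (simp add: sum.distrib) (rule sum.swap)
    also have "\<dots> \<ge> (\<Sum>j\<in>UNIV. 2 * ((1 - (x $ j)\<^sup>2) * (wt j t x)\<^sup>2) + (\<Sum>i\<in>UNIV. 2 * (g i j t x)\<^sup>2))"
    proof (rule sum_mono)
      fix j :: 'n
      let ?X = "1 - (x $ j)\<^sup>2" and ?w = "w j t x" and ?w' = "w1 j j t x"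
      have g2: "(g i j t x)\<^sup>2 = (1 - (x $ i)\<^sup>2) * ?X * (w1 i j t x)\<^sup>2
          + (if i = j then (?X * ?w' - x $ j * ?w)\<^sup>2 - ?X\<^sup>2 * ?w'\<^sup>2 else 0)" for i
        using cube[OF x, of i] cube[OF x, of j]
        by (cases "i = j") (simp_all add: g_def power_mult_distrib power2_eq_square[of ?X])
      have z2: "zi i j = 2 * ((1 - (x $ i)\<^sup>2) * ?X * (w1 i j t x)\<^sup>2) + 2 * ?X * ?w * ((1 - (x $ i)\<^sup>2) * w2 i j t x + drift i x * w1 i j t x)
          + (if i = j then ?X * (- 2 * ?w\<^sup>2 - 8 * x $ j * ?w * ?w') + drift j x * (- 2 * x $ j * ?w\<^sup>2) else 0)" for i
        unfolding zi_def by (auto simp: algebra_simps)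
      have "(\<Sum>i\<in>UNIV. zi i j) - (\<Sum>i\<in>UNIV. 2 * (g i j t x)\<^sup>2)
        = 2 * ?X * ?w * (\<Sum>i\<in>UNIV. (1 - (x $ i)\<^sup>2) * w2 i j t x + drift i x * w1 i j t x)
          + (?X * (- 2 * ?w\<^sup>2 - 8 * x $ j * ?w * ?w') + drift j x * (- 2 * x $ j * ?w\<^sup>2)
             - 2 * ((?X * ?w' - x $ j * ?w)\<^sup>2 - ?X\<^sup>2 * ?w'\<^sup>2))"
      proof -
        have "zi i j - 2 * (g i j t x)\<^sup>2 = 2 * ?X * ?w * ((1 - (x $ i)\<^sup>2) * w2 i j t x + drift i x * w1 i j t x)
          + (if i = j then ?X * (- 2 * ?w\<^sup>2 - 8 * x $ j * ?w * ?w') + drift j x * (- 2 * x $ j * ?w\<^sup>2)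
             - 2 * ((?X * ?w' - x $ j * ?w)\<^sup>2 - ?X\<^sup>2 * ?w'\<^sup>2) else 0)" for i
          unfolding g2 z2 by (simp add: algebra_simps)
        then have "(\<Sum>i\<in>UNIV. zi i j - 2 * (g i j t x)\<^sup>2) = (\<Sum>i\<in>UNIV. 2 * ?X * ?w * ((1 - (x $ i)\<^sup>2) * w2 i j t x + drift i x * w1 i j t x))
          + (\<Sum>i\<in>UNIV. if i = j then ?X * (- 2 * ?w\<^sup>2 - 8 * x $ j * ?w * ?w') + drift j x * (- 2 * x $ j * ?w\<^sup>2)
             - 2 * ((?X * ?w' - x $ j * ?w)\<^sup>2 - ?X\<^sup>2 * ?w'\<^sup>2) else 0)"
          by (simp only: sum.distrib)
        then show ?thesis by (simp only: sum_subtractf sum_distrib_left[symmetric] sum.delta finite_UNIV UNIV_I if_True) simp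
      qed
      also have "(\<Sum>i\<in>UNIV. (1 - (x $ i)\<^sup>2) * w2 i j t x + drift i x * w1 i j t x)
          = 2 * x $ j * ?w' + (\<alpha> $ j + \<beta> $ j + 2) * ?w - wtt j t x"
        using harm(2)[of j t x] by linarith
      \<comment> \<open>What remains beyond the squares of \<open>g\<close> is 2 v_j
        [\<delta>_j, \<delta>_j^*] v_j: the commutator is multiplication by (\<alpha>_j + 1/2) / (1
        - x_j) + (\<beta>_j + 1/2) / (1 + x_j), and v_j^2 = (1 - x_j^2) w_j^2 clears the
        denominators.\<close>
      finally have "(\<Sum>i\<in>UNIV. zi i j) + 2 * ?X * ?w * wtt j t x - (\<Sum>i\<in>UNIV. 2 * (g i j t x)\<^sup>2)
        = 2 * ?w\<^sup>2 * ((\<alpha> $ j + 1 / 2) * (1 + x $ j) + (\<beta> $ j + 1 / 2) * (1 - x $ j))"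
        by (simp add: algebra_simps power2_eq_square add_divide_distrib diff_divide_distrib)
      also have "\<dots> \<ge> 0"
      proof -
        have "\<alpha> $ j + 1 / 2 \<ge> 0" "\<beta> $ j + 1 / 2 \<ge> 0" using \<alpha>[of j] \<beta>[of j] by auto
        moreover have "- 1 < x $ j" "x $ j < 1" using x by (auto simp: open_cube_def)
        then have "1 + x $ j \<ge> 0" "1 - x $ j \<ge> 0" by auto
        ultimately have "(\<alpha> $ j + 1 / 2) * (1 + x $ j) + (\<beta> $ j + 1 / 2) * (1 - x $ j) \<ge> 0"
          by (meson add_nonneg_nonneg mult_nonneg_nonneg)
        then show ?thesis by (meson mult_nonneg_nonneg zero_le_numeral zero_le_power2)
      qed
      finally show "2 * (?X * (wt j t x)\<^sup>2) + (\<Sum>i\<in>UNIV. 2 * (g i j t x)\<^sup>2)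
         \<le> ?X * (2 * (wt j t x)\<^sup>2 + 2 * ?w * wtt j t x) + (\<Sum>i\<in>UNIV. zi i j)"
        by (simp add: algebra_simps)
    qed
    also have "(\<Sum>j\<in>UNIV. 2 * ((1 - (x $ j)\<^sup>2) * (wt j t x)\<^sup>2) + (\<Sum>i\<in>UNIV. 2 * (g i j t x)\<^sup>2))
      = 2 * (q t x + (\<Sum>i\<in>UNIV. b t x i))"
      unfolding q_def b_def by (simp add: sum.distrib sum_distrib_left distrib_left) (rule sum.swap)
    finally show ?thesis by simp
  qed
  have JJ: "(J t x)\<^sup>2 \<le> (p t x + (\<Sum>i\<in>UNIV. a t x i)) * (q t x + (\<Sum>i\<in>UNIV. b t x i))" if x: "x \<in> open_cube" for t x
  proof -
    have "J t x = - (\<Sum>i\<in>UNIV. (sqrt (1 - (x $ i)\<^sup>2) * u1 i t x) * (sqrt (1 - (x $ i)\<^sup>2) * wt i t x))"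
      unfolding J_def using cube[OF x] by (simp add: algebra_simps flip: power2_eq_square)
    then have "(J t x)\<^sup>2 \<le> (\<Sum>i\<in>UNIV. (sqrt (1 - (x $ i)\<^sup>2) * u1 i t x)\<^sup>2) * (\<Sum>i\<in>UNIV. (sqrt (1 - (x $ i)\<^sup>2) * wt i t x)\<^sup>2)"
      using CS by simp
    also have "\<dots> = (\<Sum>i\<in>UNIV. a t x i) * q t x"
      unfolding a_def q_def using cube[OF x] by (simp add: power_mult_distrib)
    also have "\<dots> \<le> (p t x + (\<Sum>i\<in>UNIV. a t x i)) * (q t x + (\<Sum>i\<in>UNIV. b t x i))"
      using nn[OF x] by (intro mult_mono) (auto intro!: sum_nonneg add_nonneg_nonneg)
    finally show ?thesis .
  qed
  obtain K where K: "\<And>t x. t \<ge> 0 \<Longrightarrow> x \<in> open_cube \<Longrightarrow> Y t x \<le> K" "\<And>t x. t \<ge> 0 \<Longrightarrow> x \<in> open_cube \<Longrightarrow> Z t x \<le> K"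
  proof -
    obtain Ku where Ku: "Ku \<ge> 0" "\<And>t x. t \<ge> 0 \<Longrightarrow> x \<in> open_cube \<Longrightarrow> \<bar>u t x\<bar> \<le> Ku"
      using poisson_bounded[OF F(1), of c basis_polys] unfolding u_def by blast
    have "\<forall>j. \<exists>K\<ge>0. \<forall>t\<ge>0. \<forall>x\<in>open_cube. \<bar>w j t x\<bar> \<le> K"
      using poisson_bounded[OF F(1)] unfolding w_def by blast
    then obtain Kw where Kw: "\<And>j. Kw j \<ge> 0" "\<And>j t x. t \<ge> 0 \<Longrightarrow> x \<in> open_cube \<Longrightarrow> \<bar>w j t x\<bar> \<le> Kw j" by metis
    have 1: "Y t x \<le> Ku\<^sup>2 + e" if "t \<ge> 0" "x \<in> open_cube" for t x
      unfolding Y_def using Ku(2)[OF that] by (simp add: abs_le_square_iff[symmetric] Ku(1))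
    have 2: "Z t x \<le> (\<Sum>j\<in>UNIV. (Kw j)\<^sup>2) + e" if t: "t \<ge> 0" and x: "x \<in> open_cube" for t x
    proof -
      have "(1 - (x $ j)\<^sup>2) * (w j t x)\<^sup>2 \<le> 1 * (Kw j)\<^sup>2" for j
        using Kw(1)[of j] Kw(2)[OF t x, of j] cube[OF x, of j]
        by (intro mult_mono) (auto simp: abs_le_square_iff[symmetric])
      then show ?thesis unfolding Z_def by (auto intro!: sum_mono)
    qed
    show ?thesis by (rule that[of "max (Ku\<^sup>2 + e) ((\<Sum>j\<in>UNIV. (Kw j)\<^sup>2) + e)"]) (use 1 2 in \<open>auto intro: order.trans[OF _ max.cobounded1] order.trans[OF _ max.cobounded2]\<close>)
  qed
  have SY: "C2_data Y Yt Ytt Yx Yxx" unfolding C2_data_def by (intro conjI allI cont D)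
  have SZ: "C2_data Z Zt Ztt Zx Zxx" unfolding C2_data_def by (intro conjI allI cont contZ D DZ1 DZ2)
  have enY: "energy_bound Y Yt Ytt Yx Yxx t x (p t x) (a t x)"
    and enZ: "energy_bound Z Zt Ztt Zx Zxx t x (q t x) (b t x)" if "x \<in> open_cube" for t x
    unfolding energy_bound_def using that gY gZt gZi nn LY LZ by auto
  have flow: "4 * m * (E T - E 0) \<le> (\<integral>x. bell m (Y 0 x) (Z 0 x) \<partial>\<nu>)" if "T \<ge> 0" for T
  proof (rule bellman_heat_flow[OF m SY SZ cont(7) e Yge(2) Zge(2) K _ DE that])
    fix t and x :: "real ^ 'n" assume x: "x \<in> open_cube"
    show "\<exists>p q a b. energy_bound Y Yt Ytt Yx Yxx t x p a \<and> energy_bound Z Zt Ztt Zx Zxx t x q b \<and>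
      (J t x)\<^sup>2 \<le> (p + (\<Sum>i\<in>UNIV. a i)) * (q + (\<Sum>i\<in>UNIV. b i))"
      using enY[OF x] enZ[OF x] JJ[OF x] by blast
  qed assumption+
  have flow': "4 * m * (E T - E 0) \<le> (\<integral>x. bell m (Z 0 x) (Y 0 x) \<partial>\<nu>)" if "T \<ge> 0" for T
  proof (rule bellman_heat_flow[OF m SZ SY cont(7) e Zge(2) Yge(2) K(2,1) _ DE that])
    fix t and x :: "real ^ 'n" assume x: "x \<in> open_cube"
    show "\<exists>p q a b. energy_bound Z Zt Ztt Zx Zxx t x p a \<and> energy_bound Y Yt Ytt Yx Yxx t x q b \<and>
      (J t x)\<^sup>2 \<le> (p + (\<Sum>i\<in>UNIV. a i)) * (q + (\<Sum>i\<in>UNIV. b i))"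
      using enY[OF x] enZ[OF x] JJ[OF x] by (metis mult.commute)
  qed assumption+
  have lim: "m * S \<le> I" if "\<And>T. T \<ge> 0 \<Longrightarrow> 4 * m * (E T - E 0) \<le> I" for I
  proof -
    have "((\<lambda>T. 4 * m * (E T - E 0)) \<longlongrightarrow> 4 * m * (0 - E 0)) at_top" by (intro tendsto_intros Elim)
    moreover have "\<forall>\<^sub>F T in at_top. 4 * m * (E T - E 0) \<le> I"
      using that by (auto intro: eventually_mono[OF eventually_ge_at_top[of 0]])
    ultimately have "4 * m * (0 - E 0) \<le> I" by (intro tendsto_upperbound) auto
    then show ?thesis by (simp add: E0)
  qed
  have "Y 0 = Y0" "Z 0 = Z0"
    by (simp_all add: Y_def Y0_def Z_def Z0_def u_def w_def poisson_def fun_eq_iff)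
  then show "m * S \<le> (\<integral>x. bell m (Y0 x) (Z0 x) \<partial>\<nu>)" "m * S \<le> (\<integral>x. bell m (Z0 x) (Y0 x) \<partial>\<nu>)"
    using lim[OF flow] lim[OF flow'] by simp_all
qed

end

section \<open>The spaces $L^p$\<close>

lemma powr_convex_nonneg:
  fixes a b l p :: real
  assumes "a \<ge> 0" "b \<ge> 0" "0 < l" "l < 1" "p \<ge> 1"
  shows "(l * a + (1 - l) * b) powr p \<le> l * a powr p + (1 - l) * b powr p"
proof -
  have le: "t powr p \<le> t" if "0 < t" "t < 1" for t :: real
    using powr_mono'[of 1 p t] assms that by simp
  consider "a = 0" | "b = 0" | "a > 0" "b > 0" using assms by linarith
  then show ?thesis
  proof cases
    case 1
    have "((1 - l) * b) powr p = (1 - l) powr p * b powr p" using assms by (simp add: powr_mult)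
    also have "\<dots> \<le> (1 - l) * b powr p" using le[of "1 - l"] assms by (intro mult_right_mono) auto
    finally show ?thesis using 1 by simp
  next
    case 2
    have "(l * a) powr p = l powr p * a powr p" using assms by (simp add: powr_mult)
    also have "\<dots> \<le> l * a powr p" using le[of l] assms by (intro mult_right_mono) auto
    finally show ?thesis using 2 by simp
  next
    case 3
    from convex_onD[OF powr_convex[OF \<open>p \<ge> 1\<close>], of "1 - l" a b] show ?thesis using assms 3 by simp
  qed
qed

lemma Lp_norm_nonneg: "Lp_norm M p f \<ge> 0"
  by (simp add: Lp_norm_def)

lemma Lp_norm_powr:
  "p > 0 \<Longrightarrow> Lp_norm M p f powr p = (\<integral>x. norm (f x) powr p \<partial>M)"
  by (simp add: Lp_norm_def powr_powr integral_nonneg_AE)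

lemma Lp_norm_leI:
  assumes "p > 0" "C \<ge> 0" "(\<integral>x. norm (f x) powr p \<partial>M) \<le> C powr p"
  shows "Lp_norm M p f \<le> C"
proof -
  have "Lp_norm M p f \<le> (C powr p) powr (1 / p)"
    unfolding Lp_norm_def using assms by (intro powr_mono2) (auto simp: integral_nonneg_AE)
  then show ?thesis using assms by (simp add: powr_powr)
qed

lemma Lp_norm_cong_AE:
  assumes "AE x in M. f x = g x" "f \<in> borel_measurable M" "g \<in> borel_measurable M"
  shows "Lp_norm M p f = Lp_norm M p g"
  unfolding Lp_norm_def using assms
  by (intro arg_cong2[where f = "(powr)"] integral_cong_AE) auto

lemma Lp_space_uminus:
  fixes f :: "'a \<Rightarrow> 'b::{real_normed_vector, second_countable_topology}"
  shows "f \<in> Lp_space M p \<Longrightarrow> (\<lambda>x. - f x) \<in> Lp_space M p"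
  by (auto simp: Lp_space_def)

lemma Lp_norm_minus_commute: "Lp_norm M p (\<lambda>x. f x - g x) = Lp_norm M p (\<lambda>x. g x - f x)"
  by (simp add: Lp_norm_def norm_minus_commute)

lemma Lp_space_scale:
  fixes f :: "'a \<Rightarrow> real"
  shows "f \<in> Lp_space M p \<Longrightarrow> (\<lambda>x. c * f x) \<in> Lp_space M p"
  by (auto simp: Lp_space_def abs_mult powr_mult)

lemma Lp_norm_scale:
  fixes f :: "'a \<Rightarrow> real"
  assumes "p > 0"
  shows "Lp_norm M p (\<lambda>x. c * f x) = \<bar>c\<bar> * Lp_norm M p f"
  using assms by (simp add: Lp_norm_def abs_mult powr_mult powr_powr integral_nonneg_AE)

context
  fixes M :: "'a measure" and p :: real and f g :: "'a \<Rightarrow> 'b::{real_normed_vector, second_countable_topology}"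
  assumes p: "p \<ge> 1" and f: "f \<in> Lp_space M p" and g: "g \<in> Lp_space M p"
begin

lemma Lp_space_add: "(\<lambda>x. f x + g x) \<in> Lp_space M p"
proof -
  have [measurable]: "f \<in> borel_measurable M" "g \<in> borel_measurable M" using f g by (auto simp: Lp_space_def)
  have "integrable M (\<lambda>x. 1 / 2 * (2 powr p * norm (f x) powr p) + (1 - 1 / 2) * (2 powr p * norm (g x) powr p))"
    using f g by (auto simp: Lp_space_def)
  then have "integrable M (\<lambda>x. norm (f x + g x) powr p)"
  proof (rule Bochner_Integration.integrable_bound)
    show "AE x in M. norm (norm (f x + g x) powr p)
       \<le> norm (1 / 2 * (2 powr p * norm (f x) powr p) + (1 - 1 / 2) * (2 powr p * norm (g x) powr p))"
    proof (rule AE_I2)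
      fix x
      have "norm (f x + g x) powr p \<le> (1 / 2 * (2 * norm (f x)) + (1 - 1 / 2) * (2 * norm (g x))) powr p"
        using p norm_triangle_ineq by (intro powr_mono2) auto
      also have "\<dots> \<le> 1 / 2 * (2 * norm (f x)) powr p + (1 - 1 / 2) * (2 * norm (g x)) powr p"
        using p by (intro powr_convex_nonneg) auto
      finally show "norm (norm (f x + g x) powr p)
       \<le> norm (1 / 2 * (2 powr p * norm (f x) powr p) + (1 - 1 / 2) * (2 powr p * norm (g x) powr p))"
        by (simp add: powr_mult)
    qed
  qed auto
  then show ?thesis by (simp add: Lp_space_def)
qed

text \<open>Convexity of t^p with weights proportional to the two norms; after rescaling, both
  summands then have the same bound A + B. Raising the norms by d/2 keeps the weights strictly
  between 0 and 1 also when a norm vanishes.\<close>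

lemma Lp_norm_triangle: "Lp_norm M p (\<lambda>x. f x + g x) \<le> Lp_norm M p f + Lp_norm M p g"
proof (rule field_le_epsilon)
  fix d :: real assume d: "d > 0"
  let ?N = "Lp_norm M p f" and ?K = "Lp_norm M p g"
  define A where "A = ?N + d / 2"
  define B where "B = ?K + d / 2"
  have AB: "A > 0" "B > 0" "?N \<le> A" "?K \<le> B" using d Lp_norm_nonneg[of M p f] Lp_norm_nonneg[of M p g] by (auto simp: A_def B_def)
  define l where "l = A / (A + B)"
  have l: "0 < l" "l < 1" using AB by (auto simp: l_def)
  have lA: "A / l = A + B" using AB by (simp add: l_def)
  have lB: "B / (1 - l) = A + B"
  proof -
    have "1 - l = B / (A + B)" using AB by (simp add: l_def field_simps)
    then show ?thesis using AB by simp
  qed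
  have if': "integrable M (\<lambda>x. norm (f x) powr p)" and ig: "integrable M (\<lambda>x. norm (g x) powr p)"
    using f g by (auto simp: Lp_space_def)
  have "(\<integral>x. norm (f x + g x) powr p \<partial>M) \<le> (\<integral>x. l * ((1 / l) powr p * norm (f x) powr p) + (1 - l) * ((1 / (1 - l)) powr p * norm (g x) powr p) \<partial>M)"
  proof (rule integral_mono)
    show "integrable M (\<lambda>x. norm (f x + g x) powr p)" using Lp_space_add by (simp add: Lp_space_def)
    show "integrable M (\<lambda>x. l * ((1 / l) powr p * norm (f x) powr p) + (1 - l) * ((1 / (1 - l)) powr p * norm (g x) powr p))"
      using if' ig by auto
    fix x
    have "norm (f x + g x) powr p \<le> (l * (1 / l * norm (f x)) + (1 - l) * (1 / (1 - l) * norm (g x))) powr p"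
      using p l norm_triangle_ineq by (intro powr_mono2) auto
    also have "\<dots> \<le> l * (1 / l * norm (f x)) powr p + (1 - l) * (1 / (1 - l) * norm (g x)) powr p"
      using p l by (intro powr_convex_nonneg) auto
    finally show "norm (f x + g x) powr p \<le> l * ((1 / l) powr p * norm (f x) powr p) + (1 - l) * ((1 / (1 - l)) powr p * norm (g x) powr p)"
      using l by (subst (asm) (1 2) powr_mult) auto
  qed
  also have "\<dots> = l * ((1 / l) powr p * ?N powr p) + (1 - l) * ((1 / (1 - l)) powr p * ?K powr p)"
    using if' ig p by (simp add: Lp_norm_powr)
  also have "\<dots> = l * (?N / l) powr p + (1 - l) * (?K / (1 - l)) powr p"
    using l Lp_norm_nonneg[of M p f] Lp_norm_nonneg[of M p g] by (simp add: powr_divide)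
  also have "\<dots> \<le> l * (A / l) powr p + (1 - l) * (B / (1 - l)) powr p"
    using l AB p Lp_norm_nonneg[of M p f] Lp_norm_nonneg[of M p g]
    by (intro add_mono mult_left_mono powr_mono2 divide_right_mono) auto
  also have "\<dots> = (A + B) powr p" unfolding lA lB by (simp add: algebra_simps)
  finally have "Lp_norm M p (\<lambda>x. f x + g x) \<le> A + B" using AB p by (intro Lp_norm_leI) auto
  then show "Lp_norm M p (\<lambda>x. f x + g x) \<le> ?N + ?K + d" by (simp add: A_def B_def)
qed

end

lemma Lp_space_diff:
  fixes f g :: "'a \<Rightarrow> 'b::{real_normed_vector, second_countable_topology}"
  shows "p \<ge> 1 \<Longrightarrow> f \<in> Lp_space M p \<Longrightarrow> g \<in> Lp_space M p \<Longrightarrow> (\<lambda>x. f x - g x) \<in> Lp_space M p"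
  using Lp_space_add[of p f M "\<lambda>x. - g x"] Lp_space_uminus[of g M p] by simp

lemma Lp_norm_triangle_diff:
  fixes f g h :: "'a \<Rightarrow> 'b::{real_normed_vector, second_countable_topology}"
  assumes "p \<ge> 1" "f \<in> Lp_space M p" "g \<in> Lp_space M p" "h \<in> Lp_space M p"
  shows "Lp_norm M p (\<lambda>x. f x - h x) \<le> Lp_norm M p (\<lambda>x. f x - g x) + Lp_norm M p (\<lambda>x. g x - h x)"
  using Lp_norm_triangle[OF assms(1) Lp_space_diff[OF assms(1,2,3)] Lp_space_diff[OF assms(1,3,4)]] by simp

lemma Lp_norm_le_diff:
  fixes f g :: "'a \<Rightarrow> 'b::{real_normed_vector, second_countable_topology}"
  assumes "p \<ge> 1" "f \<in> Lp_space M p" "g \<in> Lp_space M p"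
  shows "Lp_norm M p f \<le> Lp_norm M p g + Lp_norm M p (\<lambda>x. f x - g x)"
  using Lp_norm_triangle[OF assms(1,3) Lp_space_diff[OF assms]] by simp

lemma Lp_space_bound:
  assumes "f \<in> borel_measurable M" "w \<in> Lp_space M p" "AE x in M. norm (f x) \<le> norm (w x)" "p \<ge> 0"
  shows "f \<in> Lp_space M p"
proof -
  have [measurable]: "f \<in> borel_measurable M" by fact
  have "integrable M (\<lambda>x. norm (w x) powr p)" using assms by (simp add: Lp_space_def)
  then have "integrable M (\<lambda>x. norm (f x) powr p)"
    by (rule Bochner_Integration.integrable_bound) (use assms in \<open>auto elim!: eventually_mono intro!: powr_mono2\<close>)
  then show ?thesis using assms by (simp add: Lp_space_def)
qed

lemma Lp_norm_mono:
  assumes "f \<in> borel_measurable M" "w \<in> Lp_space M p" "AE x in M. norm (f x) \<le> norm (w x)" "p > 0"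
  shows "Lp_norm M p f \<le> Lp_norm M p w"
proof -
  have "f \<in> Lp_space M p" using assms by (intro Lp_space_bound[of f M w]) auto
  then have "(\<integral>x. norm (f x) powr p \<partial>M) \<le> (\<integral>x. norm (w x) powr p \<partial>M)"
    using assms by (intro integral_mono_AE) (auto simp: Lp_space_def elim!: eventually_mono intro!: powr_mono2)
  then show ?thesis unfolding Lp_norm_def using assms by (intro powr_mono2) (auto simp: integral_nonneg_AE)
qed

lemma (in prob_space) Lp_space_bounded:
  assumes "f \<in> borel_measurable M" "AE x in M. norm (f x) \<le> B" "p \<ge> 0"
  shows "f \<in> Lp_space M p"
proof -
  have "(\<lambda>x. B) \<in> Lp_space M p" by (simp add: Lp_space_def)
  then show ?thesis using assms by (intro Lp_space_bound[of f M "\<lambda>x. B"]) (auto elim!: eventually_mono)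
qed

lemma (in prob_space) Lp_norm_const: "p > 0 \<Longrightarrow> Lp_norm M p (\<lambda>x. c) = norm c"
  by (simp add: Lp_norm_def powr_powr prob_space)

lemma Lp_dominated_convergence:
  fixes f :: "'a \<Rightarrow> 'b::{real_normed_vector, second_countable_topology}"
  assumes p: "p > 0" and s: "\<And>n. s n \<in> borel_measurable M" and f: "f \<in> borel_measurable M"
    and w: "w \<in> Lp_space M p" and lim: "AE x in M. (\<lambda>n. s n x) \<longlonglongrightarrow> f x"
    and dom: "\<And>n. AE x in M. norm (s n x - f x) \<le> norm (w x)"
  shows "(\<lambda>n. Lp_norm M p (\<lambda>x. s n x - f x)) \<longlonglongrightarrow> 0"
proof -
  note [measurable] = s f
  have "(\<lambda>n. \<integral>x. norm (s n x - f x) powr p \<partial>M) \<longlonglongrightarrow> (\<integral>x. 0 \<partial>M)"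
  proof (rule integral_dominated_convergence[where w = "\<lambda>x. norm (w x) powr p"])
    show "integrable M (\<lambda>x. norm (w x) powr p)" using w by (simp add: Lp_space_def)
    show "AE x in M. (\<lambda>n. norm (s n x - f x) powr p) \<longlonglongrightarrow> 0" using lim
    proof eventually_elim
      case (elim x)
      have "(\<lambda>n. norm (s n x - f x)) \<longlonglongrightarrow> 0"
        using tendsto_norm[OF tendsto_diff[OF elim tendsto_const[of "f x"]]] by simp
      then show ?case using p by (intro tendsto_zero_powrI[of _ _ "\<lambda>_. p" p]) auto
    qed
    show "AE x in M. norm (norm (s n x - f x) powr p) \<le> norm (w x) powr p" for n
      using dom[of n] by eventually_elim (use p in \<open>auto intro!: powr_mono2\<close>)
  qed auto
  then have "(\<lambda>n. (\<integral>x. norm (s n x - f x) powr p \<partial>M) powr (1 / p)) \<longlonglongrightarrow> 0"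
    using p by (intro tendsto_zero_powrI[of _ _ "\<lambda>_. 1 / p" "1 / p"]) (auto simp: integral_nonneg_AE)
  then show ?thesis by (simp add: Lp_norm_def)
qed

lemma Lp_Fatou:
  fixes f :: "'a \<Rightarrow> 'b::{real_normed_vector, second_countable_topology}"
  assumes p: "p > 0" and s: "\<And>n. s n \<in> Lp_space M p" and f: "f \<in> borel_measurable M"
    and lim: "AE x in M. (\<lambda>n. s n x) \<longlonglongrightarrow> f x" and c: "c \<longlonglongrightarrow> C" and sc: "\<And>n. Lp_norm M p (s n) \<le> c n"
  shows "f \<in> Lp_space M p" and "Lp_norm M p f \<le> C"
proof -
  have [measurable]: "\<And>n. s n \<in> borel_measurable M" "f \<in> borel_measurable M" using s f by (auto simp: Lp_space_def)
  have c0: "0 \<le> c n" for n using Lp_norm_nonneg order.trans sc by metis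
  then have C0: "C \<ge> 0" using c by (meson LIMSEQ_le_const)
  have "(\<integral>\<^sup>+x. ennreal (norm (f x) powr p) \<partial>M) = (\<integral>\<^sup>+x. liminf (\<lambda>n. ennreal (norm (s n x) powr p)) \<partial>M)"
  proof (intro nn_integral_cong_AE, use lim in eventually_elim)
    case (elim x)
    have "(\<lambda>n. norm (s n x) powr p) \<longlonglongrightarrow> norm (f x) powr p"
      using p tendsto_norm[OF elim] by (intro tendsto_powr2[OF _ tendsto_const]) auto
    then have "(\<lambda>n. ennreal (norm (s n x) powr p)) \<longlonglongrightarrow> ennreal (norm (f x) powr p)" by (rule tendsto_ennrealI)
    then show ?case by (intro lim_imp_Liminf[symmetric]) auto
  qed
  also have "\<dots> \<le> liminf (\<lambda>n. \<integral>\<^sup>+x. ennreal (norm (s n x) powr p) \<partial>M)" by (rule nn_integral_liminf) auto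
  also have "\<dots> \<le> liminf (\<lambda>n. ennreal (c n powr p))"
  proof (intro Liminf_mono always_eventually allI)
    fix n
    have "(\<integral>\<^sup>+x. ennreal (norm (s n x) powr p) \<partial>M) = ennreal (Lp_norm M p (s n) powr p)"
      using s[of n] p by (subst nn_integral_eq_integral) (auto simp: Lp_space_def Lp_norm_powr)
    also have "\<dots> \<le> ennreal (c n powr p)"
      using sc[of n] p by (intro ennreal_leI powr_mono2) (auto simp: Lp_norm_nonneg)
    finally show "(\<integral>\<^sup>+x. ennreal (norm (s n x) powr p) \<partial>M) \<le> ennreal (c n powr p)" .
  qed
  also have "liminf (\<lambda>n. ennreal (c n powr p)) = ennreal (C powr p)"
    using p c c0 by (intro lim_imp_Liminf tendsto_ennrealI tendsto_powr2[OF _ tendsto_const]) auto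
  finally have le: "(\<integral>\<^sup>+x. ennreal (norm (f x) powr p) \<partial>M) \<le> ennreal (C powr p)" .
  have int: "integrable M (\<lambda>x. norm (f x) powr p)"
    by (rule integrableI_bounded) (use le in \<open>auto simp: order_le_less_trans\<close>)
  then show "f \<in> Lp_space M p" using f by (simp add: Lp_space_def)
  have "ennreal (\<integral>x. norm (f x) powr p \<partial>M) \<le> ennreal (C powr p)"
    using le by (subst (asm) nn_integral_eq_integral[OF int]) auto
  then have "(\<integral>x. norm (f x) powr p \<partial>M) \<le> C powr p" by simp
  then show "Lp_norm M p f \<le> C" using p C0 by (intro Lp_norm_leI) auto
qed

text \<open>
  \<open>\<Sum>\<^sub>n 2\<^sup>n\<^sup>p |s\<^sub>n\<^sub>+\<^sub>1 - s\<^sub>n|\<^sup>p\<close> has finite integral, so the increments are eventually below \<open>2\<^sup>-\<^sup>n\<close>.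
\<close>

lemma Lp_fast_Cauchy_convergent:
  fixes s :: "nat \<Rightarrow> 'a \<Rightarrow> 'b::{banach, second_countable_topology}"
  assumes p: "p \<ge> 1" and s: "\<And>n. s n \<in> Lp_space M p"
    and fast: "\<And>n. Lp_norm M p (\<lambda>x. s (Suc n) x - s n x) \<le> (1 / 4) ^ n"
  obtains f where "f \<in> borel_measurable M" "AE x in M. (\<lambda>n. s n x) \<longlonglongrightarrow> f x"
proof -
  have [measurable]: "\<And>n. s n \<in> borel_measurable M" using s by (auto simp: Lp_space_def)
  define h where "h = (\<lambda>n x. (2 ^ n * norm (s (Suc n) x - s n x)) powr p)"
  have hm [measurable]: "h n \<in> borel_measurable M" for n unfolding h_def by measurable
  have d: "(\<lambda>x. s (Suc n) x - s n x) \<in> Lp_space M p" for n by (intro Lp_space_diff p s)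
  have hn: "(\<integral>\<^sup>+x. ennreal (h n x) \<partial>M) \<le> ennreal ((1 / 2) ^ n)" for n
  proof -
    have e: "h n x = (2 ^ n) powr p * norm (s (Suc n) x - s n x) powr p" for x by (simp add: h_def powr_mult)
    have "integrable M (h n)" unfolding e using d[of n] by (auto simp: Lp_space_def)
    then have "(\<integral>\<^sup>+x. ennreal (h n x) \<partial>M) = ennreal (\<integral>x. h n x \<partial>M)"
      by (intro nn_integral_eq_integral) (auto simp: h_def)
    also have "(\<integral>x. h n x \<partial>M) = (2 ^ n) powr p * Lp_norm M p (\<lambda>x. s (Suc n) x - s n x) powr p"
      unfolding e using p by (simp add: Lp_norm_powr)
    also have "\<dots> \<le> (2 ^ n) powr p * ((1 / 4) ^ n) powr p"
      using p fast[of n] by (intro mult_left_mono powr_mono2) (auto simp: Lp_norm_nonneg)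
    also have "\<dots> = ((1 / 2) ^ n) powr p" by (simp add: powr_mult[symmetric] power_mult_distrib[symmetric])
    also have "\<dots> \<le> ((1 / 2) ^ n) powr 1" using p by (intro powr_mono') (auto simp: power_le_one)
    finally show ?thesis by (simp add: ennreal_leI)
  qed
  have "(\<integral>\<^sup>+x. (\<Sum>n. ennreal (h n x)) \<partial>M) = (\<Sum>n. \<integral>\<^sup>+x. ennreal (h n x) \<partial>M)"
    by (rule nn_integral_suminf) auto
  also have "\<dots> \<le> (\<Sum>n. ennreal ((1 / 2) ^ n))" by (intro suminf_le hn) auto
  also have "\<dots> = ennreal (\<Sum>n. (1 / 2) ^ n)" by (intro suminf_ennreal2) (auto intro!: summable_geometric)
  also have "\<dots> < \<infinity>" by simp
  finally have "AE x in M. (\<Sum>n. ennreal (h n x)) \<noteq> \<infinity>" by (intro nn_integral_noteq_infinite) auto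
  then have AEc: "AE x in M. convergent (\<lambda>n. s n x)"
  proof eventually_elim
    case (elim x)
    have "summable (\<lambda>n. h n x)" using elim by (intro summable_suminf_not_top) (auto simp: h_def)
    have "(\<lambda>n. h n x) \<longlonglongrightarrow> 0" using \<open>summable (\<lambda>n. h n x)\<close> by (rule summable_LIMSEQ_zero)
    then obtain N where N: "\<And>n. n \<ge> N \<Longrightarrow> norm (h n x - 0) < 1" using LIMSEQ_D[of _ 0 1] zero_less_one by blast
    have step: "norm (s (Suc n) x - s n x) \<le> (1 / 2) ^ n" if "n \<ge> N" for n
    proof (rule ccontr)
      assume "\<not> ?thesis"
      then have "1 \<le> 2 ^ n * norm (s (Suc n) x - s n x)" by (simp add: field_simps power_one_over)
      then have "1 \<le> h n x" unfolding h_def using p by (intro ge_one_powr_ge_zero) auto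
      then show False using N[OF that] by simp
    qed
    have "summable (\<lambda>n. s (Suc n) x - s n x)"
    proof (rule summable_comparison_test)
      show "summable (\<lambda>n. (1 / 2 :: real) ^ n)" by (intro summable_geometric) auto
      show "\<exists>N. \<forall>n\<ge>N. norm (s (Suc n) x - s n x) \<le> (1 / 2) ^ n" using step by blast
    qed
    then have "convergent (\<lambda>n. \<Sum>i<n. s (Suc i) x - s i x)" by (simp add: summable_iff_convergent)
    then have "convergent (\<lambda>n. s n x - s 0 x)" by (simp only: sum_lessThan_telescope[of "\<lambda>i. s i x"])
    from convergent_add[OF this convergent_const[of "s 0 x"]] show ?case by simp
  qed
  show ?thesis
  proof (rule that[of "\<lambda>x. lim (\<lambda>n. s n x)"])
    show "(\<lambda>x. lim (\<lambda>n. s n x)) \<in> borel_measurable M" by measurable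
    show "AE x in M. (\<lambda>n. s n x) \<longlonglongrightarrow> lim (\<lambda>n. s n x)"
      using AEc by eventually_elim (simp add: convergent_LIMSEQ_iff)
  qed
qed

section \<open>Density of polynomials\<close>

context prob_space
begin

lemma Lp_space_integrable:
  fixes f :: "'a \<Rightarrow> real"
  assumes p: "p \<ge> 1" and f: "f \<in> Lp_space M p"
  shows "integrable M f"
proof -
  have [measurable]: "f \<in> borel_measurable M" using f by (simp add: Lp_space_def)
  have "integrable M (\<lambda>x. 1 + norm (f x) powr p)" using f by (simp add: Lp_space_def)
  then show ?thesis
  proof (rule Bochner_Integration.integrable_bound)
    show "AE x in M. norm (f x) \<le> norm (1 + norm (f x) powr p)"
    proof (rule AE_I2)
      fix x
      have "norm (f x) \<le> 1 + norm (f x) powr p"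
      proof (cases "norm (f x) \<le> 1")
        case False
        then have "norm (f x) powr 1 \<le> norm (f x) powr p" using p by (intro powr_mono) auto
        then show ?thesis using False by simp
      qed (simp add: add_increasing2)
      then show "norm (f x) \<le> norm (1 + norm (f x) powr p)" by simp
    qed
  qed simp
qed

text \<open>Young's inequality for |f| / s times 1, with s slightly above the norm; the integral of
  the right side is at most s (1/p + 1/q) = s. The slack d avoids dividing by a vanishing
  norm.\<close>

lemma abs_integral_le_Lp_norm:
  fixes f :: "'a \<Rightarrow> real"
  assumes p: "p > 1" and f: "f \<in> Lp_space M p"
  shows "\<bar>\<integral>x. f x \<partial>M\<bar> \<le> Lp_norm M p f"
proof (rule field_le_epsilon)
  fix d :: real assume d: "d > 0"
  define s where "s = Lp_norm M p f + d"
  have s: "s > 0" "Lp_norm M p f \<le> s" using d Lp_norm_nonneg[of M p f] by (auto simp: s_def)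
  have i: "integrable M f" using p f by (intro Lp_space_integrable[of p]) auto
  have ip: "integrable M (\<lambda>x. norm (f x) powr p)" using f by (simp add: Lp_space_def)
  define q where "q = p / (p - 1)"
  have q: "q > 1" "1 / p + 1 / q = 1" using p by (auto simp: q_def field_simps)
  have "\<bar>\<integral>x. f x \<partial>M\<bar> \<le> (\<integral>x. \<bar>f x\<bar> \<partial>M)" by (rule integral_abs_bound)
  also have "\<dots> \<le> (\<integral>x. s * (norm (f x) powr p / s powr p / p + 1 / q) \<partial>M)"
  proof (rule integral_mono)
    show "integrable M (\<lambda>x. \<bar>f x\<bar>)" using i by simp
    show "integrable M (\<lambda>x. s * (norm (f x) powr p / s powr p / p + 1 / q))" using ip by simp
    fix x
    have "\<bar>f x\<bar> / s * 1 \<le> (\<bar>f x\<bar> / s) powr p / p + 1 powr q / q"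
      using s p q by (intro Youngs_inequality) auto
    then have "s * (\<bar>f x\<bar> / s) \<le> s * ((\<bar>f x\<bar> / s) powr p / p + 1 / q)" using s by (intro mult_left_mono) auto
    then show "\<bar>f x\<bar> \<le> s * (norm (f x) powr p / s powr p / p + 1 / q)" using s by (simp add: powr_divide)
  qed
  also have "\<dots> = s * (Lp_norm M p f powr p / s powr p / p + 1 / q)"
    using ip p by (simp add: prob_space Lp_norm_powr)
  also have "\<dots> \<le> s * (s powr p / s powr p / p + 1 / q)"
    using s p by (intro mult_left_mono add_right_mono divide_right_mono powr_mono2) (auto simp: Lp_norm_nonneg)
  also have "\<dots> = s" using s q by simp
  finally show "\<bar>\<integral>x. f x \<partial>M\<bar> \<le> Lp_norm M p f + d" by (simp add: s_def)
qed

end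

lemma real_polynomial_function_continuous:
  fixes f :: "'a::euclidean_space \<Rightarrow> real"
  shows "real_polynomial_function f \<Longrightarrow> continuous_on S f"
  using continuous_on_polymonial_function[of f S] by (simp add: real_polynomial_function_eq)

context jacobi
begin

lemma open_cube_box: "open_cube = box (\<chi> i. -1) (\<chi> i. 1)"
  by (auto simp: open_cube_def mem_box_cart)

lemma open_cube_borel [measurable]: "open_cube \<in> sets (borel :: (real ^ 'n) measure)"
  by (simp add: open_cube_box)

lemma continuous_Lp_space:
  fixes f :: "real ^ 'n \<Rightarrow> real"
  assumes "continuous_on UNIV f" "p \<ge> 0"
  shows "f \<in> Lp_space \<nu> p"
proof -
  obtain B where "\<And>x. x \<in> open_cube \<Longrightarrow> \<bar>f x\<bar> \<le> B" using bounded_on_cube[OF assms(1)] by blast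
  then show ?thesis
    by (intro nu.Lp_space_bounded[of _ B] continuous_measurable_\<nu> assms AE_I2) (auto simp: space_\<nu>)
qed

lemma polynomial_Lp_space: "real_polynomial_function f \<Longrightarrow> p \<ge> 0 \<Longrightarrow> f \<in> Lp_space \<nu> p"
  by (intro continuous_Lp_space real_polynomial_function_continuous)

lemma indicator_Lp_space: "A \<in> sets borel \<Longrightarrow> p \<ge> 0 \<Longrightarrow> (indicator A :: real ^ 'n \<Rightarrow> real) \<in> Lp_space \<nu> p"
  by (intro nu.Lp_space_bounded[of _ 1] measurable_\<nu>I) (auto simp: indicator_def)

definition approximable :: "real \<Rightarrow> (real ^ 'n \<Rightarrow> real) \<Rightarrow> bool" where
  "approximable p f \<longleftrightarrow> (\<forall>\<epsilon>>0. \<exists>h. real_polynomial_function h \<and> Lp_norm \<nu> p (\<lambda>x. f x - h x) < \<epsilon>)"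

context
  fixes p :: real
  assumes p: "p \<ge> 1"
begin

lemma approximable_lim:
  assumes f: "f \<in> Lp_space \<nu> p"
    and g: "\<And>\<epsilon>. \<epsilon> > 0 \<Longrightarrow> \<exists>g. g \<in> Lp_space \<nu> p \<and> approximable p g \<and> Lp_norm \<nu> p (\<lambda>x. f x - g x) < \<epsilon>"
  shows "approximable p f"
  unfolding approximable_def
proof (intro allI impI)
  fix \<epsilon> :: real assume e: "\<epsilon> > 0"
  obtain g where g: "g \<in> Lp_space \<nu> p" "approximable p g" "Lp_norm \<nu> p (\<lambda>x. f x - g x) < \<epsilon> / 2"
    using g[of "\<epsilon> / 2"] e by auto
  obtain h where h: "real_polynomial_function h" "Lp_norm \<nu> p (\<lambda>x. g x - h x) < \<epsilon> / 2"
    using g(2) e unfolding approximable_def by (meson half_gt_zero)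
  have "Lp_norm \<nu> p (\<lambda>x. f x - h x) \<le> Lp_norm \<nu> p (\<lambda>x. f x - g x) + Lp_norm \<nu> p (\<lambda>x. g x - h x)"
    using p by (intro Lp_norm_triangle_diff f g polynomial_Lp_space h) auto
  then show "\<exists>h. real_polynomial_function h \<and> Lp_norm \<nu> p (\<lambda>x. f x - h x) < \<epsilon>" using h g by force
qed

lemma approximable_add:
  assumes "f \<in> Lp_space \<nu> p" "g \<in> Lp_space \<nu> p" "approximable p f" "approximable p g"
  shows "approximable p (\<lambda>x. f x + g x)"
  unfolding approximable_def
proof (intro allI impI)
  fix \<epsilon> :: real assume e: "\<epsilon> > 0"
  obtain h where h: "real_polynomial_function h" "Lp_norm \<nu> p (\<lambda>x. f x - h x) < \<epsilon> / 2"
    using assms e unfolding approximable_def by (meson half_gt_zero)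
  obtain k where k: "real_polynomial_function k" "Lp_norm \<nu> p (\<lambda>x. g x - k x) < \<epsilon> / 2"
    using assms e unfolding approximable_def by (meson half_gt_zero)
  have "Lp_norm \<nu> p (\<lambda>x. (f x - h x) + (g x - k x)) \<le> Lp_norm \<nu> p (\<lambda>x. f x - h x) + Lp_norm \<nu> p (\<lambda>x. g x - k x)"
    using p by (intro Lp_norm_triangle Lp_space_diff assms polynomial_Lp_space h k) auto
  also have "(\<lambda>x. (f x - h x) + (g x - k x)) = (\<lambda>x. (f x + g x) - (h x + k x))" by auto
  finally show "\<exists>h. real_polynomial_function h \<and> Lp_norm \<nu> p (\<lambda>x. f x + g x - h x) < \<epsilon>"
    using h k by (intro exI[of _ "\<lambda>x. h x + k x"] conjI real_polynomial_function.intros(3)) auto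
qed

lemma approximable_scale:
  assumes "approximable p f" shows "approximable p (\<lambda>x. c * f x)"
  unfolding approximable_def
proof (intro allI impI)
  fix \<epsilon> :: real assume e: "\<epsilon> > 0"
  have "\<epsilon> / (\<bar>c\<bar> + 1) > 0" using e by (simp add: add_nonneg_pos)
  then obtain h where h: "real_polynomial_function h" "Lp_norm \<nu> p (\<lambda>x. f x - h x) < \<epsilon> / (\<bar>c\<bar> + 1)"
    using assms unfolding approximable_def by meson
  have "Lp_norm \<nu> p (\<lambda>x. c * f x - c * h x) = \<bar>c\<bar> * Lp_norm \<nu> p (\<lambda>x. f x - h x)"
    using p by (simp add: Lp_norm_scale right_diff_distrib[symmetric])
  also have "\<dots> \<le> \<bar>c\<bar> * (\<epsilon> / (\<bar>c\<bar> + 1))" using h by (intro mult_left_mono) auto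
  also have "\<dots> < \<epsilon>" using e by (simp add: field_simps add_nonneg_pos)
  finally show "\<exists>h. real_polynomial_function h \<and> Lp_norm \<nu> p (\<lambda>x. c * f x - h x) < \<epsilon>"
    using h by (intro exI[of _ "\<lambda>x. c * h x"] conjI real_polynomial_function.intros(2,4))
qed

lemma approximable_sum:
  assumes "finite I" "\<And>i. i \<in> I \<Longrightarrow> f i \<in> Lp_space \<nu> p" "\<And>i. i \<in> I \<Longrightarrow> approximable p (f i)"
  shows "(\<lambda>x. \<Sum>i\<in>I. f i x) \<in> Lp_space \<nu> p \<and> approximable p (\<lambda>x. \<Sum>i\<in>I. f i x)"
  using assms
proof (induction I rule: finite_induct)
  case empty
  have "approximable p (\<lambda>x. 0)" unfolding approximable_def
    using p by (auto intro!: exI[of _ "\<lambda>x. 0"] real_polynomial_function.intros(2) simp: Lp_norm_def)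
  then show ?case using p by (simp add: continuous_Lp_space)
next
  case (insert i I)
  then show ?case using p approximable_add[of "f i" "\<lambda>x. \<Sum>i\<in>I. f i x"] Lp_space_add[of p "f i" \<nu> "\<lambda>x. \<Sum>i\<in>I. f i x"]
    by simp
qed

lemma approximable_continuous:
  assumes "continuous_on UNIV f" shows "approximable p f"
  unfolding approximable_def
proof (intro allI impI)
  fix \<epsilon> :: real assume e: "\<epsilon> > 0"
  have c: "continuous_on (cbox (\<chi> i. -1) (\<chi> i. 1)) f" using assms continuous_on_subset by blast
  obtain h where h: "real_polynomial_function h" "\<And>x. x \<in> cbox (\<chi> i. -1) (\<chi> i. 1) \<Longrightarrow> \<bar>f x - h x\<bar> < \<epsilon> / 2"
    using Stone_Weierstrass_real_polynomial_function[OF compact_cbox c, of "\<epsilon> / 2"] e by auto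
  have "Lp_norm \<nu> p (\<lambda>x. f x - h x) \<le> Lp_norm \<nu> p (\<lambda>x. \<epsilon> / 2)"
  proof (rule Lp_norm_mono)
    show "(\<lambda>x. f x - h x) \<in> borel_measurable \<nu>"
      by (intro continuous_measurable_\<nu> continuous_intros assms real_polynomial_function_continuous h)
    show "(\<lambda>x. \<epsilon> / 2) \<in> Lp_space \<nu> p" using p by (intro continuous_Lp_space) auto
    show "AE x in \<nu>. norm (f x - h x) \<le> norm (\<epsilon> / 2)"
    proof (rule AE_I2)
      fix x assume "x \<in> space \<nu>"
      then have "x \<in> cbox (\<chi> i. -1) (\<chi> i. 1)" by (auto simp: space_\<nu> open_cube_def mem_box_cart less_imp_le)
      then show "norm (f x - h x) \<le> norm (\<epsilon> / 2)" using h(2)[of x] e by simp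
    qed
  qed (use p in auto)
  also have "\<dots> = \<epsilon> / 2" using p e by (subst nu.Lp_norm_const) auto
  also have "\<dots> < \<epsilon>" using e by simp
  finally show "\<exists>h. real_polynomial_function h \<and> Lp_norm \<nu> p (\<lambda>x. f x - h x) < \<epsilon>" using h by blast
qed

text \<open>The continuous functions max(0, 1 - n dist(x, K)) decrease to the indicator, because K
  is closed. The empty set is treated separately since the distance to it carries no
  information.\<close>

lemma approximable_indicator_compact:
  assumes K: "compact (K :: (real ^ 'n) set)" shows "approximable p (indicator K)"
proof (cases "K = {}")
  case True
  then show ?thesis by (simp add: approximable_continuous)
next
  case False
  have cl: "closed K" using K by (rule compact_imp_closed)
  have Km: "K \<in> sets borel" using cl by simp
  define s where "s = (\<lambda>n x. max 0 (1 - real n * infdist x K))"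
  have cs: "continuous_on UNIV (s n)" for n unfolding s_def by (intro continuous_intros)
  have "(\<lambda>n. Lp_norm \<nu> p (\<lambda>x. s n x - indicator K x)) \<longlonglongrightarrow> 0"
  proof (rule Lp_dominated_convergence[where w = "\<lambda>_. 1::real"])
    show "p > 0" using p by simp
    show "s n \<in> borel_measurable \<nu>" for n by (intro continuous_measurable_\<nu> cs)
    show "(indicator K :: _ \<Rightarrow> real) \<in> borel_measurable \<nu>" using Km by (intro measurable_\<nu>I) auto
    show "(\<lambda>_. 1::real) \<in> Lp_space \<nu> p" using p by (intro continuous_Lp_space) auto
    show "AE x in \<nu>. (\<lambda>n. s n x) \<longlonglongrightarrow> indicator K x"
    proof (rule AE_I2)
      fix x :: "real ^ 'n"
      show "(\<lambda>n. s n x) \<longlonglongrightarrow> indicator K x"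
      proof (cases "x \<in> K")
        case True
        then show ?thesis by (simp add: s_def)
      next
        case x: False
        then have i: "infdist x K > 0" using infdist_pos_not_in_closed[OF cl False x] by simp
        then obtain N where N: "1 < real N * infdist x K" using reals_Archimedean3 by blast
        have "s n x = 0" if "n \<ge> N" for n
        proof -
          have "real N * infdist x K \<le> real n * infdist x K" using that i by (intro mult_right_mono) auto
          then show ?thesis using N by (simp add: s_def)
        qed
        then have "\<forall>\<^sub>F n in sequentially. s n x = indicator K x"
          using x by (auto simp: eventually_sequentially)
        then show ?thesis by (rule tendsto_eventually)
      qed
    qed
    show "AE x in \<nu>. norm (s n x - indicator K x) \<le> norm (1::real)" for n
    proof (rule AE_I2)
      fix x :: "real ^ 'n"
      have "0 \<le> real n * infdist x K" by (simp add: infdist_nonneg)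
      then have "0 \<le> s n x" "s n x \<le> 1" by (auto simp: s_def)
      then show "norm (s n x - indicator K x) \<le> norm (1::real)" by (auto simp: indicator_def)
    qed
  qed
  moreover have "Lp_norm \<nu> p (\<lambda>x. s n x - indicator K x) = Lp_norm \<nu> p (\<lambda>x. indicator K x - s n x)" for n
    by (rule Lp_norm_minus_commute)
  ultimately have lim: "(\<lambda>n. Lp_norm \<nu> p (\<lambda>x. indicator K x - s n x)) \<longlonglongrightarrow> 0" by (simp only:)
  show ?thesis
  proof (rule approximable_lim)
    show "(indicator K :: _ \<Rightarrow> real) \<in> Lp_space \<nu> p" using Km p by (intro indicator_Lp_space) auto
    fix \<epsilon> :: real assume "\<epsilon> > 0"
    then obtain n where "Lp_norm \<nu> p (\<lambda>x. indicator K x - s n x) < \<epsilon>"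
      using eventually_happens'[OF sequentially_bot order_tendstoD(2)[OF lim]] by blast
    then show "\<exists>g. g \<in> Lp_space \<nu> p \<and> approximable p g \<and> Lp_norm \<nu> p (\<lambda>x. indicator K x - g x) < \<epsilon>"
      using cs p by (intro exI[of _ "s n"]) (auto intro!: approximable_continuous continuous_Lp_space)
  qed
qed

text \<open>Inner regularity supplies a compact subset of almost full measure. As
  \<open>\<nu>\<close> lives on the Borel sets of the cube, regularity is applied to its image
  \<open>N\<close> on the Borel sets of the whole space.\<close>

lemma approximable_indicator:
  assumes A: "(A :: (real ^ 'n) set) \<in> sets borel" shows "approximable p (indicator A)"
proof (rule approximable_lim)
  show "(indicator A :: _ \<Rightarrow> real) \<in> Lp_space \<nu> p" using A p by (intro indicator_Lp_space) auto
  fix \<epsilon> :: real assume e: "\<epsilon> > 0"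
  define N where "N = distr \<nu> borel (\<lambda>x. x)"
  have idm: "(\<lambda>x. x) \<in> measurable \<nu> borel" by (intro measurable_\<nu>I) auto
  interpret N: prob_space N unfolding N_def by (rule nu.prob_space_distr[OF idm])
  have sN: "sets N = sets borel" by (simp add: N_def)
  have "\<exists>K\<in>{K. K \<subseteq> A \<and> compact K}. emeasure N A < emeasure N K + ennreal (\<epsilon> powr p)"
  proof (rule SUP_approx_ennreal)
    show "emeasure N A = (SUP K\<in>{K. K \<subseteq> A \<and> compact K}. emeasure N K)"
      by (rule inner_regular[OF sN _ A]) simp
    have "{} \<in> {K. K \<subseteq> A \<and> compact K}" by simp
    then show "{K. K \<subseteq> A \<and> compact K} \<noteq> {}" by blast
    show "\<epsilon> powr p > 0" using e by simp
    show "emeasure N A \<noteq> \<infinity>" using N.emeasure_finite by simp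
  qed
  then obtain K where K: "K \<subseteq> A" "compact K" "emeasure N A < emeasure N K + ennreal (\<epsilon> powr p)" by auto
  have Km: "K \<in> sets borel" by (intro borel_closed compact_imp_closed K)
  have m: "measure N A < measure N K + \<epsilon> powr p"
    using K(3) unfolding N.emeasure_eq_measure by (simp add: ennreal_plus[symmetric] ennreal_less_iff del: ennreal_plus)
  have "(\<integral>x. norm (indicator A x - indicator K x :: real) powr p \<partial>\<nu>) = (\<integral>x. indicator (A - K) x \<partial>\<nu>)"
    using K(1) p by (intro Bochner_Integration.integral_cong refl) (auto simp: indicator_def)
  also have "\<dots> = (\<integral>x. indicator (A - K) x \<partial>N)"
    unfolding N_def by (rule integral_distr[OF idm, symmetric]) (use A Km in auto)
  also have "\<dots> = measure N (A - K)" using A Km by (simp add: sN N_def)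
  also have "\<dots> = measure N A - measure N K" using A Km K(1) by (intro N.finite_measure_Diff) (auto simp: sN)
  also have "\<dots> < \<epsilon> powr p" using m by simp
  finally have "Lp_norm \<nu> p (\<lambda>x. indicator A x - indicator K x :: real) < (\<epsilon> powr p) powr (1 / p)"
    unfolding Lp_norm_def using p by (intro powr_less_mono2) (auto simp: integral_nonneg_AE)
  also have "\<dots> = \<epsilon>" using p e by (simp add: powr_powr)
  finally show "\<exists>g. g \<in> Lp_space \<nu> p \<and> approximable p g \<and> Lp_norm \<nu> p (\<lambda>x. indicator A x - g x) < \<epsilon>"
    using Km p K(2) by (intro exI[of _ "indicator K"]) (auto intro!: approximable_indicator_compact indicator_Lp_space)
qed

lemma polynomials_dense:
  assumes f: "f \<in> Lp_space \<nu> p" shows "approximable p f"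
proof -
  have [measurable]: "f \<in> borel_measurable \<nu>" using f by (simp add: Lp_space_def)
  obtain s where "\<forall>i. simple_function \<nu> (s i)" "\<forall>x\<in>space \<nu>. (\<lambda>i. s i x) \<longlonglongrightarrow> f x"
    "\<forall>i. \<forall>x\<in>space \<nu>. dist (s i x) 0 \<le> 2 * dist (f x) 0"
    using borel_measurable_implies_sequence_metric[of f \<nu> 0] by auto
  then have s: "\<And>i. simple_function \<nu> (s i)" "\<And>x. x \<in> space \<nu> \<Longrightarrow> (\<lambda>i. s i x) \<longlonglongrightarrow> f x"
    "\<And>i x. x \<in> space \<nu> \<Longrightarrow> dist (s i x) 0 \<le> 2 * dist (f x) 0" by blast+
  have simple: "s i \<in> Lp_space \<nu> p \<and> approximable p (s i)" for i
  proof -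
    let ?g = "\<lambda>x. \<Sum>y\<in>s i ` space \<nu>. y * indicator (s i -` {y} \<inter> space \<nu>) x"
    have A: "s i -` {y} \<inter> space \<nu> \<in> sets borel" for y
    proof -
      have "s i -` {y} \<inter> space \<nu> \<in> sets \<nu>" using s(1) by (auto intro: simple_functionD(2))
      then show ?thesis by (auto simp: sets_\<nu> sets_restrict_space_iff)
    qed
    have g: "?g \<in> Lp_space \<nu> p \<and> approximable p ?g"
      using p by (intro approximable_sum approximable_scale approximable_indicator Lp_space_scale indicator_Lp_space A simple_functionD(1)[OF s(1)]) auto
    have eq: "s i x = ?g x" if "x \<in> space \<nu>" for x
    proof -
      have "?g x = (\<Sum>y\<in>s i ` space \<nu>. if s i x = y then y else 0)"
        using that by (intro sum.cong) (auto simp: indicator_def)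
      also have "\<dots> = s i x" using that simple_functionD(1)[OF s(1)] by (subst sum.delta') auto
      finally show ?thesis by simp
    qed
    have sm: "s i \<in> borel_measurable \<nu>" using s(1) by (rule borel_measurable_simple_function)
    have "integrable \<nu> (\<lambda>x. norm (s i x) powr p) \<longleftrightarrow> integrable \<nu> (\<lambda>x. norm (?g x) powr p)"
      by (intro Bochner_Integration.integrable_cong refl) (simp only: eq)
    then have "s i \<in> Lp_space \<nu> p" using g sm by (simp add: Lp_space_def)
    moreover have "Lp_norm \<nu> p (\<lambda>x. s i x - h x) = Lp_norm \<nu> p (\<lambda>x. ?g x - h x)" for h
      unfolding Lp_norm_def by (intro arg_cong2[where f = "(powr)"] Bochner_Integration.integral_cong refl) (simp only: eq)
    ultimately show ?thesis using g unfolding approximable_def by simp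
  qed
  \<comment> \<open>The simple functions satisfy |s n| \<le> 2 |f|, hence |s n - f| \<le> 3
    |f|.\<close>
  have "(\<lambda>x. 3 * f x) \<in> Lp_space \<nu> p" by (rule Lp_space_scale[OF f])
  then have "(\<lambda>n. Lp_norm \<nu> p (\<lambda>x. s n x - f x)) \<longlonglongrightarrow> 0"
  proof (rule Lp_dominated_convergence[rotated 3])
    show "AE x in \<nu>. norm (s n x - f x) \<le> norm (3 * f x)" for n
    proof (rule AE_I2)
      fix x assume "x \<in> space \<nu>"
      then have "\<bar>s n x\<bar> \<le> 2 * \<bar>f x\<bar>" using s(3) by simp
      then show "norm (s n x - f x) \<le> norm (3 * f x)" by (simp add: abs_mult)
    qed
  qed (use p s simple in \<open>auto simp: Lp_space_def\<close>)
  moreover have "Lp_norm \<nu> p (\<lambda>x. s n x - f x) = Lp_norm \<nu> p (\<lambda>x. f x - s n x)" for n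
    by (rule Lp_norm_minus_commute)
  ultimately have lim: "(\<lambda>n. Lp_norm \<nu> p (\<lambda>x. f x - s n x)) \<longlonglongrightarrow> 0" by (simp only:)
  show ?thesis
  proof (rule approximable_lim[OF f])
    fix \<epsilon> :: real assume "\<epsilon> > 0"
    then obtain n where "Lp_norm \<nu> p (\<lambda>x. f x - s n x) < \<epsilon>"
      using eventually_happens'[OF sequentially_bot order_tendstoD(2)[OF lim]] by blast
    then show "\<exists>g. g \<in> Lp_space \<nu> p \<and> approximable p g \<and> Lp_norm \<nu> p (\<lambda>x. f x - g x) < \<epsilon>"
      using simple by blast
  qed
qed

end

end

section \<open>Riesz transforms of polynomials\<close>

lemma poly_antiderivative: "\<exists>q. pderiv q = (p :: real poly)"
proof
  have s: "pderiv (sum f A) = (\<Sum>x\<in>A. pderiv (f x))" for f :: "nat \<Rightarrow> real poly" and A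
    using higher_pderiv_sum[of 1 f A] by simp
  have "pderiv (\<Sum>j\<le>degree p. monom (coeff p j / real (Suc j)) (Suc j)) = (\<Sum>j\<le>degree p. monom (coeff p j) j)"
    unfolding s by (intro sum.cong refl) (simp add: pderiv_monom del: of_nat_Suc)
  then show "pderiv (\<Sum>j\<le>degree p. monom (coeff p j / real (Suc j)) (Suc j)) = p"
    by (simp add: poly_as_sum_of_monoms)
qed

lemma square_powr_half: "(y\<^sup>2) powr (s / 2) = \<bar>y\<bar> powr s" for y s :: real
proof -
  have "(y\<^sup>2) powr (s / 2) = (\<bar>y\<bar> powr 2) powr (s / 2)" by simp
  then show ?thesis by (simp only: powr_powr) simp
qed

text \<open>\<open>N\<close> and \<open>F\<close> stand for the norms of R f and f, and
  \<open>l\<close> scales the test field |R f|^(p-2) R f, whose q-norm to the power q is l^q N^p.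
  The free parameter turns the additive bound into a linear one.\<close>

lemma optimize_scaling:
  fixes m K1 K2 N F p q :: real
  assumes m: "m > 0" and K: "K1 \<ge> 0" "K2 \<ge> 0" and N: "N \<ge> 0" and F: "F \<ge> 0"
    and p: "p > 1" and q: "q = p / (p - 1)"
    and le: "\<And>l. l > 0 \<Longrightarrow> m * l * N powr p \<le> K1 * F powr p + K2 * l powr q * N powr p"
  shows "N \<le> (K1 + K2) / m * F"
proof (cases "N = 0")
  case True
  then show ?thesis using K m F by simp
next
  case False
  then have N: "N > 0" using N by simp
  have q1: "q > 1" using p by (simp add: q field_simps)
  show ?thesis
  proof (cases "F = 0")
    case True
    have K2: "K2 + 1 > 0" using K by simp
    \<comment> \<open>If F = 0, a small \<open>l\<close> suffices: after division by l N^p the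
      hypothesis reads m \<le> K2 l^(q-1), and this choice makes the right side less than m, which
      is absurd.\<close>
    define l where "l = (m / (2 * (K2 + 1))) powr (1 / (q - 1))"
    have l: "l > 0" using m K2 by (simp add: l_def)
    have "l powr (q - 1) = m / (2 * (K2 + 1))" using q1 m K2 by (simp add: l_def powr_powr)
    moreover have "m * l * N powr p \<le> K2 * l powr q * N powr p" using le[OF l] True p by simp
    then have "m * l \<le> K2 * l powr q" using N by simp
    moreover have "l powr q = l * l powr (q - 1)" using l by (simp add: powr_diff)
    ultimately have "m * l \<le> K2 * (l * (m / (2 * (K2 + 1))))" by (simp only:)
    then have "m * l \<le> (K2 * (m / (2 * (K2 + 1)))) * l" by (simp only: mult_ac)
    then have "m \<le> K2 * (m / (2 * (K2 + 1)))" using l by (rule mult_right_le_imp_le)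
    then have "m * (2 * (K2 + 1)) \<le> K2 * m" using K2 by (simp add: field_simps)
    then have "m * (K2 + 2) \<le> 0" by (simp add: algebra_simps)
    then show ?thesis using m K by (simp add: mult_le_0_iff)
  next
    case False
    then have F: "F > 0" using F by simp
    \<comment> \<open>With this \<open>l\<close> one has l^q N^p = F^p, so both terms on the right
      are multiples of F^p and their constants simply add.\<close>
    define l where "l = (F / N) powr (p - 1)"
    have l: "l > 0" using F N by (simp add: l_def)
    have "l powr q = (F / N) powr p" using p by (simp add: l_def powr_powr q)
    then have lq: "l powr q * N powr p = F powr p" using F N by (simp add: powr_divide)
    have "l * N powr p = N * F powr (p - 1)" using F N by (simp add: l_def powr_divide powr_diff)
    then have "m * (N * F powr (p - 1)) \<le> (K1 + K2) * F powr p"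
      using le[OF l] lq by (simp add: mult.assoc distrib_right)
    also have "F powr p = F * F powr (p - 1)" using F by (simp add: powr_diff)
    finally have "m * N * F powr (p - 1) \<le> (K1 + K2) * F * F powr (p - 1)" by (simp add: mult.assoc)
    then have "m * N \<le> (K1 + K2) * F" using F by simp
    then show ?thesis using m by (simp add: field_simps)
  qed
qed

context jacobi
begin

definition coef :: "(real ^ 'n \<Rightarrow> real) \<Rightarrow> nat ^ 'n \<Rightarrow> real" where
  "coef f k = (\<integral>y. f y * jacobi_basis \<alpha> \<beta> k y \<partial>\<nu>)"

lemma coef_sum:
  assumes "finite F"
  shows "coef (\<lambda>x. \<Sum>k\<in>F. c k * tensor (basis_polys k) x) l = (if l \<in> F then c l else 0)"
proof -
  have "coef (\<lambda>x. \<Sum>k\<in>F. c k * tensor (basis_polys k) x) l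
    = (\<integral>x. (\<Sum>k\<in>F. c k * (tensor (basis_polys k) x * tensor (basis_polys l) x)) \<partial>\<nu>)"
    unfolding coef_def jacobi_basis_eq_tensor by (simp add: sum_distrib_right mult.assoc)
  also have "\<dots> = (\<Sum>k\<in>F. c k * (if k = l then 1 else 0))"
    by (subst Bochner_Integration.integral_sum)
      (auto simp: basis_orthonormal intro!: continuous_integrable_\<nu> continuous_intros)
  also have "\<dots> = (if l \<in> F then c l else 0)" using assms by (simp add: if_distrib[of "(*) _"] sum.delta cong: if_cong)
  finally show ?thesis .
qed

lemma polynomial_coef:
  assumes f: "real_polynomial_function f"
  shows "finite {k. coef f k \<noteq> 0}"
    and "finite F \<Longrightarrow> {k. coef f k \<noteq> 0} \<subseteq> F \<Longrightarrow> f x = (\<Sum>k\<in>F. coef f k * tensor (basis_polys k) x)"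
proof -
  obtain G c where G: "finite G" "f = (\<lambda>x. \<Sum>k\<in>G. c k * tensor (basis_polys k) x)"
    using polynomial_jspan[OF f] by (auto simp: jspan_def)
  have c: "coef f k = (if k \<in> G then c k else 0)" for k unfolding G(2) by (rule coef_sum[OF G(1)])
  show fin: "finite {k. coef f k \<noteq> 0}" by (rule finite_subset[OF _ G(1)]) (auto simp: c)
  assume F: "finite F" "{k. coef f k \<noteq> 0} \<subseteq> F"
  have "f x = (\<Sum>k\<in>G. coef f k * tensor (basis_polys k) x)" by (subst G(2)) (simp add: c)
  also have "\<dots> = (\<Sum>k\<in>{k. coef f k \<noteq> 0}. coef f k * tensor (basis_polys k) x)"
    by (intro sum.mono_neutral_right) (auto simp: G(1) c split: if_splits)
  also have "\<dots> = (\<Sum>k\<in>F. coef f k * tensor (basis_polys k) x)"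
    by (intro sum.mono_neutral_left) (use F in auto)
  finally show "f x = (\<Sum>k\<in>F. coef f k * tensor (basis_polys k) x)" .
qed

lemma coef_diff:
  assumes "real_polynomial_function f" "real_polynomial_function g"
  shows "coef (\<lambda>x. f x - g x) k = coef f k - coef g k"
proof -
  have "integrable \<nu> (\<lambda>x. f x * jacobi_basis \<alpha> \<beta> k x)" if "real_polynomial_function f" for f
    unfolding jacobi_basis_eq_tensor
    by (intro continuous_integrable_\<nu> continuous_intros real_polynomial_function_continuous that)
  from Bochner_Integration.integral_diff[OF this[OF assms(1)] this[OF assms(2)]]
  show ?thesis unfolding coef_def by (simp add: left_diff_distrib)
qed

lemma basis_0: "\<exists>r. r \<noteq> 0 \<and> tensor (basis_polys 0) = (\<lambda>x. r)"
proof -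
  have "\<exists>v. basis_polys 0 i = [:v:]" for i
    using degree_Npoly[OF \<alpha> \<beta>, of i i 0] unfolding basis_polys_def zero_index by (auto elim: degree_eq_zeroE)
  then obtain v where v: "\<And>i. basis_polys 0 i = [:v i:]" by metis
  have "tensor (basis_polys 0) = (\<lambda>x. \<Prod>i\<in>UNIV. v i)" by (simp add: tensor_def[abs_def] v)
  then obtain r where e: "tensor (basis_polys 0) = (\<lambda>x. r)" by blast
  moreover have "r \<noteq> 0" using basis_orthonormal[of 0 0] unfolding e by auto
  ultimately show ?thesis by blast
qed

lemma coef_0_eq_0_iff: "coef f 0 = 0 \<longleftrightarrow> (\<integral>x. f x \<partial>\<nu>) = 0"
proof -
  obtain r where "r \<noteq> 0" "tensor (basis_polys 0) = (\<lambda>x. r)" using basis_0 by blast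
  then show ?thesis by (simp add: coef_def jacobi_basis_eq_tensor)
qed

lemma coef_const: "k \<noteq> 0 \<Longrightarrow> coef (\<lambda>x. c) k = 0"
proof -
  assume k: "k \<noteq> 0"
  obtain r where r: "r \<noteq> 0" "tensor (basis_polys 0) = (\<lambda>x. r)" using basis_0 by blast
  have "coef (\<lambda>x. \<Sum>k\<in>{0}. c / r * tensor (basis_polys k) x) k = 0"
    by (subst coef_sum) (use k in auto)
  then show ?thesis using r by simp
qed

lemma rt_0: "rt 0 = 0"
  by (simp add: rt_def jacobi_eigenvalue_def)

lemma riesz_term_eq:
  "riesz_term \<alpha> \<beta> i f k x = coef f k / rt k * (sqrt (1 - (x $ i)\<^sup>2) * tensor (pd i (basis_polys k)) x)"
proof -
  have u: "x + t *\<^sub>R axis i 1 = upd x i (t + x $ i)" for t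
    by (simp add: vec_eq_iff axis_def)
  have "((\<lambda>t. tensor (basis_polys k) (upd x i (t + x $ i))) has_real_derivative tensor (pd i (basis_polys k)) (upd x i (0 + x $ i))) (at 0)"
    by (rule DERIV_shift[THEN iffD1], rule DERIV_tensor)
  then have "jacobi_delta i (jacobi_basis \<alpha> \<beta> k) x = sqrt (1 - (x $ i)\<^sup>2) * tensor (pd i (basis_polys k)) x"
    unfolding jacobi_delta_def jacobi_basis_eq_tensor u by (simp add: DERIV_imp_deriv)
  moreover have "jacobi_eigenvalue \<alpha> \<beta> k powr (- 1 / 2) = 1 / rt k"
    using eigenvalue_nonneg[of k] by (simp add: rt_def powr_minus_divide powr_half_sqrt)
  ultimately show ?thesis unfolding riesz_term_def coef_def[symmetric] by simp
qed

text \<open>The index \<open>0\<close> contributes nothing, as \<open>rt 0 = 0\<close> and \<open>x / 0 = 0\<close>.\<close>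

definition Rz :: "(real ^ 'n \<Rightarrow> real) \<Rightarrow> real ^ 'n \<Rightarrow> real ^ 'n" where
  "Rz f x = (\<chi> i. \<Sum>k | coef f k \<noteq> 0. riesz_term \<alpha> \<beta> i f k x)"

lemma Rz_nth:
  assumes "finite F" "{k. coef f k \<noteq> 0 \<and> k \<noteq> 0} \<subseteq> F" "finite {k. coef f k \<noteq> 0}"
  shows "Rz f x $ i = (\<Sum>k\<in>F. riesz_term \<alpha> \<beta> i f k x)"
proof -
  have z: "riesz_term \<alpha> \<beta> i f k x = 0" if "coef f k = 0 \<or> k = 0" for k
    using that rt_0 by (auto simp: riesz_term_eq)
  have "Rz f x $ i = (\<Sum>k\<in>{k. coef f k \<noteq> 0 \<and> k \<noteq> 0}. riesz_term \<alpha> \<beta> i f k x)"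
    unfolding Rz_def vec_lambda_beta
    by (intro sum.mono_neutral_right assms) (use z in auto)
  also have "\<dots> = (\<Sum>k\<in>F. riesz_term \<alpha> \<beta> i f k x)"
    by (intro sum.mono_neutral_left assms) (use z in auto)
  finally show ?thesis .
qed

lemma continuous_riesz_term: "continuous_on UNIV (riesz_term \<alpha> \<beta> i f k)"
  unfolding riesz_term_eq[abs_def] by (intro continuous_intros)

lemma continuous_Rz: "continuous_on UNIV (Rz f)"
  unfolding Rz_def[abs_def] by (intro continuous_on_vec_lambda continuous_intros continuous_riesz_term)

lemma continuous_Lp_space_vec:
  fixes g :: "real ^ 'n \<Rightarrow> real ^ 'n"
  assumes g: "continuous_on UNIV g" and p: "p \<ge> 0"
  shows "g \<in> Lp_space \<nu> p"
proof -
  have "continuous_on UNIV (\<lambda>x. norm (g x))" by (intro continuous_intros g)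
  then have "(\<lambda>x. norm (g x)) \<in> Lp_space \<nu> p" using p by (rule continuous_Lp_space)
  then show ?thesis
    using p by (intro Lp_space_bound[of g \<nu> "\<lambda>x. norm (g x)"] continuous_measurable_\<nu> g) auto
qed

lemma Rz_diff:
  assumes f: "real_polynomial_function f" and g: "real_polynomial_function g"
  shows "Rz (\<lambda>x. f x - g x) = (\<lambda>x. Rz f x - Rz g x)"
proof (rule ext, rule vec_eq_iff[THEN iffD2], rule allI)
  fix x i
  let ?F = "{k. coef f k \<noteq> 0} \<union> {k. coef g k \<noteq> 0}"
  have fin: "finite ?F" using polynomial_coef(1) f g by blast
  have d: "real_polynomial_function (\<lambda>x. f x - g x)" using f g by (rule real_polynomial_function_diff)
  have "Rz (\<lambda>x. f x - g x) x $ i = (\<Sum>k\<in>?F. riesz_term \<alpha> \<beta> i (\<lambda>x. f x - g x) k x)"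
    by (intro Rz_nth fin polynomial_coef(1) d) (auto simp: coef_diff[OF f g])
  also have "\<dots> = (\<Sum>k\<in>?F. riesz_term \<alpha> \<beta> i f k x) - (\<Sum>k\<in>?F. riesz_term \<alpha> \<beta> i g k x)"
    unfolding riesz_term_eq coef_diff[OF f g] by (simp add: sum_subtractf[symmetric] left_diff_distrib diff_divide_distrib)
  also have "(\<Sum>k\<in>?F. riesz_term \<alpha> \<beta> i f k x) = Rz f x $ i"
    by (intro Rz_nth[symmetric] fin polynomial_coef(1) f) auto
  also have "(\<Sum>k\<in>?F. riesz_term \<alpha> \<beta> i g k x) = Rz g x $ i"
    by (intro Rz_nth[symmetric] fin polynomial_coef(1) g) auto
  finally show "Rz (\<lambda>x. f x - g x) x $ i = (Rz f x - Rz g x) $ i" by simp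
qed

lemma Rz_const: "Rz (\<lambda>x. c) = (\<lambda>x. 0)"
proof (rule ext, rule vec_eq_iff[THEN iffD2], rule allI)
  fix x i
  have "Rz (\<lambda>x. c) x $ i = (\<Sum>k\<in>{}. riesz_term \<alpha> \<beta> i (\<lambda>x. c) k x)"
    by (intro Rz_nth polynomial_coef(1) real_polynomial_function.intros(2)) (use coef_const in auto)
  then show "Rz (\<lambda>x. c) x $ i = 0 $ i" by simp
qed

lemma has_riesz_transform_Rz:
  assumes f: "real_polynomial_function f"
  shows "has_riesz_transform \<alpha> \<beta> f (Rz f)"
  unfolding has_riesz_transform_def has_L2_sum_def
proof (intro conjI allI ballI)
  show "f \<in> Lp_space \<nu> 2" using f by (intro polynomial_Lp_space) auto
  fix i
  show "riesz_term \<alpha> \<beta> i f k \<in> Lp_space \<nu> 2" for k by (intro continuous_Lp_space continuous_riesz_term) auto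
  show "(\<lambda>x. Rz f x $ i) \<in> Lp_space \<nu> 2"
    by (intro continuous_Lp_space continuous_intros continuous_Rz) auto
  let ?S = "{k. coef f k \<noteq> 0 \<and> k \<noteq> 0}"
  have fin: "finite ?S" using polynomial_coef(1)[OF f] by (rule rev_finite_subset) auto
  have "\<forall>\<^sub>F F in finite_subsets_at_top {k. k \<noteq> 0}. Lp_norm \<nu> 2 (\<lambda>x. (\<Sum>k\<in>F. riesz_term \<alpha> \<beta> i f k x) - Rz f x $ i) = 0"
    unfolding eventually_finite_subsets_at_top
    using fin by (intro exI[of _ ?S]) (auto simp: Rz_nth polynomial_coef(1)[OF f] Lp_norm_def)
  then show "((\<lambda>F. Lp_norm \<nu> 2 (\<lambda>x. (\<Sum>k\<in>F. riesz_term \<alpha> \<beta> i f k x) - Rz f x $ i)) \<longlongrightarrow> 0) (finite_subsets_at_top {k. k \<noteq> 0})"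
    by (rule tendsto_eventually)
qed

text \<open>For a polynomial the partial sums equal \<open>Rz f\<close> as soon as the index set
  contains the nonzero indices of the support. The distances in the definition are therefore
  eventually constant, and a constant tending to 0 is 0.\<close>

lemma has_riesz_transform_unique:
  assumes f: "real_polynomial_function f" and g: "has_riesz_transform \<alpha> \<beta> f g"
  shows "AE x in \<nu>. g x = Rz f x"
proof -
  have "AE x in \<nu>. g x $ i = Rz f x $ i" for i
  proof -
    let ?S = "{k. coef f k \<noteq> 0 \<and> k \<noteq> 0}"
    have fin: "finite ?S" using polynomial_coef(1)[OF f] by (rule rev_finite_subset) auto
    let ?N = "Lp_norm \<nu> 2 (\<lambda>x. Rz f x $ i - g x $ i)"
    have L: "((\<lambda>F. Lp_norm \<nu> 2 (\<lambda>x. (\<Sum>k\<in>F. riesz_term \<alpha> \<beta> i f k x) - g x $ i)) \<longlongrightarrow> 0) (finite_subsets_at_top {k. k \<noteq> 0})"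
      and g2: "(\<lambda>x. g x $ i) \<in> Lp_space \<nu> 2"
      using g unfolding has_riesz_transform_def has_L2_sum_def by auto
    have ev: "\<forall>\<^sub>F F in finite_subsets_at_top {k. k \<noteq> 0}. Lp_norm \<nu> 2 (\<lambda>x. (\<Sum>k\<in>F. riesz_term \<alpha> \<beta> i f k x) - g x $ i) = ?N"
      unfolding eventually_finite_subsets_at_top
      using fin by (intro exI[of _ ?S]) (auto simp: Rz_nth polynomial_coef(1)[OF f])
    have "((\<lambda>F. ?N) \<longlongrightarrow> 0) (finite_subsets_at_top {k :: nat ^ 'n. k \<noteq> 0})"
      by (rule Lim_transform_eventually[OF L ev])
    then have "?N = 0" by (simp add: tendsto_const_iff)
    then have "(\<integral>x. (Rz f x $ i - g x $ i)\<^sup>2 \<partial>\<nu>) = 0" by (simp add: Lp_norm_2)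
    moreover have "(\<lambda>x. Rz f x $ i - g x $ i) \<in> Lp_space \<nu> 2"
      by (intro Lp_space_diff g2 continuous_Lp_space continuous_intros continuous_Rz) auto
    then have "integrable \<nu> (\<lambda>x. (Rz f x $ i - g x $ i)\<^sup>2)" by (simp add: Lp_space_def)
    ultimately have "AE x in \<nu>. (Rz f x $ i - g x $ i)\<^sup>2 = 0"
      by (subst (asm) integral_nonneg_eq_0_iff_AE) auto
    then show ?thesis by eventually_elim simp
  qed
  then have "AE x in \<nu>. \<forall>i. g x $ i = Rz f x $ i" by (simp add: AE_all_countable)
  then show ?thesis by (simp add: vec_eq_iff)
qed

section \<open>Test fields and the dual pairing\<close>

lemma pd_basis_0: "tensor (pd i (basis_polys 0)) x = 0"
proof -
  have "pderiv (basis_polys 0 i) = 0"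
    using degree_Npoly[OF \<alpha> \<beta>, of i i 0] by (simp add: basis_polys_def pderiv_eq_0_iff)
  then show ?thesis by (simp add: pd_def tensor_upd)
qed

lemma polynomial_eq_pd_sum:
  assumes h: "real_polynomial_function h"
  shows "\<exists>F d. finite F \<and> 0 \<notin> F \<and> (\<forall>x. h x = (\<Sum>k\<in>F. d k * tensor (pd i (basis_polys k)) x))"
proof -
  obtain G e where G: "finite G" "h = (\<lambda>x. \<Sum>k\<in>G. e k * tensor (basis_polys k) x)"
    using polynomial_jspan[OF h] by (auto simp: jspan_def)
  have "\<forall>k. \<exists>q. pderiv q = basis_polys k i" using poly_antiderivative by blast
  then obtain Q where Q: "\<And>k. pderiv (Q k) = basis_polys k i" by metis
  define H where "H = (\<lambda>x. \<Sum>k\<in>G. e k * tensor ((basis_polys k)(i := Q k)) x)"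
  have "H \<in> jspan" unfolding H_def by (intro jspan_sum G jspan_scale jspan_tensor_upd)
  then obtain F d where F: "finite F" "H = (\<lambda>x. \<Sum>k\<in>F. d k * tensor (basis_polys k) x)"
    by (auto simp: jspan_def)
  have pQ: "pd i ((basis_polys k)(i := Q k)) = basis_polys k" for k by (auto simp: pd_def Q fun_eq_iff)
  have "h x = (\<Sum>k\<in>F. d k * tensor (pd i (basis_polys k)) x)" for x
  proof -
    have "((\<lambda>s. H (upd x i s)) has_real_derivative h (upd x i (x $ i))) (at (x $ i))"
      unfolding H_def G(2)
      using DERIV_tensor[of "(basis_polys k)(i := Q k)" x i "x $ i" for k, unfolded pQ]
      by (intro DERIV_sum DERIV_cmult)
    moreover have "((\<lambda>s. H (upd x i s)) has_real_derivative (\<Sum>k\<in>F. d k * tensor (pd i (basis_polys k)) (upd x i (x $ i)))) (at (x $ i))"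
      unfolding F(2) by (intro DERIV_sum DERIV_cmult DERIV_tensor)
    ultimately show ?thesis using DERIV_unique by fastforce
  qed
  moreover have "(\<Sum>k\<in>F. d k * tensor (pd i (basis_polys k)) x) = (\<Sum>k\<in>F - {0}. d k * tensor (pd i (basis_polys k)) x)" for x
    by (intro sum.mono_neutral_right F) (auto simp: pd_basis_0)
  ultimately show ?thesis using F(1) by (intro exI[of _ "F - {0}"] exI[of _ d]) auto
qed

lemma integral_pd_sums:
  assumes "finite F"
  shows "(\<integral>x. (1 - (x $ i)\<^sup>2) * (\<Sum>k\<in>F. a k * tensor (pd i (basis_polys k)) x) * (\<Sum>k\<in>F. b k * tensor (pd i (basis_polys k)) x) \<partial>\<nu>)
    = (\<Sum>k\<in>F. a k * b k * eigen1 i k)"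
proof -
  have int: "integrable \<nu> (\<lambda>x. (1 - (x $ i)\<^sup>2) * tensor (pd i (basis_polys k)) x * tensor (pd i (basis_polys l)) x)" for k l
    by (intro continuous_integrable_\<nu> continuous_intros)
  have "(1 - (x $ i)\<^sup>2) * (\<Sum>k\<in>F. a k * tensor (pd i (basis_polys k)) x) * (\<Sum>k\<in>F. b k * tensor (pd i (basis_polys k)) x)
     = (\<Sum>k\<in>F. \<Sum>l\<in>F. a k * b l * ((1 - (x $ i)\<^sup>2) * tensor (pd i (basis_polys k)) x * tensor (pd i (basis_polys l)) x))" for x
  proof -
    have "(\<Sum>k\<in>F. a k * tensor (pd i (basis_polys k)) x) * (\<Sum>k\<in>F. b k * tensor (pd i (basis_polys k)) x)
      = (\<Sum>k\<in>F. \<Sum>l\<in>F. (a k * tensor (pd i (basis_polys k)) x) * (b l * tensor (pd i (basis_polys l)) x))"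
      by (rule sum_product)
    then have "(1 - (x $ i)\<^sup>2) * (\<Sum>k\<in>F. a k * tensor (pd i (basis_polys k)) x) * (\<Sum>k\<in>F. b k * tensor (pd i (basis_polys k)) x)
      = (1 - (x $ i)\<^sup>2) * (\<Sum>k\<in>F. \<Sum>l\<in>F. (a k * tensor (pd i (basis_polys k)) x) * (b l * tensor (pd i (basis_polys l)) x))"
      by (simp only: mult.assoc)
    then show ?thesis unfolding sum_distrib_left by (rule trans) (intro sum.cong refl, simp add: algebra_simps)
  qed
  then have "(\<integral>x. (1 - (x $ i)\<^sup>2) * (\<Sum>k\<in>F. a k * tensor (pd i (basis_polys k)) x) * (\<Sum>k\<in>F. b k * tensor (pd i (basis_polys k)) x) \<partial>\<nu>)
     = (\<Sum>k\<in>F. \<Sum>l\<in>F. a k * b l * (if k = l then eigen1 i k else 0))"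
    by (simp add: Bochner_Integration.integral_sum int basis_gradient_orthogonal del: mult_eq_0_iff)
  also have "\<dots> = (\<Sum>k\<in>F. \<Sum>l\<in>F. if k = l then a k * b k * eigen1 i k else 0)"
    by (intro sum.cong refl) auto
  also have "\<dots> = (\<Sum>k\<in>F. a k * b k * eigen1 i k)" using assms by (simp add: sum.delta')
  finally show ?thesis .
qed

text \<open>The i-th Riesz transform stripped of its factor sqrt(1 - x_i^2). What is left is a
  polynomial, and so is the square length of R f built from it in
  \<open>riesz_square\<close>.\<close>

definition riesz_poly :: "(real ^ 'n \<Rightarrow> real) \<Rightarrow> 'n \<Rightarrow> real ^ 'n \<Rightarrow> real" where
  "riesz_poly f i x = (\<Sum>k | coef f k \<noteq> 0. coef f k / rt k * tensor (pd i (basis_polys k)) x)"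

definition riesz_square :: "(real ^ 'n \<Rightarrow> real) \<Rightarrow> real ^ 'n \<Rightarrow> real" where
  "riesz_square f x = (\<Sum>i\<in>UNIV. (1 - (x $ i)\<^sup>2) * (riesz_poly f i x)\<^sup>2)"

lemma real_polynomial_function_coordinate: "real_polynomial_function (\<lambda>x::real^'n. x $ i)"
  by (intro real_polynomial_function.intros(1) bounded_linear_vec_nth)

lemma polynomial_tensor: "real_polynomial_function (tensor (pd i (basis_polys k)))"
  unfolding pd_def using jspan_polynomial jspan_tensor_upd by blast

lemma polynomial_riesz_poly:
  assumes "real_polynomial_function f" shows "real_polynomial_function (riesz_poly f i)"
  unfolding riesz_poly_def[abs_def]
  by (rule real_polynomial_function_sum[OF polynomial_coef(1)[OF assms]])
    (rule real_polynomial_function.intros(4)[OF real_polynomial_function.intros(2) polynomial_tensor])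

lemma polynomial_riesz_square:
  assumes "real_polynomial_function f" shows "real_polynomial_function (riesz_square f)"
  unfolding riesz_square_def[abs_def]
  by (rule real_polynomial_function_sum, simp, rule real_polynomial_function.intros(4))
    (rule real_polynomial_function_diff[OF real_polynomial_function.intros(2)] real_polynomial_function_power
      real_polynomial_function_coordinate polynomial_riesz_poly assms)+

lemma norm_Rz:
  assumes "x \<in> open_cube"
  shows "norm (Rz f x) = sqrt (riesz_square f x)" and "riesz_square f x \<ge> 0"
proof -
  have c: "1 - (x $ i)\<^sup>2 \<ge> 0" for i
  proof -
    have "\<bar>x $ i\<bar> \<le> 1" using assms by (simp add: open_cube_def abs_le_iff minus_le_iff less_imp_le)
    then show ?thesis by (simp add: abs_square_le_1)
  qed
  have "Rz f x $ i = sqrt (1 - (x $ i)\<^sup>2) * riesz_poly f i x" for i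
    by (simp add: Rz_def riesz_term_eq riesz_poly_def sum_distrib_left algebra_simps)
  then have "(norm (Rz f x $ i))\<^sup>2 = (1 - (x $ i)\<^sup>2) * (riesz_poly f i x)\<^sup>2" for i
    using c[of i] by (simp add: power_mult_distrib)
  then show "norm (Rz f x) = sqrt (riesz_square f x)"
    by (simp add: norm_vec_def L2_set_def riesz_square_def)
  show "riesz_square f x \<ge> 0" unfolding riesz_square_def using c by (intro sum_nonneg mult_nonneg_nonneg) auto
qed

text \<open>The test field is g = W(G) R f with G = |R f|^2. Its i-th component is sqrt(1 - x_i^2)
  times a polynomial, so it is \<delta>_i of a polynomial; the pairing with R f is \<integral> W(G)
  G and |g|^2 = W(G)^2 G. The components have separate expansions, which are padded with zeros to a
  common index set \<open>F\<close> containing the support of f.\<close>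

lemma riesz_pairing:
  assumes f: "real_polynomial_function f" "coef f 0 = 0" and W: "real_polynomial_function (W :: real \<Rightarrow> real)"
    and m: "0 < m" "m \<le> 1" and e: "e > 0"
  defines "G \<equiv> riesz_square f"
  shows "m * (\<integral>x. W (G x) * G x \<partial>\<nu>) \<le> (\<integral>x. bell m ((f x)\<^sup>2 + e) ((W (G x))\<^sup>2 * G x + e) \<partial>\<nu>)"
    and "m * (\<integral>x. W (G x) * G x \<partial>\<nu>) \<le> (\<integral>x. bell m ((W (G x))\<^sup>2 * G x + e) ((f x)\<^sup>2 + e) \<partial>\<nu>)"
proof -
  have WG: "real_polynomial_function (\<lambda>x. W (G x))"
    using real_polynomial_function_compose[OF _ W, of G] polynomial_riesz_square[OF f(1)]
    by (simp add: G_def o_def real_polynomial_function_eq)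
  define h where "h = (\<lambda>i x. W (G x) * riesz_poly f i x)"
  have "\<forall>i. \<exists>F d. finite F \<and> 0 \<notin> F \<and> (\<forall>x. h i x = (\<Sum>k\<in>F. d k * tensor (pd i (basis_polys k)) x))"
    unfolding h_def
    by (intro allI polynomial_eq_pd_sum real_polynomial_function.intros(4)[OF WG polynomial_riesz_poly[OF f(1)]])
  from choice[OF this] obtain Fi where
    "\<forall>i. \<exists>d. finite (Fi i) \<and> 0 \<notin> Fi i \<and> (\<forall>x. h i x = (\<Sum>k\<in>Fi i. d k * tensor (pd i (basis_polys k)) x))" by blast
  from choice[OF this] obtain di where Fi: "\<And>i. finite (Fi i)" "\<And>i. 0 \<notin> Fi i"
    "\<And>i x. h i x = (\<Sum>k\<in>Fi i. di i k * tensor (pd i (basis_polys k)) x)" by blast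
  let ?S = "{k. coef f k \<noteq> 0}"
  define F where "F = ?S \<union> (\<Union>i. Fi i)"
  define d where "d = (\<lambda>i k. if k \<in> Fi i then di i k else 0)"
  have F: "finite F" "0 \<notin> F" using polynomial_coef(1)[OF f(1)] Fi f(2) by (auto simp: F_def)
  have hF: "h i x = (\<Sum>k\<in>F. d i k * tensor (pd i (basis_polys k)) x)" for i x
    unfolding Fi(3) d_def by (intro sum.mono_neutral_cong_left F) (auto simp: F_def)
  have fF: "f x = (\<Sum>k\<in>F. coef f k * tensor (basis_polys k) x)" for x
    by (intro polynomial_coef f F) (auto simp: F_def)
  have qF: "riesz_poly f i x = (\<Sum>k\<in>F. coef f k / rt k * tensor (pd i (basis_polys k)) x)" for i x
    unfolding riesz_poly_def by (intro sum.mono_neutral_left F) (auto simp: F_def)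
  have ZG: "(\<Sum>j\<in>UNIV. (1 - (x $ j)\<^sup>2) * (\<Sum>k\<in>F. d j k * tensor (pd j (basis_polys k)) x)\<^sup>2) = (W (G x))\<^sup>2 * G x" for x
    unfolding hF[symmetric] h_def G_def riesz_square_def sum_distrib_left
    by (intro sum.cong refl) (simp add: power_mult_distrib)
  have S: "(\<integral>x. W (G x) * G x \<partial>\<nu>) = (\<Sum>i\<in>UNIV. \<Sum>k\<in>F. coef f k * d i k * eigen1 i k / rt k)"
  proof -
    have "W (G x) * G x = (\<Sum>i\<in>UNIV. (1 - (x $ i)\<^sup>2) * riesz_poly f i x * h i x)" for x
      unfolding h_def G_def riesz_square_def sum_distrib_left by (intro sum.cong refl) (simp add: power2_eq_square)
    then have "(\<integral>x. W (G x) * G x \<partial>\<nu>) = (\<Sum>i\<in>UNIV. \<integral>x. (1 - (x $ i)\<^sup>2) * riesz_poly f i x * h i x \<partial>\<nu>)"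
      by (simp only:, subst Bochner_Integration.integral_sum)
        (auto simp: h_def intro!: continuous_integrable_\<nu> continuous_intros
          real_polynomial_function_continuous[OF WG] real_polynomial_function_continuous[OF polynomial_riesz_poly[OF f(1)]])
    also have "\<dots> = (\<Sum>i\<in>UNIV. \<Sum>k\<in>F. coef f k / rt k * d i k * eigen1 i k)"
      unfolding qF hF integral_pd_sums[OF F(1)] ..
    finally show ?thesis by simp
  qed
  from poisson_bilinear_estimate[OF F m e, of "coef f" d]
  show "m * (\<integral>x. W (G x) * G x \<partial>\<nu>) \<le> (\<integral>x. bell m ((f x)\<^sup>2 + e) ((W (G x))\<^sup>2 * G x + e) \<partial>\<nu>)"
    and "m * (\<integral>x. W (G x) * G x \<partial>\<nu>) \<le> (\<integral>x. bell m ((W (G x))\<^sup>2 * G x + e) ((f x)\<^sup>2 + e) \<partial>\<nu>)"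
    unfolding S ZG fF[symmetric] by auto
qed

lemma dominated_limit_\<nu>:
  fixes s :: "nat \<Rightarrow> real ^ 'n \<Rightarrow> real" and g :: "real ^ 'n \<Rightarrow> real"
  assumes "\<And>n. s n \<in> borel_measurable \<nu>" "g \<in> borel_measurable \<nu>"
    and "\<And>x. x \<in> open_cube \<Longrightarrow> (\<lambda>n. s n x) \<longlonglongrightarrow> g x"
    and "\<And>n x. x \<in> open_cube \<Longrightarrow> \<bar>s n x\<bar> \<le> B"
  shows "(\<lambda>n. \<integral>x. s n x \<partial>\<nu>) \<longlonglongrightarrow> (\<integral>x. g x \<partial>\<nu>)"
  by (rule integral_dominated_convergence[where w = "\<lambda>_. B"]) (use assms in \<open>auto simp: space_\<nu> intro!: AE_I2\<close>)

lemma regularized_power_limit: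
  fixes g :: "real ^ 'n \<Rightarrow> real"
  assumes g: "continuous_on UNIV g" and nn: "\<And>x. x \<in> open_cube \<Longrightarrow> g x \<ge> 0" and r: "r > 0"
  shows "(\<lambda>n. \<integral>x. (g x + inverse (real (Suc n))) powr r \<partial>\<nu>) \<longlonglongrightarrow> (\<integral>x. g x powr r \<partial>\<nu>)"
proof -
  have [measurable]: "g \<in> borel_measurable \<nu>" by (rule continuous_measurable_\<nu>[OF g])
  obtain B where B: "\<And>x. x \<in> open_cube \<Longrightarrow> \<bar>g x\<bar> \<le> B" using bounded_on_cube[OF g] by blast
  show ?thesis
  proof (rule dominated_limit_\<nu>)
    fix x :: "real ^ 'n" assume x: "x \<in> open_cube"
    have "(\<lambda>n. g x + inverse (real (Suc n))) \<longlonglongrightarrow> g x + 0"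
      by (intro tendsto_add tendsto_const LIMSEQ_inverse_real_of_nat)
    then show "(\<lambda>n. (g x + inverse (real (Suc n))) powr r) \<longlonglongrightarrow> g x powr r"
      using nn[OF x] r by (intro tendsto_powr2[OF _ tendsto_const]) (auto simp: add_nonneg_nonneg)
    fix n
    have "inverse (real (Suc n)) \<le> 1" by (simp add: inverse_eq_divide)
    then have "g x + inverse (real (Suc n)) \<le> B + 1" using B[OF x] by linarith
    moreover have "0 \<le> g x + inverse (real (Suc n))" using nn[OF x] by (intro add_nonneg_nonneg) auto
    ultimately show "\<bar>(g x + inverse (real (Suc n))) powr r\<bar> \<le> (B + 1) powr r"
      using r by (simp add: powr_mono2)
  qed auto
qed

text \<open>For p \<ge> 2 one has m = 1 / (p - 1), so that P = p and Q = q; for p < 2 one has m = p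
  - 1, so that P = q and Q = p, and f moves to the second argument of \<open>bell\<close>. This is
  why \<open>K\<close>, the constant in front of f, is 3 in one case and 18 in the other. The
  regularization e tends to 0 along 1 / (n + 1).\<close>

lemma riesz_pairing_powers:
  assumes f: "real_polynomial_function f" "coef f 0 = 0" and W: "real_polynomial_function (W :: real \<Rightarrow> real)"
    and p: "p > 1" and q: "q = p / (p - 1)" and m: "m = 1 / (max p q - 1)"
  defines "G \<equiv> riesz_square f" and "K \<equiv> if p \<ge> 2 then 3 else (18::real)"
  shows "m * (\<integral>x. W (G x) * G x \<partial>\<nu>)
      \<le> K * (\<integral>x. \<bar>f x\<bar> powr p \<partial>\<nu>) + (21 - K) * (\<integral>x. ((W (G x))\<^sup>2 * G x) powr (q / 2) \<partial>\<nu>)"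
proof -
  let ?e = "\<lambda>n. inverse (real (Suc n))"
  have WG: "real_polynomial_function (\<lambda>x. W (G x))"
    using real_polynomial_function_compose[OF _ W, of G] polynomial_riesz_square[OF f(1)]
    by (simp add: G_def o_def real_polynomial_function_eq)
  define Y where "Y = (\<lambda>x. (f x)\<^sup>2)"
  define Z where "Z = (\<lambda>x. (W (G x))\<^sup>2 * G x)"
  have cG: "continuous_on UNIV G" unfolding G_def
    by (intro real_polynomial_function_continuous polynomial_riesz_square f)
  have cY: "continuous_on UNIV Y" unfolding Y_def by (intro continuous_intros real_polynomial_function_continuous f)
  have cZ: "continuous_on UNIV Z" unfolding Z_def
    by (intro continuous_intros real_polynomial_function_continuous[OF WG] cG)
  have Y0: "Y x \<ge> 0" for x by (simp add: Y_def)
  have Z0: "Z x \<ge> 0" if "x \<in> open_cube" for x using norm_Rz(2)[OF that, of f] by (simp add: Z_def G_def)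
  have limit: "m * (\<integral>x. W (G x) * G x \<partial>\<nu>) \<le> 3 * (\<integral>x. A x powr r \<partial>\<nu>) + 18 * (\<integral>x. B x powr s \<partial>\<nu>)"
    if A: "continuous_on UNIV A" "\<And>x. x \<in> open_cube \<Longrightarrow> A x \<ge> 0"
      and B: "continuous_on UNIV B" "\<And>x. x \<in> open_cube \<Longrightarrow> B x \<ge> 0"
      and rs: "r = (1 + 1 / m) / 2" "s = (1 + m) / 2" "r > 0" "s > 0" and m: "0 < m" "m \<le> 1"
      and le: "\<And>e. e > 0 \<Longrightarrow> m * (\<integral>x. W (G x) * G x \<partial>\<nu>) \<le> (\<integral>x. bell m (A x + e) (B x + e) \<partial>\<nu>)" for A B r s
  proof (rule LIMSEQ_le_const)
    show "(\<lambda>n. 3 * (\<integral>x. (A x + ?e n) powr r \<partial>\<nu>) + 18 * (\<integral>x. (B x + ?e n) powr s \<partial>\<nu>))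
       \<longlonglongrightarrow> 3 * (\<integral>x. A x powr r \<partial>\<nu>) + 18 * (\<integral>x. B x powr s \<partial>\<nu>)"
      by (intro tendsto_intros regularized_power_limit A B rs)
    have int: "integrable \<nu> (\<lambda>x. (C x + ?e n) powr u)" if C: "continuous_on UNIV C" "\<And>x. x \<in> open_cube \<Longrightarrow> C x \<ge> 0" "u > 0" for C u n
    proof -
      have [measurable]: "C \<in> borel_measurable \<nu>" by (rule continuous_measurable_\<nu>[OF C(1)])
      obtain D where D: "\<And>x. x \<in> open_cube \<Longrightarrow> \<bar>C x\<bar> \<le> D" using bounded_on_cube[OF C(1)] by blast
      show ?thesis
      proof (rule nu.integrable_const_bound[of _ "(D + ?e n) powr u"])
        show "AE x in \<nu>. norm ((C x + ?e n) powr u) \<le> (D + ?e n) powr u"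
        proof (rule AE_I2)
          fix x assume "x \<in> space \<nu>"
          then have x: "x \<in> open_cube" by (simp add: space_\<nu>)
          show "norm ((C x + ?e n) powr u) \<le> (D + ?e n) powr u"
            using C(2)[OF x] D[OF x] C(3) by (auto intro!: powr_mono2 add_nonneg_nonneg)
        qed
      qed measurable
    qed
    have "m * (\<integral>x. W (G x) * G x \<partial>\<nu>) \<le> 3 * (\<integral>x. (A x + ?e n) powr r \<partial>\<nu>) + 18 * (\<integral>x. (B x + ?e n) powr s \<partial>\<nu>)" for n
    proof -
      have "m * (\<integral>x. W (G x) * G x \<partial>\<nu>) \<le> (\<integral>x. bell m (A x + ?e n) (B x + ?e n) \<partial>\<nu>)" by (rule le) simp
      also have "\<dots> \<le> (\<integral>x. 3 * (A x + ?e n) powr r + 18 * (B x + ?e n) powr s \<partial>\<nu>)"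
      proof (rule integral_mono')
        show "integrable \<nu> (\<lambda>x. 3 * (A x + ?e n) powr r + 18 * (B x + ?e n) powr s)"
          using int[OF A rs(3)] int[OF B rs(4)] by auto
        fix x assume "x \<in> space \<nu>"
        then have x: "x \<in> open_cube" by (simp add: space_\<nu>)
        have pos: "A x + ?e n > 0" "B x + ?e n > 0" using A(2)[OF x] B(2)[OF x] by (auto intro!: add_nonneg_pos)
        show "bell m (A x + ?e n) (B x + ?e n) \<le> 3 * (A x + ?e n) powr r + 18 * (B x + ?e n) powr s"
          unfolding rs(1,2) by (rule bell_le[OF pos m])
        show "0 \<le> 3 * (A x + ?e n) powr r + 18 * (B x + ?e n) powr s" by simp
      qed
      finally show ?thesis using int[OF A rs(3)] int[OF B rs(4)] by simp
    qed
    then show "\<exists>N. \<forall>n\<ge>N. m * (\<integral>x. W (G x) * G x \<partial>\<nu>) \<le> 3 * (\<integral>x. (A x + ?e n) powr r \<partial>\<nu>) + 18 * (\<integral>x. (B x + ?e n) powr s \<partial>\<nu>)"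
      by blast
  qed
  have Yp: "(\<integral>x. Y x powr (p / 2) \<partial>\<nu>) = (\<integral>x. \<bar>f x\<bar> powr p \<partial>\<nu>)" by (simp add: Y_def square_powr_half)
  show ?thesis
  proof (cases "p \<ge> 2")
    case True
    have "q \<le> p"
    proof -
      have "p \<le> p * (p - 1)" using True by simp
      then show ?thesis using p by (simp add: q field_simps)
    qed
    then have m': "m = 1 / (p - 1)" by (simp add: m max_def)
    have m1: "0 < m" "m \<le> 1" using True by (auto simp: m')
    have "p / 2 = (1 + 1 / m) / 2" "q / 2 = (1 + m) / 2" using p by (auto simp: m' q field_simps)
    from limit[OF cY Y0 cZ Z0 this _ _ m1]
    have "m * (\<integral>x. W (G x) * G x \<partial>\<nu>) \<le> 3 * (\<integral>x. Y x powr (p / 2) \<partial>\<nu>) + 18 * (\<integral>x. Z x powr (q / 2) \<partial>\<nu>)"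
      using riesz_pairing(1)[OF f W m1] p by (simp add: Y_def Z_def G_def q)
    then show ?thesis using True unfolding Yp Z_def K_def by simp
  next
    case False
    have "p \<le> q"
    proof -
      have "p * (p - 1) \<le> p * 1" using False p by (intro mult_left_mono) auto
      then show ?thesis using p by (simp add: q field_simps)
    qed
    then have m': "m = p - 1" using p by (simp add: m max_def q field_simps)
    have m1: "0 < m" "m \<le> 1" using False p by (auto simp: m')
    have "q / 2 = (1 + 1 / m) / 2" "p / 2 = (1 + m) / 2" using p by (auto simp: m' q field_simps)
    from limit[OF cZ Z0 cY Y0 this _ _ m1]
    have "m * (\<integral>x. W (G x) * G x \<partial>\<nu>) \<le> 3 * (\<integral>x. Z x powr (q / 2) \<partial>\<nu>) + 18 * (\<integral>x. Y x powr (p / 2) \<partial>\<nu>)"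
      using riesz_pairing(2)[OF f W m1] p by (simp add: Y_def Z_def G_def q)
    then show ?thesis using False unfolding Yp Z_def K_def by simp
  qed
qed

text \<open>
  Duality: the optimal test function is \<open>|R f|\<^sup>p\<^sup>-\<^sup>2 R f\<close>, where \<open>|R f|\<^sup>2 = G\<close> is a polynomial, so that
  \<open>G powr ((p - 2) / 2)\<close> is approximated by polynomials in \<open>G\<close>.
\<close>

lemma riesz_duality:
  assumes f: "real_polynomial_function f" "coef f 0 = 0"
    and p: "p > 1" and q: "q = p / (p - 1)" and m: "m = 1 / (max p q - 1)"
    and l: "l > 0"
  defines "G \<equiv> riesz_square f" and "K1 \<equiv> if p \<ge> 2 then 3 else (18::real)"
  shows "m * l * (\<integral>x. G x powr (p / 2) \<partial>\<nu>)
      \<le> K1 * (\<integral>x. \<bar>f x\<bar> powr p \<partial>\<nu>) + (21 - K1) * l powr q * (\<integral>x. G x powr (p / 2) \<partial>\<nu>)"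
proof -
  let ?e = "\<lambda>n. inverse (real (Suc n))"
  have q1: "q > 1" using p by (simp add: q field_simps)
  have cG: "continuous_on UNIV G" unfolding G_def
    by (intro real_polynomial_function_continuous polynomial_riesz_square f)
  have Gm [measurable]: "G \<in> borel_measurable \<nu>" by (rule continuous_measurable_\<nu>[OF cG])
  have G0: "G x \<ge> 0" if "x \<in> open_cube" for x using norm_Rz(2)[OF that, of f] by (simp add: G_def)
  obtain M where M: "\<And>x. x \<in> open_cube \<Longrightarrow> \<bar>G x\<bar> \<le> M" using bounded_on_cube[OF cG] by blast
  \<comment> \<open>The shift by 1 / (n + 1) makes the power continuous at 0 also when p < 2, so
    that it can be approximated uniformly on [0, M].\<close>
  define T where "T = (\<lambda>n y. l * (y + ?e n) powr ((p - 2) / 2))"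
  have "\<forall>n. \<exists>w. real_polynomial_function w \<and> (\<forall>y\<in>{0..M}. \<bar>T n y - w y\<bar> < ?e n)"
  proof
    fix n
    have nz: "\<forall>y\<in>{0..M}. y + ?e n \<noteq> 0"
    proof
      fix y assume "y \<in> {0..M}"
      then have "y + ?e n > 0" by (intro add_nonneg_pos) auto
      then show "y + ?e n \<noteq> 0" by simp
    qed
    have "continuous_on {0..M} (T n)" unfolding T_def by (intro continuous_intros nz)
    then show "\<exists>w. real_polynomial_function w \<and> (\<forall>y\<in>{0..M}. \<bar>T n y - w y\<bar> < ?e n)"
    proof (rule Stone_Weierstrass_real_polynomial_function[OF compact_Icc])
      fix w assume "real_polynomial_function w" "\<And>y. y \<in> {0..M} \<Longrightarrow> \<bar>T n y - w y\<bar> < ?e n"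
      then show ?thesis by blast
    qed simp
  qed
  from choice[OF this] obtain W
    where W': "\<forall>n. real_polynomial_function (W n) \<and> (\<forall>y\<in>{0..M}. \<bar>T n y - W n y\<bar> < ?e n)" ..
  have W: "real_polynomial_function (W n)" for n by (rule conjunct1[OF spec[OF W']])
  have TW: "\<bar>T n y - W n y\<bar> < ?e n" if "0 \<le> y" "y \<le> M" for n y
  proof -
    have "y \<in> {0..M}" using that by (simp only: atLeastAtMost_iff)
    with conjunct2[OF spec[OF W', of n]] show ?thesis by (rule bspec)
  qed
  have Wm [measurable]: "W n \<in> borel_measurable borel" for n
    by (intro borel_measurable_continuous_onI real_polynomial_function_continuous W)
  \<comment> \<open>Up to sign this is the length of the test field as a function of y = |R f|^2.
    The factor sqrt y compensates the singularity of y^((p-2)/2) for p < 2, so that \<open>a\<close>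
    is bounded uniformly in n, whereas \<open>W\<close> need not be.\<close>
  define a where "a = (\<lambda>n y. W n y * sqrt y)"
  define B where "B = l * (M + 1) powr ((p - 1) / 2) + sqrt M"
  have e1: "?e n \<le> 1" for n by (simp add: inverse_eq_divide)
  have aB: "\<bar>a n y\<bar> \<le> B" if y: "0 \<le> y" "y \<le> M" for n y
  proof -
    have "T n y * sqrt y \<le> T n y * sqrt (y + ?e n)" using y l by (intro mult_left_mono) (auto simp: T_def)
    also have "\<dots> = l * (y + ?e n) powr ((p - 1) / 2)"
    proof -
      have "y + ?e n > 0" using y by (intro add_nonneg_pos) auto
      then show ?thesis by (simp add: T_def powr_half_sqrt[symmetric] powr_add[symmetric] field_simps)
    qed
    also have "\<dots> \<le> l * (M + 1) powr ((p - 1) / 2)"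
      using y l p e1[of n] by (intro mult_left_mono powr_mono2 add_mono) (auto intro!: add_nonneg_nonneg)
    finally have 1: "T n y * sqrt y \<le> l * (M + 1) powr ((p - 1) / 2)" .
    have "\<bar>W n y\<bar> \<le> T n y + 1"
    proof -
      have "T n y \<ge> 0" using l by (simp add: T_def)
      then show ?thesis using TW[OF y, of n] e1[of n] by linarith
    qed
    then have "\<bar>W n y\<bar> * sqrt y \<le> (T n y + 1) * sqrt y" using y by (intro mult_right_mono) auto
    also have "\<dots> = T n y * sqrt y + sqrt y" by (simp add: algebra_simps)
    also have "\<dots> \<le> B" using 1 y by (simp add: B_def add_mono)
    finally show ?thesis using y by (simp add: a_def abs_mult)
  qed
  have alim: "(\<lambda>n. a n y) \<longlonglongrightarrow> l * y powr ((p - 1) / 2)" if y: "0 \<le> y" "y \<le> M" for y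
  proof (cases "y = 0")
    case True
    then show ?thesis by (simp add: a_def)
  next
    case False
    then have y0: "y > 0" using y by simp
    have "(\<lambda>n. y + ?e n) \<longlonglongrightarrow> y + 0" by (intro tendsto_add tendsto_const LIMSEQ_inverse_real_of_nat)
    then have "(\<lambda>n. T n y) \<longlonglongrightarrow> l * (y + 0) powr ((p - 2) / 2)"
      unfolding T_def using y0 by (intro tendsto_mult tendsto_const tendsto_powr) auto
    moreover have "(\<lambda>n. W n y - T n y) \<longlonglongrightarrow> 0"
    proof (rule Lim_null_comparison)
      show "\<forall>\<^sub>F n in sequentially. norm (W n y - T n y) \<le> ?e n"
        using TW[OF y] by (intro always_eventually allI) (simp add: abs_minus_commute less_imp_le)
    qed (rule LIMSEQ_inverse_real_of_nat)
    ultimately have "(\<lambda>n. (W n y - T n y) + T n y) \<longlonglongrightarrow> 0 + l * (y + 0) powr ((p - 2) / 2)" by (rule tendsto_add[rotated])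
    then have "(\<lambda>n. W n y * sqrt y) \<longlonglongrightarrow> l * y powr ((p - 2) / 2) * sqrt y"
      by (intro tendsto_mult tendsto_const) simp
    also have "l * y powr ((p - 2) / 2) * sqrt y = l * y powr ((p - 1) / 2)"
      using y0 by (simp add: powr_half_sqrt[symmetric] powr_add[symmetric] field_simps)
    finally show ?thesis by (simp add: a_def)
  qed
  have lim1: "(\<lambda>n. \<integral>x. W n (G x) * G x \<partial>\<nu>) \<longlonglongrightarrow> (\<integral>x. l * G x powr (p / 2) \<partial>\<nu>)"
  proof (rule dominated_limit_\<nu>)
    fix x :: "real ^ 'n" assume x: "x \<in> open_cube"
    have y: "0 \<le> G x" "G x \<le> M" using G0[OF x] M[OF x] by auto
    have e: "W n (G x) * G x = a n (G x) * sqrt (G x)" for n using y by (simp add: a_def)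
    have "(\<lambda>n. a n (G x) * sqrt (G x)) \<longlonglongrightarrow> l * G x powr ((p - 1) / 2) * sqrt (G x)"
      by (intro tendsto_mult tendsto_const alim y)
    also have "l * G x powr ((p - 1) / 2) * sqrt (G x) = l * G x powr (p / 2)"
    proof (cases "G x = 0")
      case False
      then show ?thesis using y by (simp add: powr_half_sqrt[symmetric] powr_add[symmetric] field_simps)
    qed simp
    finally show "(\<lambda>n. W n (G x) * G x) \<longlonglongrightarrow> l * G x powr (p / 2)" unfolding e .
    show "\<bar>W n (G x) * G x\<bar> \<le> B * sqrt M" for n
      unfolding e abs_mult using aB[OF y, of n] y by (intro mult_mono) auto
  qed auto
  have lim2: "(\<lambda>n. \<integral>x. ((W n (G x))\<^sup>2 * G x) powr (q / 2) \<partial>\<nu>) \<longlonglongrightarrow> (\<integral>x. l powr q * G x powr (p / 2) \<partial>\<nu>)"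
  proof (rule dominated_limit_\<nu>)
    fix x :: "real ^ 'n" assume x: "x \<in> open_cube"
    have y: "0 \<le> G x" "G x \<le> M" using G0[OF x] M[OF x] by auto
    have e: "((W n (G x))\<^sup>2 * G x) powr (q / 2) = \<bar>a n (G x)\<bar> powr q" for n
    proof -
      have "(W n (G x))\<^sup>2 * G x = (a n (G x))\<^sup>2" using y by (simp add: a_def power_mult_distrib)
      then show ?thesis by (simp add: square_powr_half)
    qed
    have "(\<lambda>n. \<bar>a n (G x)\<bar> powr q) \<longlonglongrightarrow> \<bar>l * G x powr ((p - 1) / 2)\<bar> powr q"
      using q1 by (intro tendsto_powr2[OF _ tendsto_const] tendsto_rabs alim y) auto
    also have "\<bar>l * G x powr ((p - 1) / 2)\<bar> powr q = l powr q * G x powr (p / 2)"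
    proof -
      have "(p - 1) * q = p" using p by (simp add: q)
      then show ?thesis using l by (simp add: abs_mult powr_mult powr_powr)
    qed
    finally show "(\<lambda>n. ((W n (G x))\<^sup>2 * G x) powr (q / 2)) \<longlonglongrightarrow> l powr q * G x powr (p / 2)" unfolding e .
    show "\<bar>((W n (G x))\<^sup>2 * G x) powr (q / 2)\<bar> \<le> B powr q" for n
      unfolding e using aB[OF y, of n] q1 by (auto intro!: powr_mono2)
  qed auto
  have "m * (\<integral>x. l * G x powr (p / 2) \<partial>\<nu>)
      \<le> K1 * (\<integral>x. \<bar>f x\<bar> powr p \<partial>\<nu>) + (21 - K1) * (\<integral>x. l powr q * G x powr (p / 2) \<partial>\<nu>)"
  proof (rule LIMSEQ_le)
    show "(\<lambda>n. m * (\<integral>x. W n (G x) * G x \<partial>\<nu>)) \<longlonglongrightarrow> m * (\<integral>x. l * G x powr (p / 2) \<partial>\<nu>)"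
      by (intro tendsto_mult tendsto_const lim1)
    show "(\<lambda>n. K1 * (\<integral>x. \<bar>f x\<bar> powr p \<partial>\<nu>) + (21 - K1) * (\<integral>x. ((W n (G x))\<^sup>2 * G x) powr (q / 2) \<partial>\<nu>))
      \<longlonglongrightarrow> K1 * (\<integral>x. \<bar>f x\<bar> powr p \<partial>\<nu>) + (21 - K1) * (\<integral>x. l powr q * G x powr (p / 2) \<partial>\<nu>)"
      by (intro tendsto_add tendsto_mult tendsto_const lim2)
    have "m * (\<integral>x. W n (G x) * G x \<partial>\<nu>) \<le> K1 * (\<integral>x. \<bar>f x\<bar> powr p \<partial>\<nu>) + (21 - K1) * (\<integral>x. ((W n (G x))\<^sup>2 * G x) powr (q / 2) \<partial>\<nu>)" for n
      unfolding G_def K1_def by (rule riesz_pairing_powers[OF f W p q m])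
    then show "\<exists>N. \<forall>n\<ge>N. m * (\<integral>x. W n (G x) * G x \<partial>\<nu>)
       \<le> K1 * (\<integral>x. \<bar>f x\<bar> powr p \<partial>\<nu>) + (21 - K1) * (\<integral>x. ((W n (G x))\<^sup>2 * G x) powr (q / 2) \<partial>\<nu>)" by blast
  qed
  then show ?thesis by (simp add: mult.assoc)
qed

lemma riesz_bound:
  assumes f: "real_polynomial_function f" "(\<integral>x. f x \<partial>\<nu>) = 0" and p: "p > 1"
  shows "Lp_norm \<nu> p (Rz f) \<le> 21 * (max p (p / (p - 1)) - 1) * Lp_norm \<nu> p f"
proof -
  define q where "q = p / (p - 1)"
  define m where "m = 1 / (max p q - 1)"
  have m: "m > 0" using p by (simp add: m_def max_def)
  let ?K = "if p \<ge> 2 then 3 else (18::real)"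
  have N: "(\<integral>x. riesz_square f x powr (p / 2) \<partial>\<nu>) = Lp_norm \<nu> p (Rz f) powr p"
  proof -
    have "riesz_square f x powr (p / 2) = norm (Rz f x) powr p" if "x \<in> open_cube" for x
      using norm_Rz[OF that, of f] by (simp add: powr_half_sqrt[symmetric] powr_powr)
    then have "(\<integral>x. riesz_square f x powr (p / 2) \<partial>\<nu>) = (\<integral>x. norm (Rz f x) powr p \<partial>\<nu>)"
      by (intro Bochner_Integration.integral_cong refl) (simp add: space_\<nu>)
    then show ?thesis using p by (simp add: Lp_norm_powr)
  qed
  have F: "(\<integral>x. \<bar>f x\<bar> powr p \<partial>\<nu>) = Lp_norm \<nu> p f powr p" using p by (simp add: Lp_norm_powr)
  have "Lp_norm \<nu> p (Rz f) \<le> (?K + (21 - ?K)) / m * Lp_norm \<nu> p f"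
  proof (rule optimize_scaling[OF m _ _ Lp_norm_nonneg Lp_norm_nonneg p q_def])
    show "m * l * Lp_norm \<nu> p (Rz f) powr p \<le> ?K * Lp_norm \<nu> p f powr p + (21 - ?K) * l powr q * Lp_norm \<nu> p (Rz f) powr p"
      if "l > 0" for l
      using riesz_duality[OF f(1) _ p q_def m_def that] coef_0_eq_0_iff[of f] f(2) unfolding N F by blast
  qed auto
  then show ?thesis by (simp add: m_def q_def)
qed

section \<open>Passage from polynomials to the whole space\<close>

lemma mean_Lp_norm_diff:
  fixes f h :: "real ^ 'n \<Rightarrow> real"
  assumes p: "p > 1" and f: "f \<in> Lp_space \<nu> p" and h: "h \<in> Lp_space \<nu> p"
  shows "Lp_norm \<nu> p (\<lambda>x. (h x - (\<integral>y. h y \<partial>\<nu>)) - (f x - (\<integral>y. f y \<partial>\<nu>))) \<le> 2 * Lp_norm \<nu> p (\<lambda>x. h x - f x)"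
proof -
  have i: "integrable \<nu> f" "integrable \<nu> h" using nu.Lp_space_integrable[of p f] nu.Lp_space_integrable[of p h] p f h by simp_all
  have d: "(\<lambda>x. h x - f x) \<in> Lp_space \<nu> p" using p f h by (intro Lp_space_diff) auto
  define c where "c = (\<integral>x. h x - f x \<partial>\<nu>)"
  have c: "c = (\<integral>y. h y \<partial>\<nu>) - (\<integral>y. f y \<partial>\<nu>)" unfolding c_def using i by simp
  have cp: "(\<lambda>x. - c) \<in> Lp_space \<nu> p" using p by (intro continuous_Lp_space) auto
  have "Lp_norm \<nu> p (\<lambda>x. (h x - f x) + (- c)) \<le> Lp_norm \<nu> p (\<lambda>x. h x - f x) + Lp_norm \<nu> p (\<lambda>x. - c)"
    using p by (intro Lp_norm_triangle d cp) auto
  also have "Lp_norm \<nu> p (\<lambda>x. - c) = \<bar>c\<bar>" using p by (subst nu.Lp_norm_const) auto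
  also have "\<bar>c\<bar> \<le> Lp_norm \<nu> p (\<lambda>x. h x - f x)" unfolding c_def by (rule nu.abs_integral_le_Lp_norm[OF p d])
  finally show ?thesis by (simp add: c algebra_simps)
qed

text \<open>Constants are annihilated, and subtracting the mean at most doubles the norm, which
  turns 21 into 42. This bound on all polynomials yields the extension; the constant of the theorem
  comes from \<open>riesz_bound\<close>, where the mean is zero.\<close>

lemma Rz_Lp_bound:
  assumes f: "real_polynomial_function f" and p: "p > 1"
  shows "Lp_norm \<nu> p (Rz f) \<le> 42 * (max p (p / (p - 1)) - 1) * Lp_norm \<nu> p f"
proof -
  let ?c = "\<integral>y. f y \<partial>\<nu>"
  have C: "max p (p / (p - 1)) - 1 \<ge> 0" using p by (simp add: max_def)
  have fp: "f \<in> Lp_space \<nu> p" using f p by (intro polynomial_Lp_space) auto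
  have if': "integrable \<nu> f" using p fp by (intro nu.Lp_space_integrable[of p]) auto
  have g: "real_polynomial_function (\<lambda>x. f x - ?c)"
    by (rule real_polynomial_function_diff[OF f real_polynomial_function.intros(2)])
  have "Rz (\<lambda>x. f x - ?c) = Rz f"
    unfolding Rz_diff[OF f real_polynomial_function.intros(2)] Rz_const by simp
  moreover have "(\<integral>x. f x - ?c \<partial>\<nu>) = 0" using if' by (simp add: nu.prob_space)
  ultimately have "Lp_norm \<nu> p (Rz f) \<le> 21 * (max p (p / (p - 1)) - 1) * Lp_norm \<nu> p (\<lambda>x. f x - ?c)"
    using riesz_bound[OF g _ p] by simp
  also have "\<dots> \<le> 21 * (max p (p / (p - 1)) - 1) * (2 * Lp_norm \<nu> p f)"
    using mean_Lp_norm_diff[OF p _ fp, of "\<lambda>x. 0"] p C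
    by (intro mult_left_mono) (auto simp: continuous_Lp_space)
  also have "\<dots> = 42 * (max p (p / (p - 1)) - 1) * Lp_norm \<nu> p f" by (simp add: algebra_simps)
  finally show ?thesis .
qed

lemma polynomial_approx:
  assumes "p > 1" "f \<in> Lp_space \<nu> p" "\<epsilon> > 0"
  obtains h where "real_polynomial_function h" "Lp_norm \<nu> p (\<lambda>x. h x - f x) < \<epsilon>"
proof -
  have "approximable p f" using polynomials_dense[of p f] assms by simp
  then obtain h where h: "real_polynomial_function h" "Lp_norm \<nu> p (\<lambda>x. f x - h x) < \<epsilon>"
    unfolding approximable_def using assms(3) by blast
  from h(2) have "Lp_norm \<nu> p (\<lambda>x. h x - f x) < \<epsilon>" using Lp_norm_minus_commute[of \<nu> p f h] by simp
  with h(1) show ?thesis by (rule that)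
qed

text \<open>The limit is taken almost everywhere along a rapidly convergent sequence of polynomials,
  and Fatou's lemma transfers the Lipschitz estimate to it. Comparing with all polynomials h, rather
  than with the chosen sequence, determines \<open>g\<close> up to null sets and allows different f
  to be compared later.\<close>

lemma riesz_limit_exists:
  assumes p: "p > 1" and f: "f \<in> Lp_space \<nu> p"
  defines "C \<equiv> 42 * (max p (p / (p - 1)) - 1)"
  shows "\<exists>g. g \<in> Lp_space \<nu> p \<and> (\<forall>h. real_polynomial_function h \<longrightarrow>
     Lp_norm \<nu> p (\<lambda>x. Rz h x - g x) \<le> C * Lp_norm \<nu> p (\<lambda>x. h x - f x))"
proof -
  have p1: "p \<ge> 1" "p \<ge> 0" "p > 0" using p by auto
  have C: "C \<ge> 0" using p by (simp add: C_def max_def)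
  have hp: "h \<in> Lp_space \<nu> p" "Rz h \<in> Lp_space \<nu> p" if "real_polynomial_function h" for h
    using p1 that by (auto intro: polynomial_Lp_space continuous_Lp_space_vec continuous_Rz)
  have lip: "Lp_norm \<nu> p (\<lambda>x. Rz h x - Rz k x) \<le> C * Lp_norm \<nu> p (\<lambda>x. h x - k x)"
    if "real_polynomial_function h" "real_polynomial_function k" for h k
    using Rz_Lp_bound[OF real_polynomial_function_diff[OF that] p] unfolding Rz_diff[OF that] C_def .
  \<comment> \<open>Consecutive approximants differ by at most 2 (1/4)^n / (2 C + 1), so their
    images differ by at most 2 C / (2 C + 1) (1/4)^n \<le> (1/4)^n.\<close>
  have "\<exists>h. real_polynomial_function h \<and> Lp_norm \<nu> p (\<lambda>x. h x - f x) < (1 / 4) ^ n / (2 * C + 1)" for n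
    by (rule polynomial_approx[OF p f, of "(1 / 4) ^ n / (2 * C + 1)"]) (use C in auto)
  then obtain s where s: "\<And>n. real_polynomial_function (s n)"
    "\<And>n. Lp_norm \<nu> p (\<lambda>x. s n x - f x) < (1 / 4) ^ n / (2 * C + 1)" by metis
  have fast: "Lp_norm \<nu> p (\<lambda>x. Rz (s (Suc n)) x - Rz (s n) x) \<le> (1 / 4) ^ n" for n
  proof -
    let ?d = "(1 / 4) ^ n / (2 * C + 1)"
    have "Lp_norm \<nu> p (\<lambda>x. s (Suc n) x - s n x) \<le> Lp_norm \<nu> p (\<lambda>x. s (Suc n) x - f x) + Lp_norm \<nu> p (\<lambda>x. f x - s n x)"
      by (intro Lp_norm_triangle_diff p1 hp s f)
    moreover have "Lp_norm \<nu> p (\<lambda>x. s (Suc n) x - f x) \<le> ?d"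
    proof -
      have "(1 / 4 :: real) ^ Suc n / (2 * C + 1) \<le> ?d" using C by (intro divide_right_mono) auto
      then show ?thesis using s(2)[of "Suc n"] by linarith
    qed
    moreover have "Lp_norm \<nu> p (\<lambda>x. f x - s n x) \<le> ?d"
      using s(2)[of n] Lp_norm_minus_commute[of \<nu> p f "s n"] by simp
    ultimately have "Lp_norm \<nu> p (\<lambda>x. s (Suc n) x - s n x) \<le> 2 * ?d" by linarith
    then have "C * Lp_norm \<nu> p (\<lambda>x. s (Suc n) x - s n x) \<le> C * (2 * ?d)" using C by (intro mult_left_mono)
    also have "\<dots> = (2 * C / (2 * C + 1)) * (1 / 4) ^ n" by simp
    also have "\<dots> \<le> 1 * (1 / 4) ^ n" using C by (intro mult_right_mono) auto
    finally show ?thesis using lip[OF s(1) s(1), of "Suc n" n] by simp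
  qed
  obtain g where g: "g \<in> borel_measurable \<nu>" "AE x in \<nu>. (\<lambda>n. Rz (s n) x) \<longlonglongrightarrow> g x"
    using Lp_fast_Cauchy_convergent[of p "\<lambda>n. Rz (s n)", OF p1(1) hp(2)[OF s(1)] fast] by blast
  have slim: "(\<lambda>n. Lp_norm \<nu> p (\<lambda>x. f x - s n x)) \<longlonglongrightarrow> 0"
  proof (rule Lim_null_comparison)
    show "\<forall>\<^sub>F n in sequentially. norm (Lp_norm \<nu> p (\<lambda>x. f x - s n x)) \<le> (1 / 4) ^ n / (2 * C + 1)"
    proof (intro always_eventually allI)
      fix n
      show "norm (Lp_norm \<nu> p (\<lambda>x. f x - s n x)) \<le> (1 / 4) ^ n / (2 * C + 1)"
        using s(2)[of n] Lp_norm_minus_commute[of \<nu> p f "s n"] Lp_norm_nonneg[of \<nu> p "\<lambda>x. f x - s n x"] by simp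
    qed
    have "(\<lambda>n. (1 / 4 :: real) ^ n / (2 * C + 1)) \<longlonglongrightarrow> 0 / (2 * C + 1)"
      using C by (intro tendsto_divide tendsto_const LIMSEQ_power_zero) auto
    then show "(\<lambda>n. (1 / 4 :: real) ^ n / (2 * C + 1)) \<longlonglongrightarrow> 0" by simp
  qed
  have main: "(\<lambda>x. Rz h x - g x) \<in> Lp_space \<nu> p"
    "Lp_norm \<nu> p (\<lambda>x. Rz h x - g x) \<le> C * (Lp_norm \<nu> p (\<lambda>x. h x - f x) + 0)" if h: "real_polynomial_function h" for h
  proof -
    have Rm: "Rz h \<in> borel_measurable \<nu>" using hp(2)[OF h] by (simp add: Lp_space_def)
    have m: "(\<lambda>x. Rz h x - g x) \<in> borel_measurable \<nu>" by (rule borel_measurable_diff[OF Rm g(1)])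
    have lim: "AE x in \<nu>. (\<lambda>n. Rz h x - Rz (s n) x) \<longlonglongrightarrow> Rz h x - g x"
      using g(2) by eventually_elim (intro tendsto_diff tendsto_const)
    have c: "(\<lambda>n. C * (Lp_norm \<nu> p (\<lambda>x. h x - f x) + Lp_norm \<nu> p (\<lambda>x. f x - s n x))) \<longlonglongrightarrow> C * (Lp_norm \<nu> p (\<lambda>x. h x - f x) + 0)"
      by (intro tendsto_mult tendsto_add tendsto_const slim)
    have le: "Lp_norm \<nu> p (\<lambda>x. Rz h x - Rz (s n) x) \<le> C * (Lp_norm \<nu> p (\<lambda>x. h x - f x) + Lp_norm \<nu> p (\<lambda>x. f x - s n x))" for n
    proof -
      have "Lp_norm \<nu> p (\<lambda>x. h x - s n x) \<le> Lp_norm \<nu> p (\<lambda>x. h x - f x) + Lp_norm \<nu> p (\<lambda>x. f x - s n x)"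
        by (intro Lp_norm_triangle_diff p1 hp s f h)
      then have "C * Lp_norm \<nu> p (\<lambda>x. h x - s n x) \<le> C * (Lp_norm \<nu> p (\<lambda>x. h x - f x) + Lp_norm \<nu> p (\<lambda>x. f x - s n x))"
        using C by (rule mult_left_mono)
      then show ?thesis using lip[OF h s(1), of n] by linarith
    qed
    show "(\<lambda>x. Rz h x - g x) \<in> Lp_space \<nu> p"
      by (rule Lp_Fatou(1)[OF p1(3) _ m lim c le]) (intro Lp_space_diff p1 hp h s)
    show "Lp_norm \<nu> p (\<lambda>x. Rz h x - g x) \<le> C * (Lp_norm \<nu> p (\<lambda>x. h x - f x) + 0)"
      by (rule Lp_Fatou(2)[OF p1(3) _ m lim c le]) (intro Lp_space_diff p1 hp h s)
  qed
  have "g \<in> Lp_space \<nu> p"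
  proof -
    have "(\<lambda>x. Rz (s 0) x - (Rz (s 0) x - g x)) \<in> Lp_space \<nu> p"
      by (intro Lp_space_diff p1 hp s main)
    then show ?thesis by simp
  qed
  then show ?thesis using main(2) by auto
qed

lemma riesz_extension_exists:
  assumes p: "p > 1"
  shows "\<exists>T. riesz_extension \<alpha> \<beta> p T"
proof -
  define C where "C = 42 * (max p (p / (p - 1)) - 1)"
  have p1: "p \<ge> 1" "p \<ge> 0" "p > 0" using p by auto
  have C: "C \<ge> 0" using p by (simp add: C_def max_def)
  have hp: "h \<in> Lp_space \<nu> p" "Rz h \<in> Lp_space \<nu> p" if "real_polynomial_function h" for h
    using p1 that by (auto intro: polynomial_Lp_space continuous_Lp_space_vec continuous_Rz)
  define P where "P = (\<lambda>f g. g \<in> Lp_space \<nu> p \<and> (\<forall>h. real_polynomial_function h \<longrightarrow>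
     Lp_norm \<nu> p (\<lambda>x. Rz h x - g x) \<le> C * Lp_norm \<nu> p (\<lambda>x. h x - f x)))"
  \<comment> \<open>On polynomials the value is prescribed up to null sets, and \<open>Rz\<close> is
    taken; elsewhere any limit will do. By the Lipschitz bound \<open>Rz f\<close> itself satisfies
    \<open>P f\<close>, so both branches obey the same estimate.\<close>
  define T where "T = (\<lambda>f. if real_polynomial_function f then Rz f else (SOME g. P f g))"
  have PT: "P f (T f)" if f: "f \<in> Lp_space \<nu> p" for f
  proof (cases "real_polynomial_function f")
    case True
    have "Lp_norm \<nu> p (\<lambda>x. Rz h x - Rz f x) \<le> C * Lp_norm \<nu> p (\<lambda>x. h x - f x)" if "real_polynomial_function h" for h
      using Rz_Lp_bound[OF real_polynomial_function_diff[OF that True] p] unfolding Rz_diff[OF that True] C_def .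
    then show ?thesis using True hp(2)[OF True] by (simp add: P_def T_def)
  next
    case False
    have "\<exists>g. P f g" unfolding P_def C_def by (rule riesz_limit_exists[OF p f])
    then show ?thesis using False by (simp add: T_def someI_ex)
  qed
  have "riesz_extension \<alpha> \<beta> p T"
    unfolding riesz_extension_def
  proof (intro conjI ballI allI impI)
    fix f :: "real ^ 'n \<Rightarrow> real" assume f: "f \<in> Lp_space \<nu> p"
    show Tf: "T f \<in> Lp_space \<nu> p" using PT[OF f] by (simp add: P_def)
    fix \<epsilon> :: real assume e: "\<epsilon> > 0"
    \<comment> \<open>\<open>T g\<close> and \<open>T f\<close> are compared through
      \<open>Rz h\<close> for a polynomial h within \<delta> of f and hence within 2 \<delta> of g.
      The two errors add up to at most 3 C \<delta>, which is less than 4 (C + 1) \<delta> =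
      \<epsilon>.\<close>
    define \<delta> where "\<delta> = \<epsilon> / (4 * (C + 1))"
    have \<delta>: "\<delta> > 0" using e C by (simp add: \<delta>_def)
    show "\<exists>\<delta>>0. \<forall>g\<in>Lp_space \<nu> p. Lp_norm \<nu> p (\<lambda>x. g x - f x) < \<delta> \<longrightarrow> Lp_norm \<nu> p (\<lambda>x. T g x - T f x) < \<epsilon>"
    proof (intro exI[of _ \<delta>] conjI \<delta> ballI impI)
      fix g assume g: "g \<in> Lp_space \<nu> p" and gf: "Lp_norm \<nu> p (\<lambda>x. g x - f x) < \<delta>"
      have Tg: "T g \<in> Lp_space \<nu> p" using PT[OF g] by (simp add: P_def)
      obtain h where h: "real_polynomial_function h" "Lp_norm \<nu> p (\<lambda>x. h x - f x) < \<delta>"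
        by (rule polynomial_approx[OF p f \<delta>])
      have "Lp_norm \<nu> p (\<lambda>x. h x - g x) \<le> Lp_norm \<nu> p (\<lambda>x. h x - f x) + Lp_norm \<nu> p (\<lambda>x. f x - g x)"
        by (intro Lp_norm_triangle_diff p1 hp h f g)
      then have hg: "Lp_norm \<nu> p (\<lambda>x. h x - g x) \<le> 2 * \<delta>"
        using h(2) gf Lp_norm_minus_commute[of \<nu> p f g] by linarith
      have "Lp_norm \<nu> p (\<lambda>x. T g x - T f x) \<le> Lp_norm \<nu> p (\<lambda>x. T g x - Rz h x) + Lp_norm \<nu> p (\<lambda>x. Rz h x - T f x)"
        by (intro Lp_norm_triangle_diff p1 hp h Tf Tg)
      also have "Lp_norm \<nu> p (\<lambda>x. T g x - Rz h x) = Lp_norm \<nu> p (\<lambda>x. Rz h x - T g x)" by (rule Lp_norm_minus_commute)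
      also have "\<dots> \<le> C * Lp_norm \<nu> p (\<lambda>x. h x - g x)" using PT[OF g] h(1) by (simp add: P_def)
      also have "C * Lp_norm \<nu> p (\<lambda>x. h x - g x) \<le> C * (2 * \<delta>)" using C hg by (intro mult_left_mono)
      also have "Lp_norm \<nu> p (\<lambda>x. Rz h x - T f x) \<le> C * Lp_norm \<nu> p (\<lambda>x. h x - f x)" using PT[OF f] h(1) by (simp add: P_def)
      also have "C * Lp_norm \<nu> p (\<lambda>x. h x - f x) \<le> C * \<delta>" using C h(2) by (intro mult_left_mono) auto
      also have "C * (2 * \<delta>) + C * \<delta> = 3 * C * \<delta>" by simp
      also have "\<dots> < 4 * (C + 1) * \<delta>" using C \<delta> by (intro mult_strict_right_mono) auto
      also have "\<dots> = \<epsilon>" using C by (simp add: \<delta>_def)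
      finally show "Lp_norm \<nu> p (\<lambda>x. T g x - T f x) < \<epsilon>" by simp
    qed
  next
    fix f :: "real ^ 'n \<Rightarrow> real" assume "real_polynomial_function f"
    then show "has_riesz_transform \<alpha> \<beta> f (T f)" by (simp add: T_def has_riesz_transform_Rz)
  qed
  then show ?thesis by blast
qed

lemma riesz_extension_bound:
  assumes p: "p > 1" and R: "riesz_extension \<alpha> \<beta> p R" and f: "f \<in> Lp_space \<nu> p" "(\<integral>y. f y \<partial>\<nu>) = 0"
  shows "Lp_norm \<nu> p (R f) \<le> 21 * (max p (p / (p - 1)) - 1) * Lp_norm \<nu> p f"
proof (rule field_le_epsilon)
  fix \<eta> :: real assume \<eta>: "\<eta> > 0"
  define C where "C = 21 * (max p (p / (p - 1)) - 1)"
  have p1: "p \<ge> 1" "p \<ge> 0" "p > 0" using p by auto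
  have C: "C \<ge> 0" using p by (simp add: C_def max_def)
  define \<epsilon> where "\<epsilon> = \<eta> / (C + 1)"
  have \<epsilon>: "\<epsilon> > 0" using \<eta> C by (simp add: \<epsilon>_def)
  obtain \<delta> where \<delta>: "\<delta> > 0" "\<And>g. g \<in> Lp_space \<nu> p \<Longrightarrow> Lp_norm \<nu> p (\<lambda>x. g x - f x) < \<delta> \<Longrightarrow> Lp_norm \<nu> p (\<lambda>x. R g x - R f x) < \<epsilon>"
    using R f(1) \<epsilon> unfolding riesz_extension_def by meson
  have RLp: "R g \<in> Lp_space \<nu> p" if "g \<in> Lp_space \<nu> p" for g using R that unfolding riesz_extension_def by blast
  \<comment> \<open>Halved because subtracting the mean from \<open>k\<close> may double its
    distance to f, whose own mean is zero.\<close>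
  have "min \<delta> \<epsilon> / 2 > 0" using \<delta>(1) \<epsilon> by simp
  then obtain k where k: "real_polynomial_function k" "Lp_norm \<nu> p (\<lambda>x. k x - f x) < min \<delta> \<epsilon> / 2"
    by (rule polynomial_approx[OF p f(1)])
  define h where "h = (\<lambda>x. k x - (\<integral>y. k y \<partial>\<nu>))"
  have h: "real_polynomial_function h" unfolding h_def
    by (rule real_polynomial_function_diff[OF k(1) real_polynomial_function.intros(2)])
  have kp: "k \<in> Lp_space \<nu> p" and hp: "h \<in> Lp_space \<nu> p" using k(1) h p1 by (auto intro: polynomial_Lp_space)
  have "integrable \<nu> k" using kp p1 by (intro nu.Lp_space_integrable[of p])
  then have h0: "(\<integral>x. h x \<partial>\<nu>) = 0" by (simp add: h_def nu.prob_space)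
  have "Lp_norm \<nu> p (\<lambda>x. h x - f x) \<le> 2 * Lp_norm \<nu> p (\<lambda>x. k x - f x)"
    using mean_Lp_norm_diff[OF p f(1) kp] f(2) by (simp add: h_def)
  then have hf: "Lp_norm \<nu> p (\<lambda>x. h x - f x) < min \<delta> \<epsilon>" using k(2) by linarith
  have "AE x in \<nu>. R h x = Rz h x"
    using R h by (intro has_riesz_transform_unique) (auto simp: riesz_extension_def)
  then have Rh: "Lp_norm \<nu> p (R h) = Lp_norm \<nu> p (Rz h)"
    by (rule Lp_norm_cong_AE) (use RLp[OF hp] in \<open>auto simp: Lp_space_def intro: continuous_measurable_\<nu> continuous_Rz\<close>)
  have "Lp_norm \<nu> p (R f) \<le> Lp_norm \<nu> p (R h) + Lp_norm \<nu> p (\<lambda>x. R f x - R h x)"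
    by (intro Lp_norm_le_diff p1 RLp hp f)
  also have "Lp_norm \<nu> p (\<lambda>x. R f x - R h x) = Lp_norm \<nu> p (\<lambda>x. R h x - R f x)" by (rule Lp_norm_minus_commute)
  also have "\<dots> \<le> \<epsilon>" using \<delta>(2)[OF hp] hf by simp
  also have "Lp_norm \<nu> p (R h) \<le> C * Lp_norm \<nu> p h" unfolding Rh C_def by (rule riesz_bound[OF h h0 p])
  also have "Lp_norm \<nu> p h \<le> Lp_norm \<nu> p f + Lp_norm \<nu> p (\<lambda>x. h x - f x)"
    by (intro Lp_norm_le_diff p1 hp f)
  also have "Lp_norm \<nu> p (\<lambda>x. h x - f x) \<le> \<epsilon>" using hf by simp
  finally have "Lp_norm \<nu> p (R f) \<le> C * (Lp_norm \<nu> p f + \<epsilon>) + \<epsilon>" using C by (simp add: mult_left_mono)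
  also have "\<dots> = C * Lp_norm \<nu> p f + (C + 1) * \<epsilon>" by (simp add: algebra_simps)
  also have "(C + 1) * \<epsilon> = \<eta>" using C by (simp add: \<epsilon>_def)
  finally show "Lp_norm \<nu> p (R f) \<le> 21 * (max p (p / (p - 1)) - 1) * Lp_norm \<nu> p f + \<eta>" unfolding C_def .
qed

end

theorem theorem9:
  fixes \<alpha> \<beta> :: "real ^ 'n" and p :: real
  assumes "\<forall>i. \<alpha> $ i \<ge> - 1 / 2" and "\<forall>i. \<beta> $ i \<ge> - 1 / 2" and "1 < p"
  shows "(\<exists>R. riesz_extension \<alpha> \<beta> p R) \<and>
    (\<forall>R. riesz_extension \<alpha> \<beta> p R \<longrightarrow>
      (\<forall>f \<in> Lp_space (jacobi_measure \<alpha> \<beta>) p.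
        (\<integral>y. f y \<partial>jacobi_measure \<alpha> \<beta>) = 0 \<longrightarrow>
        Lp_norm (jacobi_measure \<alpha> \<beta>) p (R f)
          \<le> 24 * (max p (p / (p - 1)) - 1) * Lp_norm (jacobi_measure \<alpha> \<beta>) p f))"
proof -
  interpret jacobi \<alpha> \<beta> using assms by unfold_locales auto
  have "21 * (max p (p / (p - 1)) - 1) * Lp_norm \<nu> p f \<le> 24 * (max p (p / (p - 1)) - 1) * Lp_norm \<nu> p f"
    for f :: "real ^ 'n \<Rightarrow> real"
    using assms(3) by (intro mult_right_mono Lp_norm_nonneg) (auto simp: max_def)
  then show ?thesis
    using riesz_extension_exists[OF assms(3)] riesz_extension_bound[OF assms(3)] by (meson order.trans)
qed

end
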